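(* Assume the Continuum Hypothesis. Let $\alpha$ be any ordinal with $\alpha\le\omega_1$. Then there exists a compact sequential Hausdorff space $K$ which is a quotient space of $\beta\omega$ and whose sequential order is $\sigma(K)=\alpha$.
   Context: $\beta\omega$ denotes the Čech–Stone compactification of the discrete space $\omega$ (the space of all ultrafilters on $\omega$). A quotient space of $\beta\omega$ is a space $\beta\omega/\approx$ with the quotient topology, for some equivalence relation $\approx$ on $\beta\omega$. For a topological space $X$ and $M\subseteq X$, the sequential closure of $M$ is $\mathrm{seqcl}(M)=\{x\in X:\text{ there is a sequence }(x_n)_{n\in\omega}\text{ of points of }M\text{ converging to }x\}$. For ordinals $\alpha\le\omega_1$ define inductively: $\mathrm{seqcl}_0(M)=M$; $\mathrm{seqcl}_{\alpha+1}(M)=\mathrm{seqcl}(\mathrm{seqcl}_\alpha(M))$; $\mathrm{seqcl}_\alpha(M)=\bigcup_{\beta<\alpha}\mathrm{seqcl}_\beta(M)$ if $\alpha$ is a limit ordinal. $X$ is sequential if $\mathrm{seqcl}_{\omega_1}(M)=\overline{M}$ for every $M\subseteq X$ (equivalently, every sequentially closed subset of $X$ is closed). The sequential order of a sequential space $X$ is $\sigma(X)=\min\{\alpha\le\omega_1:\ \mathrm{seqcl}_\alpha(M)=\overline{M}\text{ for all }M\subseteq X\}$. *)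

theory Defs
  imports "HOL-Analysis.Analysis"
begin

section \<open>The ordinals up to \<open>\<omega>\<^sub>1\<close>\<close>

text \<open>
  The well-order \<open>cardSuc natLeq\<close> is \<open>\<omega>\<^sub>1\<close>: a well-order of least order type among those of
  uncountable cardinality. An ordinal \<open>\<alpha> \<le> \<omega>\<^sub>1\<close> is represented by the initial segment of
  \<open>\<omega>\<^sub>1\<close> of order type \<open>\<alpha>\<close>, the whole field representing \<open>\<omega>\<^sub>1\<close> itself; the order is
  inclusion. The lemmas \<open>ord1_le_omega1\<close> and \<open>countable_below_iff\<close> show that the type has
  order type \<open>\<omega>\<^sub>1 + 1\<close>.
\<close>

abbreviation omega1_rel :: "nat set rel"
  where "omega1_rel \<equiv> cardSuc natLeq"

lemma Well_order_omega1_rel: "Well_order omega1_rel"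
  by (rule cardSuc_Well_order[OF natLeq_Card_order])

lemma wo_rel_omega1_rel: "wo_rel omega1_rel"
  unfolding wo_rel_def by (rule Well_order_omega1_rel)

typedef ord1 = "{A. Order_Relation.ofilter omega1_rel A}"
  by (auto intro: exI[of _ "{}"] simp: Order_Relation.ofilter_def)

instantiation ord1 :: wellorder
begin

definition less_eq_ord1 :: "ord1 \<Rightarrow> ord1 \<Rightarrow> bool"
  where "\<alpha> \<le> \<beta> \<longleftrightarrow> Rep_ord1 \<alpha> \<subseteq> Rep_ord1 \<beta>"

definition less_ord1 :: "ord1 \<Rightarrow> ord1 \<Rightarrow> bool"
  where "\<alpha> < \<beta> \<longleftrightarrow> Rep_ord1 \<alpha> \<subset> Rep_ord1 \<beta>"

instance
proof intro_classes
  fix \<alpha> \<beta> \<gamma> :: ord1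
  show "\<alpha> < \<beta> \<longleftrightarrow> \<alpha> \<le> \<beta> \<and> \<not> \<beta> \<le> \<alpha>" "\<alpha> \<le> \<alpha>" "\<alpha> \<le> \<beta> \<Longrightarrow> \<beta> \<le> \<gamma> \<Longrightarrow> \<alpha> \<le> \<gamma>"
    by (auto simp: less_eq_ord1_def less_ord1_def)
  show "\<alpha> \<le> \<beta> \<Longrightarrow> \<beta> \<le> \<alpha> \<Longrightarrow> \<alpha> = \<beta>"
    by (auto simp: less_eq_ord1_def simp flip: Rep_ord1_inject)
  show "\<alpha> \<le> \<beta> \<or> \<beta> \<le> \<alpha>"
    using wo_rel.ofilter_linord[OF wo_rel_omega1_rel] Rep_ord1[of \<alpha>] Rep_ord1[of \<beta>]
    by (auto simp: less_eq_ord1_def)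
next
  fix P :: "ord1 \<Rightarrow> bool" and \<alpha> :: ord1
  assume step: "\<And>\<alpha>. (\<And>\<beta>. \<beta> < \<alpha> \<Longrightarrow> P \<beta>) \<Longrightarrow> P \<alpha>"
  have "{(\<alpha>, \<beta>::ord1). \<alpha> < \<beta>} \<subseteq> inv_image ordLess (\<lambda>\<alpha>. Restr omega1_rel (Rep_ord1 \<alpha>))"
    using ofilter_subset_ordLess[OF Well_order_omega1_rel] Rep_ord1
    by (auto simp: less_ord1_def)
  then have "wf {(\<alpha>, \<beta>::ord1). \<alpha> < \<beta>}"
    using wf_ordLess wf_inv_image wf_subset by blast
  then show "P \<alpha>"
    by (induction rule: wf_induct_rule) (use step in auto)
qed

end

definition omega1 :: ord1
  where "omega1 = Abs_ord1 (Field omega1_rel)"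

lemma Rep_omega1: "Rep_ord1 omega1 = Field omega1_rel"
  unfolding omega1_def
  by (rule Abs_ord1_inverse) (simp add: wo_rel.Field_ofilter wo_rel_omega1_rel)

lemma ord1_le_omega1: "\<alpha> \<le> omega1"
  using Rep_ord1[of \<alpha>] by (auto simp: less_eq_ord1_def Rep_omega1 Order_Relation.ofilter_def)

lemma countable_iff_le_natLeq: "countable A \<longleftrightarrow> (card_of A, natLeq) \<in> ordLeq"
proof -
  have "countable A \<longleftrightarrow> (card_of A, card_of (UNIV :: nat set)) \<in> ordLeq"
    unfolding countable_def card_of_ordLeq[symmetric] by auto
  then show ?thesis
    using card_of_nat ordLeq_ordIso_trans ordIso_symmetric by blast
qed

lemma countable_below_iff:
  includes cardinal_syntax
  shows "countable {\<beta>. \<beta> < \<alpha>} \<longleftrightarrow> \<alpha> \<noteq> omega1"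
proof
  let ?r = omega1_rel
  have ofil: "Order_Relation.ofilter ?r (underS ?r a)" for a
    using wo_rel.underS_ofilter[OF wo_rel_omega1_rel] by blast
  have proper: "underS ?r a \<subset> Field ?r" if "a \<in> Field ?r" for a
    using that by (intro underS_Field3) auto
  have inj: "inj_on (underS ?r) (Field ?r)"
    using wo_rel.suc_underS[OF wo_rel_omega1_rel] by (metis inj_onI)
  {
    assume "countable {\<beta>. \<beta> < \<alpha>}"
    moreover have "uncountable {\<beta>. \<beta> < omega1}"
    proof
      assume "countable {\<beta>. \<beta> < omega1}"
      moreover have "inj_on (\<lambda>a. Abs_ord1 (underS ?r a)) (Field ?r)"
        using inj ofil by (auto simp: inj_on_def Abs_ord1_inject)
      moreover have "(\<lambda>a. Abs_ord1 (underS ?r a)) ` Field ?r \<subseteq> {\<beta>. \<beta> < omega1}"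
        using proper by (simp add: image_subset_iff less_ord1_def Rep_omega1 Abs_ord1_inverse ofil)
      ultimately have "countable (Field ?r)"
        by (meson countable_image_inj_on countable_subset)
      then have "card_of (Field ?r) \<le>o natLeq"
        using countable_iff_le_natLeq by blast
      then show False
        using card_of_Field_ordIso[OF cardSuc_Card_order[OF natLeq_Card_order]]
          cardSuc_greater[OF natLeq_Card_order] not_ordLess_ordLeq
          ordIso_ordLeq_trans ordIso_symmetric by blast
    qed
    ultimately show "\<alpha> \<noteq> omega1" by blast
  next
    assume "\<alpha> \<noteq> omega1"
    then have "Rep_ord1 \<alpha> \<subset> Field ?r"
      using ord1_le_omega1[of \<alpha>] by (metis Rep_omega1 less_ord1_def order_le_less)
    then have less: "Restr ?r (Rep_ord1 \<alpha>) <o ?r"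
      using ofilter_ordLess[OF Well_order_omega1_rel] Rep_ord1 by blast
    have "Field (Restr ?r (Rep_ord1 \<alpha>)) = Rep_ord1 \<alpha>"
      using Rep_ord1[of \<alpha>] wo_rel.REFL[OF wo_rel_omega1_rel]
      by (intro Refl_Field_Restr2) (auto simp: Order_Relation.ofilter_def)
    then have "card_of (Rep_ord1 \<alpha>) \<le>o Restr ?r (Rep_ord1 \<alpha>)"
      by (metis Well_order_omega1_rel Well_order_Restr card_of_least well_order_on_Well_order)
    then have "card_of (Rep_ord1 \<alpha>) <o ?r"
      using less ordLeq_ordLess_trans by blast
    then have "card_of (Rep_ord1 \<alpha>) \<le>o natLeq"
      using cardSuc_ordLess_ordLeq cardSuc_ordLeq_ordLess natLeq_Card_order card_of_Card_order
      by blast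
    then have "countable (Rep_ord1 \<alpha>)"
      using countable_iff_le_natLeq by blast
    moreover have "{\<beta>. \<beta> < \<alpha>} \<subseteq> (\<lambda>a. Abs_ord1 (underS ?r a)) ` Rep_ord1 \<alpha>"
    proof
      fix \<beta> assume "\<beta> \<in> {\<beta>. \<beta> < \<alpha>}"
      then have lt: "Rep_ord1 \<beta> \<subset> Rep_ord1 \<alpha>"
        by (simp add: less_ord1_def)
      then obtain b where b: "b \<in> Rep_ord1 \<alpha>" "b \<notin> Rep_ord1 \<beta>" by blast
      have "Rep_ord1 \<beta> \<noteq> Field ?r"
        using lt \<open>Rep_ord1 \<alpha> \<subset> Field ?r\<close> by blast
      then obtain a where a: "a \<in> Field ?r" "Rep_ord1 \<beta> = underS ?r a"
        using wo_rel.ofilter_underS_Field[OF wo_rel_omega1_rel, of "Rep_ord1 \<beta>"] Rep_ord1[of \<beta>]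
        by auto
      have "(a, b) \<in> ?r"
      proof -
        have "b \<in> Field ?r"
          using b \<open>Rep_ord1 \<alpha> \<subset> Field ?r\<close> by blast
        then have "(a, b) \<in> ?r \<or> (b, a) \<in> ?r"
          using a wo_rel.TOTALS[OF wo_rel_omega1_rel] by blast
        then show ?thesis
          using a b wo_rel.REFL[OF wo_rel_omega1_rel]
          by (auto simp: underS_def refl_on_def)
      qed
      then have "a \<in> Rep_ord1 \<alpha>"
        using b Rep_ord1[of \<alpha>] by (auto simp: Order_Relation.ofilter_def under_def)
      then show "\<beta> \<in> (\<lambda>a. Abs_ord1 (underS ?r a)) ` Rep_ord1 \<alpha>"
        using a by (metis Rep_ord1_inverse image_eqI)
    qed
    ultimately show "countable {\<beta>. \<beta> < \<alpha>}"
      by (meson countable_image countable_subset)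
  }
qed

definition continuum_hypothesis :: bool
  where "continuum_hypothesis \<longleftrightarrow> (card_of (UNIV :: real set), cardSuc natLeq) \<in> ordIso"


section \<open>Sequential closure and sequential order\<close>

definition seqcl :: "'a topology \<Rightarrow> 'a set \<Rightarrow> 'a set"
  where "seqcl X M = {x \<in> topspace X. \<exists>s :: nat \<Rightarrow> 'a. (\<forall>n. s n \<in> M) \<and> limitin X s x sequentially}"

definition ord1_succ_of :: "ord1 \<Rightarrow> ord1 \<Rightarrow> bool"
  where "ord1_succ_of \<alpha> \<beta> \<longleftrightarrow> \<beta> < \<alpha> \<and> (\<forall>\<gamma>. \<gamma> < \<alpha> \<longrightarrow> \<gamma> \<le> \<beta>)"

lemma ord1_succ_of_unique: "ord1_succ_of \<alpha> \<beta> \<Longrightarrow> ord1_succ_of \<alpha> \<gamma> \<Longrightarrow> \<beta> = \<gamma>"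
  by (auto simp: ord1_succ_of_def intro: order_antisym)

lemma the_pred: "ord1_succ_of \<alpha> \<beta> \<Longrightarrow> (THE \<beta>. ord1_succ_of \<alpha> \<beta>) = \<beta>"
  using ord1_succ_of_unique by blast

lemma the_pred_less: "ord1_succ_of \<alpha> \<beta> \<Longrightarrow> (THE \<beta>. ord1_succ_of \<alpha> \<beta>) < \<alpha>"
  by (simp add: the_pred) (simp add: ord1_succ_of_def)

function seqcl_iter :: "'a topology \<Rightarrow> ord1 \<Rightarrow> 'a set \<Rightarrow> 'a set"
  where "seqcl_iter X \<alpha> M =
    (if \<forall>\<beta>. \<not> \<beta> < \<alpha> then M
     else if \<exists>\<beta>. ord1_succ_of \<alpha> \<beta> then seqcl X (seqcl_iter X (THE \<beta>. ord1_succ_of \<alpha> \<beta>) M)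
     else (\<Union>\<beta>\<in>{\<beta>. \<beta> < \<alpha>}. seqcl_iter X \<beta> M))"
  by pat_completeness auto
termination
proof (relation "inv_image {(\<beta>, \<alpha>). \<beta> < \<alpha>} (\<lambda>(X, \<alpha>, M). \<alpha>)")
  show "wf (inv_image {(\<beta>, \<alpha>::ord1). \<beta> < \<alpha>} (\<lambda>(X :: 'a topology, \<alpha>, M :: 'a set). \<alpha>))"
    by (intro wf_inv_image wf)
qed (auto simp: the_pred_less)

declare seqcl_iter.simps [simp del]

lemma seqcl_iter_zero: "(\<And>\<beta>. \<not> \<beta> < \<alpha>) \<Longrightarrow> seqcl_iter X \<alpha> M = M"
  by (subst seqcl_iter.simps) simp

lemma seqcl_iter_succ: "ord1_succ_of \<alpha> \<beta> \<Longrightarrow> seqcl_iter X \<alpha> M = seqcl X (seqcl_iter X \<beta> M)"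
  by (subst seqcl_iter.simps) (auto simp: the_pred ord1_succ_of_def)

lemma seqcl_iter_limit:
  "\<beta> < \<alpha> \<Longrightarrow> (\<And>\<beta>. \<not> ord1_succ_of \<alpha> \<beta>) \<Longrightarrow> seqcl_iter X \<alpha> M = (\<Union>\<beta>\<in>{\<beta>. \<beta> < \<alpha>}. seqcl_iter X \<beta> M)"
  by (subst seqcl_iter.simps) auto

definition sequential_space :: "'a topology \<Rightarrow> bool"
  where "sequential_space X \<longleftrightarrow> (\<forall>M \<subseteq> topspace X. seqcl_iter X omega1 M = X closure_of M)"

text \<open>Only meaningful for sequential spaces; otherwise the \<open>LEAST\<close> ranges over the empty set.\<close>

definition sequential_order :: "'a topology \<Rightarrow> ord1"
  where "sequential_order X = (LEAST \<alpha>. \<forall>M \<subseteq> topspace X. seqcl_iter X \<alpha> M = X closure_of M)"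


section \<open>The space \<open>\<beta>\<omega>\<close> and quotient spaces\<close>

text \<open>An ultrafilter is a \<open>nat filter\<close>; the set \<open>A\<close> belongs to it iff \<open>n \<in> A\<close> eventually holds.\<close>

definition ultrafilter :: "'a filter \<Rightarrow> bool"
  where "ultrafilter F \<longleftrightarrow>
    F \<noteq> bot \<and> (\<forall>A. eventually (\<lambda>n. n \<in> A) F \<or> eventually (\<lambda>n. n \<notin> A) F)"

definition beta_omega :: "nat filter topology"
  where "beta_omega =
    topology_generated_by (range (\<lambda>A. {F. ultrafilter F \<and> eventually (\<lambda>n. n \<in> A) F}))"

lemma topspace_beta_omega: "topspace beta_omega = {F. ultrafilter F}"
  unfolding beta_omega_def topology_generated_by_topspace
  by (auto intro!: exI[of _ UNIV])

definition quotient_space :: "'a topology \<Rightarrow> 'a rel \<Rightarrow> 'a set topology"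
  where "quotient_space X E =
    topology (\<lambda>U. U \<subseteq> topspace X // E \<and> openin X {x \<in> topspace X. E `` {x} \<in> U})"

lemma openin_quotient_space:
  "openin (quotient_space X E) U \<longleftrightarrow>
    U \<subseteq> topspace X // E \<and> openin X {x \<in> topspace X. E `` {x} \<in> U}"
proof -
  have "istopology (\<lambda>U. U \<subseteq> topspace X // E \<and> openin X {x \<in> topspace X. E `` {x} \<in> U})"
    unfolding istopology_def
  proof (intro conjI allI impI)
    fix S T
    assume "S \<subseteq> topspace X // E \<and> openin X {x \<in> topspace X. E `` {x} \<in> S}"
      and "T \<subseteq> topspace X // E \<and> openin X {x \<in> topspace X. E `` {x} \<in> T}"
    moreover have "{x \<in> topspace X. E `` {x} \<in> S \<inter> T} =
        {x \<in> topspace X. E `` {x} \<in> S} \<inter> {x \<in> topspace X. E `` {x} \<in> T}" by blast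
    ultimately show "S \<inter> T \<subseteq> topspace X // E" "openin X {x \<in> topspace X. E `` {x} \<in> S \<inter> T}"
      by auto
  next
    fix \<K>
    assume *: "\<forall>K\<in>\<K>. K \<subseteq> topspace X // E \<and> openin X {x \<in> topspace X. E `` {x} \<in> K}"
    show "\<Union>\<K> \<subseteq> topspace X // E" using * by blast
    have "{x \<in> topspace X. E `` {x} \<in> \<Union>\<K>} = (\<Union>K\<in>\<K>. {x \<in> topspace X. E `` {x} \<in> K})" by blast
    then show "openin X {x \<in> topspace X. E `` {x} \<in> \<Union>\<K>}" using * by auto
  qed
  then show ?thesis
    unfolding quotient_space_def by (simp add: topology_inverse')
qed

lemma topspace_quotient_space: "topspace (quotient_space X E) = topspace X // E"
proof -
  have "{x \<in> topspace X. E `` {x} \<in> topspace X // E} = topspace X"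
    by (auto simp: quotient_def)
  then have "openin (quotient_space X E) (topspace X // E)"
    by (simp add: openin_quotient_space)
  then show ?thesis
    using openin_quotient_space openin_subset openin_topspace subset_antisym by metis
qed

lemma quotient_map_quotient_space: "quotient_map X (quotient_space X E) (\<lambda>x. E `` {x})"
  unfolding quotient_map_def
  by (auto simp: topspace_quotient_space openin_quotient_space quotient_def)

end

theory Submission
  imports Defs
begin

text \<open>
  A Boolean algebra \<open>B\<close> of subsets of \<open>\<omega>\<close> identifies two ultrafilters with the same trace on \<open>B\<close>, and
  the quotient of \<open>\<beta>\<omega>\<close> is the Stone space of \<open>B\<close>. A sequentially compact space of this kind is
  sequential as soon as it carries a countable ordinal rank such that every point has a neighbourhood
  in which all other points have smaller rank, and if limit ranks are omitted the rank of a point bounds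
  the number of iterated sequential closures needed to reach it.

  For a successor \<open>\<alpha>\<close>, start with a convergent sequence whose limit has rank \<open>\<alpha>\<close> and build an increasing
  \<open>\<omega>\<^sub>1\<close>-chain of countable algebras. Whenever a sequence of points of rank at most \<open>\<gamma>\<close> converges
  to a point of rank above \<open>\<gamma> + 1\<close>, that point can be split, so that a subsequence converges to a new
  point of rank \<open>\<gamma> + 1\<close> instead. Under CH every sequence is dealt with. In the limit a point of
  rank \<open>\<alpha>\<close> is in the closure of \<open>\<omega>\<close>, but it is not reached from \<open>\<omega>\<close> in fewer than \<open>\<alpha>\<close> steps. Ranks
  only decrease along the chain, so no point is moved infinitely often.

  For a limit \<open>\<alpha>\<close>, spaces of all successor orders below \<open>\<alpha>\<close> are placed on the members of a maximal
  almost disjoint family and one point is added at infinity; by maximality two further sequential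
  closures reach it.
\<close>

section \<open>Ultrafilters\<close>

text \<open>The two bounds on the order compete. The point of rank \<alpha> has to survive, yet
  sequences of points of rank at most \<gamma> must not lead beyond rank \<gamma> + 1. Splitting
  reconciles them: the sequence gets a new limit, while the old point keeps a representative and its
  rank. This takes a set that catches infinitely many terms of the sequence and still avoids that
  representative; it is built along a countable neighbourhood base. Hence every stage before
  \<open>\<omega>\<^sub>1\<close> has to be countable, and the continuum many sequences have to be
  met in \<open>\<omega>\<^sub>1\<close> steps.

  A point of countable limit rank \<lambda> could be the limit of a sequence with ranks cofinal in
  \<lambda> and would then be reached only after \<lambda> + 1 closures. So limit ranks are left
  out, and a limit order needs another construction. There the ranks of the components are cofinal
  in \<alpha>, while the point at infinity gets the formal rank \<open>omega1\<close> and is handled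
  separately.\<close>

definition has :: "'a filter \<Rightarrow> 'a set \<Rightarrow> bool"
  where "has F A \<longleftrightarrow> eventually (\<lambda>x. x \<in> A) F"

lemma has_UNIV [simp]: "has F UNIV"
  by (simp add: has_def)

lemma has_Int [simp]: "has F (A \<inter> B) \<longleftrightarrow> has F A \<and> has F B"
  by (simp add: has_def eventually_conj_iff)

lemma has_mono: "has F A \<Longrightarrow> A \<subseteq> B \<Longrightarrow> has F B"
  unfolding has_def by (auto elim: eventually_mono)

lemma has_empty [simp]: "ultrafilter F \<Longrightarrow> \<not> has F {}"
  by (simp add: has_def ultrafilter_def eventually_False)

lemma has_Compl [simp]: "ultrafilter F \<Longrightarrow> has F (- A) \<longleftrightarrow> \<not> has F A"
  using has_Int[of F A "- A"] has_empty[of F]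
  by (auto simp: has_def ultrafilter_def)

lemma has_Un [simp]: "ultrafilter F \<Longrightarrow> has F (A \<union> B) \<longleftrightarrow> has F A \<or> has F B"
  using has_Compl[of F "A \<union> B"] has_Compl[of F A] has_Compl[of F B] has_Int[of F "- A" "- B"]
  by (auto simp del: has_Compl has_Int)

lemma has_Diff [simp]: "ultrafilter F \<Longrightarrow> has F (A - B) \<longleftrightarrow> has F A \<and> \<not> has F B"
  by (simp add: Diff_eq)

lemma has_UN_finite:
  assumes "ultrafilter F" "finite I"
  shows "has F (\<Union>i\<in>I. A i) \<longleftrightarrow> (\<exists>i\<in>I. has F (A i))"
  using assms(2) by induction (use assms(1) in auto)

lemma has_Union_finite:
  "ultrafilter F \<Longrightarrow> finite \<T> \<Longrightarrow> has F (\<Union>\<T>) \<longleftrightarrow> (\<exists>A\<in>\<T>. has F A)"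
  using has_UN_finite[of F \<T> "\<lambda>A. A"] by simp

lemma has_finite:
  assumes "ultrafilter F" "finite A" "has F A"
  obtains n where "n \<in> A" "has F {n}"
  using assms has_UN_finite[of F A "\<lambda>n. {n}"] by auto

lemma has_singleton:
  assumes "ultrafilter F" "has F {n}"
  shows "has F A \<longleftrightarrow> n \<in> A"
proof -
  have "has F A \<longleftrightarrow> has F (A \<inter> {n})" using assms by simp
  then show ?thesis using assms by (cases "n \<in> A") (auto simp: Int_insert_right)
qed

lemma ultrafilter_principal: "ultrafilter (principal {n})"
  by (auto simp: ultrafilter_def eventually_principal principal_eq_bot_iff)

lemma has_principal [simp]: "has (principal {n}) A \<longleftrightarrow> n \<in> A"
  by (simp add: has_def eventually_principal)

text \<open>Zorn's lemma gives a maximal proper family that contains \<open>F\<close> and is closed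
  under intersections and supersets. It decides every set \<open>A\<close>: if it contained neither
  \<open>A\<close> nor the complement, adding \<open>A\<close> would generate a larger proper
  family.\<close>

lemma ultrafilter_exists:
  fixes F :: "'a filter"
  assumes "F \<noteq> bot"
  obtains G where "ultrafilter G" "G \<le> F"
proof -
  define \<P> where "\<P> = {S. {A. has F A} \<subseteq> S \<and> {} \<notin> S \<and> (\<forall>A\<in>S. \<forall>B\<in>S. A \<inter> B \<in> S)
    \<and> (\<forall>A\<in>S. \<forall>B. A \<subseteq> B \<longrightarrow> B \<in> S)}"
  have "\<exists>M\<in>\<P>. \<forall>X\<in>\<P>. M \<subseteq> X \<longrightarrow> X = M"
  proof (rule subset_Zorn_nonempty)
    have "\<not> has F {}"
      using assms by (simp add: has_def eventually_False)
    then have "{A. has F A} \<in> \<P>"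
      unfolding \<P>_def by (auto intro: has_mono)
    then show "\<P> \<noteq> {}" by blast
  next
    fix \<C> assume ne: "\<C> \<noteq> {}" and ch: "subset.chain \<P> \<C>"
    have sub: "C \<in> \<P>" if "C \<in> \<C>" for C
      using ch that by (auto simp: subset.chain_def)
    have cmp: "C \<subseteq> D \<or> D \<subseteq> C" if "C \<in> \<C>" "D \<in> \<C>" for C D
      using ch that by (auto simp: subset.chain_def)
    have "A \<inter> B \<in> \<Union>\<C>" if "A \<in> C" "B \<in> D" "C \<in> \<C>" "D \<in> \<C>" for A B C D
    proof -
      have "\<exists>E\<in>\<C>. A \<in> E \<and> B \<in> E" using cmp[OF that(3,4)] that by blast
      then obtain E where E: "E \<in> \<C>" "A \<in> E" "B \<in> E" by blast
      then have "A \<inter> B \<in> E" using sub[OF E(1)] unfolding \<P>_def by simp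
      then show ?thesis using E by blast
    qed
    moreover have "{A. has F A} \<subseteq> \<Union>\<C>"
      using ne sub unfolding \<P>_def by fast
    moreover have "{} \<notin> \<Union>\<C>"
      using sub unfolding \<P>_def by fast
    moreover have "B \<in> \<Union>\<C>" if "A \<in> C" "C \<in> \<C>" "A \<subseteq> B" for A B C
      using sub[OF that(2)] that unfolding \<P>_def mem_Collect_eq by (metis UnionI)
    ultimately show "\<Union>\<C> \<in> \<P>" unfolding \<P>_def mem_Collect_eq by (metis UnionE)
  qed
  then obtain M where M: "M \<in> \<P>" and max: "\<And>X. X \<in> \<P> \<Longrightarrow> M \<subseteq> X \<Longrightarrow> X = M" by blast
  have MF: "has F A \<Longrightarrow> A \<in> M" and M0: "{} \<notin> M"
    and MI: "A \<in> M \<Longrightarrow> B \<in> M \<Longrightarrow> A \<inter> B \<in> M" and MU: "A \<in> M \<Longrightarrow> A \<subseteq> B \<Longrightarrow> B \<in> M" for A B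
    using M unfolding \<P>_def by auto
  have dec: "A \<in> M \<or> - A \<in> M" for A
  proof (rule ccontr)
    assume *: "\<not> (A \<in> M \<or> - A \<in> M)"
    let ?X = "{C. \<exists>B\<in>M. B \<inter> A \<subseteq> C}"
    have "B \<inter> A \<noteq> {}" if "B \<in> M" for B
      using * MU[OF that, of "- A"] by blast
    then have "{} \<notin> ?X" by simp
    moreover have "C \<inter> D \<in> ?X" if CD: "C \<in> ?X" "D \<in> ?X" for C D
    proof -
      obtain B B' where B: "B \<in> M" "B \<inter> A \<subseteq> C" "B' \<in> M" "B' \<inter> A \<subseteq> D"
        using CD by auto
      then have "B \<inter> B' \<in> M" "(B \<inter> B') \<inter> A \<subseteq> C \<inter> D" using MI by auto
      then show ?thesis by auto
    qed
    moreover have "{A. has F A} \<subseteq> ?X" using MF by auto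
    moreover have "D \<in> ?X" if "C \<in> ?X" "C \<subseteq> D" for C D
      using that by auto
    ultimately have "?X \<in> \<P>"
      unfolding \<P>_def mem_Collect_eq[of ?X] by (intro conjI ballI allI impI)
    then have "?X = M" by (rule max) blast
    moreover have "A \<in> ?X" using MF[OF has_UNIV] by blast
    ultimately show False using * by blast
  qed
  let ?G = "Abs_filter (\<lambda>P. {x. P x} \<in> M)"
  have ev: "eventually P ?G \<longleftrightarrow> {x. P x} \<in> M" for P
  proof (rule eventually_Abs_filter, rule is_filter.intro)
    show "{x. True} \<in> M" using MF[OF has_UNIV] by simp
    show "{x. P x} \<in> M \<Longrightarrow> {x. Q x} \<in> M \<Longrightarrow> {x. P x \<and> Q x} \<in> M" for P Q
      using MI by (metis Collect_conj_eq)
    show "\<forall>x. P x \<longrightarrow> Q x \<Longrightarrow> {x. P x} \<in> M \<Longrightarrow> {x. Q x} \<in> M" for P Q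
      using MU by (metis Collect_mono)
  qed
  have "ultrafilter ?G"
    unfolding ultrafilter_def
  proof
    show "?G \<noteq> bot" using ev[of "\<lambda>_. False"] M0 by auto
    show "\<forall>A. (\<forall>\<^sub>F n in ?G. n \<in> A) \<or> (\<forall>\<^sub>F n in ?G. n \<notin> A)"
      using dec by (auto simp: ev Compl_eq)
  qed
  moreover have "?G \<le> F"
    unfolding le_filter_def ev using MF by (simp add: has_def)
  ultimately show ?thesis using that by blast
qed

lemma ultrafilter_FIP:
  assumes "\<And>\<T>. finite \<T> \<Longrightarrow> \<T> \<subseteq> \<S> \<Longrightarrow> \<Inter>\<T> \<noteq> {}"
  shows "\<exists>G. ultrafilter G \<and> (\<forall>A\<in>\<S>. has G A)"
proof -
  have "Inf (principal ` \<S>) \<noteq> bot"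
  proof (rule INF_filter_not_bot)
    fix X assume "X \<subseteq> \<S>" "finite X"
    then show "Inf (principal ` X) \<noteq> bot"
      using assms[of X] by (simp add: INF_principal_finite principal_eq_bot_iff)
  qed
  then obtain G where G: "ultrafilter G" "G \<le> Inf (principal ` \<S>)"
    by (rule ultrafilter_exists)
  have "has G A" if "A \<in> \<S>" for A
    using G(2) INF_lower[OF that, of principal] unfolding has_def le_principal[symmetric]
    by (metis order_trans Collect_mem_eq)
  then show ?thesis using G by blast
qed

lemma ultrafilter_nonprincipal:
  assumes "infinite A"
  obtains G where "ultrafilter G" "has G A" "\<And>B. finite B \<Longrightarrow> \<not> has G B"
proof -
  have "\<exists>G. ultrafilter G \<and> (\<forall>C\<in>{A - B | B. finite B}. has G C)"
  proof (rule ultrafilter_FIP)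
    fix \<T> assume "finite \<T>" "\<T> \<subseteq> {A - B | B. finite B}"
    then have "\<exists>B. finite B \<and> A - B \<subseteq> \<Inter>\<T>"
    proof induction
      case empty then show ?case by (intro exI[of _ "{}"]) auto
    next
      case (insert C \<T>)
      then obtain B B' where "finite B" "A - B \<subseteq> \<Inter>\<T>" "finite B'" "C = A - B'" by auto
      then show ?case by (intro exI[of _ "B \<union> B'"]) auto
    qed
    then show "\<Inter>\<T> \<noteq> {}" using assms by (metis Diff_eq_empty_iff finite_subset subset_empty)
  qed
  then obtain G where G: "ultrafilter G" "\<And>C. C \<in> {A - B | B. finite B} \<Longrightarrow> has G C" by blast
  have "has G (A - B)" if "finite B" for B
    using G(2) that by blast
  then show ?thesis
    using that[OF G(1)] has_Diff[OF G(1)] by (metis finite.emptyI)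
qed

text \<open>\<open>L\<close> is the limit of the \<open>u n\<close> along \<open>v\<close>. Along a
  nonprincipal \<open>v\<close> it is the candidate limit from which convergent subsequences are
  extracted.\<close>

lemma ultrafilter_limit:
  fixes u :: "'i \<Rightarrow> 'a filter"
  assumes "ultrafilter v" "\<And>n. ultrafilter (u n)"
  obtains L where "ultrafilter L" "\<And>A. has L A \<longleftrightarrow> has v {n. has (u n) A}"
proof -
  let ?L = "Abs_filter (\<lambda>P. has v {n. has (u n) {x. P x}})"
  have ev: "eventually P ?L \<longleftrightarrow> has v {n. has (u n) {x. P x}}" for P
  proof (rule eventually_Abs_filter, rule is_filter.intro)
    show "has v {n. has (u n) {x. P x \<and> Q x}}"
      if "has v {n. has (u n) {x. P x}}" "has v {n. has (u n) {x. Q x}}" for P Q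
    proof -
      have "{n. has (u n) {x. P x \<and> Q x}} = {n. has (u n) {x. P x}} \<inter> {n. has (u n) {x. Q x}}"
        by (auto simp: Collect_conj_eq)
      then show ?thesis using that by simp
    qed
    show "has v {n. has (u n) {x. Q x}}"
      if "\<forall>x. P x \<longrightarrow> Q x" "has v {n. has (u n) {x. P x}}" for P Q
      using that(2) by (rule has_mono) (auto intro: has_mono that(1)[rule_format])
  qed simp
  have L: "has ?L A \<longleftrightarrow> has v {n. has (u n) A}" for A
    by (simp add: has_def[of ?L] ev)
  have "has ?L A \<or> has ?L (- A)" for A
  proof -
    have "{n. has (u n) (- A)} = - {n. has (u n) A}"
      using assms(2) by auto
    then show ?thesis unfolding L using assms(1) by simp
  qed
  moreover have "\<not> has ?L {}"
    using assms by (simp add: L)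
  ultimately have "ultrafilter ?L"
    unfolding ultrafilter_def by (auto simp: has_def eventually_False Compl_eq)
  then show ?thesis using L that by blast
qed

section \<open>Quotients of \<open>\<beta>\<omega>\<close> by Boolean algebras\<close>

lemma openin_beta_omega_has: "openin beta_omega {u. ultrafilter u \<and> has u A}"
  unfolding beta_omega_def has_def by (rule topology_generated_by_Basis) blast

lemma openin_beta_omega_base:
  assumes "openin beta_omega W" "u \<in> W"
  obtains A where "has u A" "\<And>v. ultrafilter v \<Longrightarrow> has v A \<Longrightarrow> v \<in> W"
proof -
  have "generate_topology_on (range (\<lambda>A. {F. ultrafilter F \<and> has F A})) W"
    using assms(1) unfolding beta_omega_def has_def by (rule openin_topology_generated_by)
  then have "\<exists>A. has u A \<and> (\<forall>v. ultrafilter v \<and> has v A \<longrightarrow> v \<in> W)"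
    using assms(2)
  proof (induction arbitrary: rule: generate_topology_on.induct)
    case (Int a b)
    then obtain A B where "has u A" "\<forall>v. ultrafilter v \<and> has v A \<longrightarrow> v \<in> a"
      "has u B" "\<forall>v. ultrafilter v \<and> has v B \<longrightarrow> v \<in> b" by blast
    then show ?case by (intro exI[of _ "A \<inter> B"]) auto
  next
    case (UN K)
    then show ?case by blast
  next
    case (Basis s)
    then show ?case by auto
  qed simp
  then show ?thesis using that by blast
qed

text \<open>If no finite subfamily covered the space, the complements of all \<open>A\<close> whose
  basic open set lies inside a member of the cover would have the finite intersection property. An
  ultrafilter containing all of them could lie in no member of the cover.\<close>

lemma compact_space_beta_omega: "compact_space beta_omega"
  unfolding compact_space_alt
proof (intro allI impI)
  fix \<U> assume op: "(\<forall>U\<in>\<U>. openin beta_omega U) \<and> topspace beta_omega \<subseteq> \<Union>\<U>"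
  define \<S> where "\<S> = {- A | A. \<exists>U\<in>\<U>. \<forall>v. ultrafilter v \<longrightarrow> has v A \<longrightarrow> v \<in> U}"
  show "\<exists>\<F>. finite \<F> \<and> \<F> \<subseteq> \<U> \<and> topspace beta_omega \<subseteq> \<Union>\<F>"
  proof (rule ccontr)
    assume no: "\<not> ?thesis"
    have "\<exists>G. ultrafilter G \<and> (\<forall>A\<in>\<S>. has G A)"
    proof (rule ultrafilter_FIP)
      fix \<T> assume T: "finite \<T>" "\<T> \<subseteq> \<S>"
      then have "\<exists>f. \<forall>A\<in>\<T>. f A \<in> \<U> \<and> (\<forall>v. ultrafilter v \<longrightarrow> has v (- A) \<longrightarrow> v \<in> f A)"
        unfolding \<S>_def by (intro bchoice ballI) fastforce
      then obtain f where f: "\<And>A. A \<in> \<T> \<Longrightarrow> f A \<in> \<U>"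
        "\<And>A v. A \<in> \<T> \<Longrightarrow> ultrafilter v \<Longrightarrow> has v (- A) \<Longrightarrow> v \<in> f A" by metis
      then have "\<not> topspace beta_omega \<subseteq> \<Union>(f ` \<T>)"
        using no T by (meson finite_imageI image_subsetI)
      then obtain v where v: "ultrafilter v" "v \<notin> \<Union>(f ` \<T>)"
        by (auto simp: topspace_beta_omega)
      then have "\<And>A. A \<in> \<T> \<Longrightarrow> \<not> has v (- A)" using f(2) by blast
      then have "\<not> has v (\<Union>A\<in>\<T>. - A)"
        using v(1) T(1) by (subst has_UN_finite) auto
      then have "has v (\<Inter>\<T>)"
        using v(1) by (metis has_Compl uminus_Inf)
      then show "\<Inter>\<T> \<noteq> {}" using v(1) by auto
    qed
    then obtain G where G: "ultrafilter G" "\<And>A. A \<in> \<S> \<Longrightarrow> has G A" by blast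
    obtain U where "U \<in> \<U>" "G \<in> U"
      using op G(1) by (auto simp: topspace_beta_omega)
    then obtain A where A: "has G A" "\<And>v. ultrafilter v \<Longrightarrow> has v A \<Longrightarrow> v \<in> U"
      using openin_beta_omega_base op by metis
    then have "has G (- A)" using G(2) \<open>U \<in> \<U>\<close> unfolding \<S>_def by blast
    then show False using G(1) A(1) by simp
  qed
qed

section \<open>Points, clopen cells and convergence in the Stone space of an algebra\<close>

definition alg_eq :: "nat set set \<Rightarrow> nat filter \<Rightarrow> nat filter \<Rightarrow> bool"
  where "alg_eq B u v \<longleftrightarrow> (\<forall>b\<in>B. has u b \<longleftrightarrow> has v b)"

definition alg_rel :: "nat set set \<Rightarrow> nat filter rel"
  where "alg_rel B = {(u, v). ultrafilter u \<and> ultrafilter v \<and> alg_eq B u v}"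

abbreviation alg_class :: "nat set set \<Rightarrow> nat filter \<Rightarrow> nat filter set"
  where "alg_class B u \<equiv> alg_rel B `` {u}"

abbreviation alg_space :: "nat set set \<Rightarrow> nat filter set topology"
  where "alg_space B \<equiv> quotient_space beta_omega (alg_rel B)"

text \<open>Convergence in the quotient, expressed through representatives. It depends only on the
  traces on \<open>B\<close>, and for an algebra \<open>limitin_alg_space\<close> identifies it with
  topological convergence.\<close>

definition alg_lim :: "nat set set \<Rightarrow> (nat \<Rightarrow> nat filter) \<Rightarrow> nat filter \<Rightarrow> bool"
  where "alg_lim B s v \<longleftrightarrow> (\<forall>b\<in>B. has v b \<longrightarrow> (\<forall>\<^sub>F n in sequentially. has (s n) b))"

lemma alg_eq_refl [simp]: "alg_eq B u u"
  and alg_eq_sym: "alg_eq B u v \<Longrightarrow> alg_eq B v u"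
  and alg_eq_trans: "alg_eq B u v \<Longrightarrow> alg_eq B v w \<Longrightarrow> alg_eq B u w"
  and alg_eq_mono: "alg_eq B u v \<Longrightarrow> C \<subseteq> B \<Longrightarrow> alg_eq C u v"
  by (auto simp: alg_eq_def)

lemma equiv_alg_rel: "equiv (topspace beta_omega) (alg_rel B)"
  unfolding topspace_beta_omega
  by (rule equivI) (auto simp: refl_on_def sym_def trans_def alg_rel_def alg_eq_def)

lemma alg_class_eq_iff:
  assumes "ultrafilter u" "ultrafilter v"
  shows "alg_class B u = alg_class B v \<longleftrightarrow> alg_eq B u v"
  using assms eq_equiv_class_iff[OF equiv_alg_rel, of u v B]
  by (simp add: topspace_beta_omega) (simp add: alg_rel_def)

lemma topspace_alg_space: "topspace (alg_space B) = alg_class B ` {u. ultrafilter u}"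
  by (auto simp: topspace_quotient_space topspace_beta_omega quotient_def)

lemma alg_space_cases:
  assumes "x \<in> topspace (alg_space B)"
  obtains u where "ultrafilter u" "x = alg_class B u"
  using assms by (auto simp: topspace_alg_space)

lemma alg_space_point [simp]: "ultrafilter u \<Longrightarrow> alg_class B u \<in> topspace (alg_space B)"
  by (auto simp: topspace_alg_space)

text \<open>For an algebra \<open>B\<close> and \<open>b\<close> in \<open>B\<close> this is the
  basic clopen set of the Stone space that corresponds to \<open>b\<close>.\<close>

definition alg_cell :: "nat set set \<Rightarrow> nat set \<Rightarrow> nat filter set set"
  where "alg_cell B b = alg_class B ` {u. ultrafilter u \<and> has u b}"

lemma alg_cell_iff:
  assumes "ultrafilter u" "b \<in> B"
  shows "alg_class B u \<in> alg_cell B b \<longleftrightarrow> has u b"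
  using assms unfolding alg_cell_def
  by (auto simp: image_iff alg_class_eq_iff alg_eq_def)

lemma alg_cell_subset: "alg_cell B b \<subseteq> topspace (alg_space B)"
  by (auto simp: alg_cell_def)

lemma openin_alg_cell:
  assumes "b \<in> B"
  shows "openin (alg_space B) (alg_cell B b)"
  unfolding openin_quotient_space
proof
  show "alg_cell B b \<subseteq> topspace beta_omega // alg_rel B"
    using alg_cell_subset by (simp add: topspace_quotient_space)
  have "{x \<in> topspace beta_omega. alg_class B x \<in> alg_cell B b} = {u. ultrafilter u \<and> has u b}"
    using assms by (auto simp: topspace_beta_omega alg_cell_iff)
  then show "openin beta_omega {x \<in> topspace beta_omega. alg_class B x \<in> alg_cell B b}"
    using openin_beta_omega_has by simp
qed

lemma closedin_alg_cell:
  assumes "algebra UNIV B" "b \<in> B"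
  shows "closedin (alg_space B) (alg_cell B b)"
proof -
  have "- b \<in> B" using algebra.compl_sets[OF assms(1), of b] assms(2) by (simp add: Compl_eq_Diff_UNIV)
  then have "openin (alg_space B) (alg_cell B (- b))" by (rule openin_alg_cell)
  moreover have "topspace (alg_space B) - alg_cell B b = alg_cell B (- b)"
    using assms(2) \<open>- b \<in> B\<close> alg_cell_subset[of B "- b"]
    by (fastforce simp: topspace_alg_space alg_cell_iff)
  ultimately show ?thesis
    by (simp add: closedin_def alg_cell_subset)
qed

lemma compact_space_alg_space: "compact_space (alg_space B)"
  using image_compactin[OF compact_space_beta_omega[unfolded compact_space_def]
      quotient_imp_continuous_map[OF quotient_map_quotient_space]]
  by (simp add: compact_space_def quotient_imp_surjective_map[OF quotient_map_quotient_space])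

lemma alg_space_separated:
  assumes "algebra UNIV B" "x \<in> topspace (alg_space B)" "y \<in> topspace (alg_space B)" "x \<noteq> y"
  obtains U where "closedin (alg_space B) U" "openin (alg_space B) U" "x \<in> U" "y \<notin> U"
proof -
  obtain u v where u: "ultrafilter u" "x = alg_class B u" and v: "ultrafilter v" "y = alg_class B v"
    using assms alg_space_cases by metis
  then obtain b where b: "b \<in> B" "has u b \<noteq> has v b"
    using assms(4) by (auto simp: alg_class_eq_iff alg_eq_def)
  have b': "- b \<in> B"
    using algebra.compl_sets[OF assms(1), of b] b by (simp add: Compl_eq_Diff_UNIV)
  show ?thesis
  proof (cases "has u b")
    case True
    then show ?thesis using that[of "alg_cell B b"] b u v assms(1)
      by (simp add: closedin_alg_cell openin_alg_cell alg_cell_iff)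
  next
    case False
    then show ?thesis using that[of "alg_cell B (- b)"] b b' u v assms(1)
      by (simp add: closedin_alg_cell openin_alg_cell alg_cell_iff)
  qed
qed

lemma Hausdorff_space_alg_space:
  assumes "algebra UNIV B"
  shows "Hausdorff_space (alg_space B)"
  unfolding Hausdorff_space_def
proof (intro allI impI)
  fix x y assume "x \<in> topspace (alg_space B) \<and> y \<in> topspace (alg_space B) \<and> x \<noteq> y"
  then obtain U where U: "closedin (alg_space B) U" "openin (alg_space B) U" "x \<in> U" "y \<notin> U"
    "y \<in> topspace (alg_space B)"
    using alg_space_separated[OF assms] by metis
  then show "\<exists>U V. openin (alg_space B) U \<and> openin (alg_space B) V \<and> x \<in> U \<and> y \<in> V \<and> disjnt U V"
    by (intro exI[of _ U] exI[of _ "topspace (alg_space B) - U"]) (auto simp: disjnt_def closedin_def)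
qed

text \<open>A priori the quotient topology might be finer than the one generated by the cells.
  Compactness excludes this: the preimage of \<open>W\<close> and the complements of those members
  of \<open>B\<close> that contain \<open>u\<close> cover the space of ultrafilters, and the members
  occurring in a finite subcover intersect in the required \<open>b\<close>.\<close>

lemma alg_space_base:
  assumes B: "algebra UNIV B" and "openin (alg_space B) W" "ultrafilter u" "alg_class B u \<in> W"
  obtains b where "b \<in> B" "has u b" "alg_cell B b \<subseteq> W"
proof -
  interpret algebra UNIV B by (rule B)
  define O' where "O' = {v. ultrafilter v \<and> alg_class B v \<in> W}"
  have O': "openin beta_omega O'"
    using assms(2) unfolding openin_quotient_space O'_def topspace_beta_omega by simp
  let ?\<U> = "insert O' ((\<lambda>b. {v. ultrafilter v \<and> has v (- b)}) ` {b \<in> B. has u b})"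
  have "\<exists>\<F>. finite \<F> \<and> \<F> \<subseteq> ?\<U> \<and> topspace beta_omega \<subseteq> \<Union>\<F>"
  proof (rule compact_space_beta_omega[unfolded compact_space_alt, rule_format], intro conjI ballI)
    show "openin beta_omega U" if "U \<in> ?\<U>" for U
      using that O' openin_beta_omega_has by auto
    show "topspace beta_omega \<subseteq> \<Union>?\<U>"
    proof
      fix v assume "v \<in> topspace beta_omega"
      then have v: "ultrafilter v" by (simp add: topspace_beta_omega)
      show "v \<in> \<Union>?\<U>"
      proof (cases "alg_eq B u v")
        case True
        then have "v \<in> O'" using assms v by (simp add: O'_def flip: alg_class_eq_iff)
        then show ?thesis by blast
      next
        case False
        then obtain b where b: "b \<in> B" "has u b \<noteq> has v b" by (auto simp: alg_eq_def)
        have "- b \<in> B" using compl_sets[of b] b by (simp add: Compl_eq_Diff_UNIV)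
        then have "\<exists>c\<in>B. has u c \<and> \<not> has v c"
          using b v assms(3) by (metis has_Compl)
        then show ?thesis using v by auto
      qed
    qed
  qed
  then obtain \<F> where \<F>: "finite \<F>" "\<F> \<subseteq> ?\<U>" "topspace beta_omega \<subseteq> \<Union>\<F>" by blast
  then have sub: "\<F> - {O'} \<subseteq> (\<lambda>b. {v. ultrafilter v \<and> has v (- b)}) ` {b \<in> B. has u b}" by blast
  obtain C where C: "C \<subseteq> {b \<in> B. has u b}" "finite C"
    "\<F> - {O'} = (\<lambda>b. {v. ultrafilter v \<and> has v (- b)}) ` C"
    using finite_subset_image[OF finite_Diff[OF \<F>(1)] sub] by (elim exE conjE) (rule that)
  let ?b = "\<Inter>C"
  have "\<Inter>C \<in> B \<and> has u (\<Inter>C)"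
    using C(2,1) by induction (auto simp: Int)
  moreover have "alg_cell B ?b \<subseteq> W"
  proof
    fix x assume "x \<in> alg_cell B ?b"
    then obtain v where v: "ultrafilter v" "has v ?b" "x = alg_class B v" by (auto simp: alg_cell_def)
    then have "\<not> has v (- c)" if "c \<in> C" for c
      using that has_mono[OF v(2), of c] by auto
    then have "v \<notin> \<Union>(\<F> - {O'})"
      unfolding C(3) by auto
    then have "v \<in> O'" using \<F>(3) v(1) by (auto simp: topspace_beta_omega)
    then show "x \<in> W" using v by (simp add: O'_def)
  qed
  ultimately show ?thesis using that by blast
qed

lemma limitin_alg_space:
  assumes B: "algebra UNIV B" and s: "\<And>n. ultrafilter (s n)" and v: "ultrafilter v"
  shows "limitin (alg_space B) (\<lambda>n. alg_class B (s n)) (alg_class B v) sequentially \<longleftrightarrow> alg_lim B s v"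
proof
  assume L: "limitin (alg_space B) (\<lambda>n. alg_class B (s n)) (alg_class B v) sequentially"
  show "alg_lim B s v" unfolding alg_lim_def
  proof (intro ballI impI)
    fix b assume b: "b \<in> B" "has v b"
    then have "\<forall>\<^sub>F n in sequentially. alg_class B (s n) \<in> alg_cell B b"
      using L v openin_alg_cell[of b B] alg_cell_iff[of v b B] unfolding limitin_def by blast
    then show "\<forall>\<^sub>F n in sequentially. has (s n) b" using b s by (simp add: alg_cell_iff)
  qed
next
  assume L: "alg_lim B s v"
  show "limitin (alg_space B) (\<lambda>n. alg_class B (s n)) (alg_class B v) sequentially"
    unfolding limitin_def
  proof (intro conjI allI impI)
    fix U assume U: "openin (alg_space B) U \<and> alg_class B v \<in> U"
    then obtain b where b: "b \<in> B" "has v b" "alg_cell B b \<subseteq> U"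
      using alg_space_base[OF B _ v] by blast
    then have "\<forall>\<^sub>F n in sequentially. has (s n) b" using L by (simp add: alg_lim_def)
    then show "\<forall>\<^sub>F n in sequentially. alg_class B (s n) \<in> U"
      by eventually_elim (use b s in \<open>auto simp: alg_cell_iff subset_iff\<close>)
  qed (use v in simp)
qed

lemma alg_space_closure_iff:
  assumes B: "algebra UNIV B" and v: "ultrafilter v"
  shows "alg_class B v \<in> alg_space B closure_of M \<longleftrightarrow>
    (\<forall>b\<in>B. has v b \<longrightarrow> M \<inter> alg_cell B b \<noteq> {})"
proof
  assume "alg_class B v \<in> alg_space B closure_of M"
  then show "\<forall>b\<in>B. has v b \<longrightarrow> M \<inter> alg_cell B b \<noteq> {}"
    unfolding in_closure_of using v openin_alg_cell[of _ B] alg_cell_iff[of v _ B]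
    by (metis disjoint_iff)
next
  assume *: "\<forall>b\<in>B. has v b \<longrightarrow> M \<inter> alg_cell B b \<noteq> {}"
  then show "alg_class B v \<in> alg_space B closure_of M"
    unfolding in_closure_of
  proof (intro conjI allI impI)
    fix W assume "alg_class B v \<in> W \<and> openin (alg_space B) W"
    then obtain b where "b \<in> B" "has v b" "alg_cell B b \<subseteq> W"
      using alg_space_base[OF B _ v] by blast
    with * show "\<exists>y. y \<in> M \<and> y \<in> W" by blast
  qed (use v in simp)
qed

lemma alg_lim_subseq: "alg_lim B s v \<Longrightarrow> strict_mono k \<Longrightarrow> alg_lim B (s \<circ> k) v"
  unfolding alg_lim_def by (auto intro: eventually_subseq)

lemma alg_lim_cong:
  assumes "alg_lim B s v" "\<And>n. alg_eq B (s n) (t n)" "alg_eq B v w"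
  shows "alg_lim B t w"
  using assms unfolding alg_lim_def alg_eq_def by simp

section \<open>Iterated sequential closure\<close>

lemma ord1_succ_of_exists:
  assumes "\<gamma> < omega1"
  obtains \<delta> where "ord1_succ_of \<delta> \<gamma>"
proof
  show "ord1_succ_of (LEAST \<delta>. \<gamma> < \<delta>) \<gamma>"
    unfolding ord1_succ_of_def
    using LeastI[of "\<lambda>\<delta>. \<gamma> < \<delta>", OF assms] not_less_Least[of _ "\<lambda>\<delta>. \<gamma> < \<delta>"]
    by (auto simp: not_less)
qed

lemma ord1_less_succ_iff: "ord1_succ_of \<delta> \<gamma> \<Longrightarrow> \<beta> < \<delta> \<longleftrightarrow> \<beta> \<le> \<gamma>"
  by (auto simp: ord1_succ_of_def)

lemma not_ord1_succ_of_omega1: "\<not> ord1_succ_of omega1 \<gamma>"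
proof
  assume *: "ord1_succ_of omega1 \<gamma>"
  then have "{\<beta>. \<beta> < omega1} = insert \<gamma> {\<beta>. \<beta> < \<gamma>}"
    by (auto simp: ord1_less_succ_iff)
  moreover have "\<gamma> \<noteq> omega1" using * by (auto simp: ord1_succ_of_def)
  ultimately have "countable {\<beta>. \<beta> < omega1}"
    using countable_below_iff[of \<gamma>] by simp
  then show False by (simp add: countable_below_iff)
qed

lemma ord1_less_omega1_iff: "\<gamma> < omega1 \<longleftrightarrow> \<gamma> \<noteq> omega1"
  using ord1_le_omega1[of \<gamma>] by auto

lemma ord1_cases:
  fixes \<alpha> :: ord1
  obtains (zero) "\<And>\<beta>. \<not> \<beta> < \<alpha>"
  | (succ) \<beta> where "ord1_succ_of \<alpha> \<beta>"
  | (limit) \<beta> where "\<beta> < \<alpha>" "\<And>\<gamma>. \<not> ord1_succ_of \<alpha> \<gamma>"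
  by blast

section \<open>Monotonicity and bounds of iterated sequential closures\<close>

lemma seqcl_superset: "M \<subseteq> topspace X \<Longrightarrow> M \<subseteq> seqcl X M"
  unfolding seqcl_def using limitin_const by fastforce

lemma seqcl_mono: "M \<subseteq> N \<Longrightarrow> seqcl X M \<subseteq> seqcl X N"
  unfolding seqcl_def by blast

lemma seqclI: "limitin X s x sequentially \<Longrightarrow> (\<And>n. s n \<in> M) \<Longrightarrow> x \<in> seqcl X M"
  unfolding seqcl_def using limitin_topspace by fastforce

lemma seqcl_subset_closedin:
  assumes "closedin X C" "M \<subseteq> C"
  shows "seqcl X M \<subseteq> C"
proof
  fix x assume "x \<in> seqcl X M"
  then obtain s :: "nat \<Rightarrow> 'a" where "\<And>n. s n \<in> M" "limitin X s x sequentially"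
    by (auto simp: seqcl_def)
  then show "x \<in> C"
    using limitin_closedin[OF _ assms(1), of s x sequentially] assms(2) by (simp add: subset_iff)
qed

lemma seqcl_iter_subset_closedin:
  assumes "closedin X C" "M \<subseteq> C"
  shows "seqcl_iter X \<alpha> M \<subseteq> C"
proof (induction \<alpha> rule: less_induct)
  case (less \<alpha>)
  show ?case
  proof (cases \<alpha> rule: ord1_cases)
    case zero then show ?thesis using assms by (simp add: seqcl_iter_zero)
  next
    case (succ \<beta>)
    then show ?thesis using less[of \<beta>] seqcl_subset_closedin[OF assms(1)]
      by (simp add: seqcl_iter_succ ord1_succ_of_def)
  next
    case limit
    then show ?thesis using less by (auto simp: seqcl_iter_limit)
  qed
qed

lemma seqcl_iter_subset_closure: "M \<subseteq> topspace X \<Longrightarrow> seqcl_iter X \<alpha> M \<subseteq> X closure_of M"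
  by (rule seqcl_iter_subset_closedin) (simp_all add: closure_of_subset)

lemma seqcl_iter_subset_topspace: "M \<subseteq> topspace X \<Longrightarrow> seqcl_iter X \<alpha> M \<subseteq> topspace X"
  by (rule seqcl_iter_subset_closedin) simp_all

lemma seqcl_iter_mono_ord:
  assumes "M \<subseteq> topspace X"
  shows "\<beta> \<le> \<alpha> \<Longrightarrow> seqcl_iter X \<beta> M \<subseteq> seqcl_iter X \<alpha> M"
proof (induction \<alpha> rule: less_induct)
  case (less \<alpha>)
  show ?case
  proof (cases "\<beta> = \<alpha>")
    case False
    then have lt: "\<beta> < \<alpha>" using less.prems by simp
    show ?thesis
    proof (cases \<alpha> rule: ord1_cases)
      case zero then show ?thesis using lt by blast
    next
      case (succ \<gamma>)
      then have "seqcl_iter X \<beta> M \<subseteq> seqcl_iter X \<gamma> M"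
        using less.IH[of \<gamma>] lt by (auto simp: ord1_succ_of_def)
      also have "\<dots> \<subseteq> seqcl X (seqcl_iter X \<gamma> M)"
        by (intro seqcl_superset seqcl_iter_subset_topspace assms)
      finally show ?thesis using succ by (simp add: seqcl_iter_succ)
    next
      case limit
      then show ?thesis using lt by (auto simp: seqcl_iter_limit)
    qed
  qed simp
qed

lemma seqcl_iter_superset:
  assumes "M \<subseteq> topspace X"
  shows "M \<subseteq> seqcl_iter X \<alpha> M"
proof -
  define z :: ord1 where "z = (LEAST \<beta>. True)"
  have z: "z \<le> \<beta>" for \<beta> unfolding z_def by (rule Least_le) simp
  then have "seqcl_iter X z M = M"
    by (intro seqcl_iter_zero) (simp add: not_less)
  then show ?thesis using seqcl_iter_mono_ord[OF assms z] by simp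
qed

lemma sequential_space_order_eqI:
  assumes upper: "\<And>M. M \<subseteq> topspace X \<Longrightarrow> X closure_of M \<subseteq> seqcl_iter X \<alpha> M"
    and lower: "\<And>\<gamma>. \<gamma> < \<alpha> \<Longrightarrow> \<exists>M\<subseteq>topspace X. seqcl_iter X \<gamma> M \<noteq> X closure_of M"
  shows "sequential_space X" "sequential_order X = \<alpha>"
proof -
  have eq: "seqcl_iter X \<beta> M = X closure_of M" if "M \<subseteq> topspace X" "\<alpha> \<le> \<beta>" for M \<beta>
    using upper[OF that(1)] seqcl_iter_subset_closure[OF that(1)] seqcl_iter_mono_ord[OF that]
    by blast
  then show "sequential_space X"
    using ord1_le_omega1 by (auto simp: sequential_space_def)
  show "sequential_order X = \<alpha>"
    unfolding sequential_order_def
  proof (rule Least_equality)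
    show "\<alpha> \<le> \<gamma>" if "\<forall>M\<subseteq>topspace X. seqcl_iter X \<gamma> M = X closure_of M" for \<gamma>
      using lower[of \<gamma>] that by (meson not_le)
  qed (use eq in auto)
qed

text \<open>Since limits are unique, it is enough to control the limit of one subsequence of each
  sequence. Starting from points of least rank, each closure then gains at most one step of rank;
  all lower bounds on the order come from here.\<close>

lemma seqcl_iter_rank_le:
  fixes \<rho> :: "'a \<Rightarrow> ord1"
  assumes H: "Hausdorff_space X" and T: "closedin X T" "D \<subseteq> T"
    and zero: "\<And>x \<beta>. x \<in> D \<Longrightarrow> \<rho> x \<le> \<beta>"
    and step: "\<And>s \<gamma> \<delta>. (\<And>n::nat. s n \<in> T) \<Longrightarrow> (\<And>n. \<rho> (s n) \<le> \<gamma>) \<Longrightarrow> ord1_succ_of \<delta> \<gamma> \<Longrightarrow>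
      \<exists>k l. strict_mono k \<and> limitin X (s \<circ> k) l sequentially \<and> \<rho> l \<le> \<delta>"
  shows "seqcl_iter X \<gamma> D \<subseteq> {x \<in> T. \<rho> x \<le> \<gamma>}"
proof (induction \<gamma> rule: less_induct)
  case (less \<gamma>)
  show ?case
  proof (cases \<gamma> rule: ord1_cases)
    case z: zero
    then show ?thesis using T zero by (auto simp: seqcl_iter_zero)
  next
    case (succ \<beta>)
    show ?thesis
    proof
      fix x assume "x \<in> seqcl_iter X \<gamma> D"
      then obtain s :: "nat \<Rightarrow> 'a"
        where s: "\<And>n. s n \<in> seqcl_iter X \<beta> D" "limitin X s x sequentially"
        using succ by (auto simp: seqcl_iter_succ seqcl_def)
      have "\<beta> < \<gamma>" using succ by (simp add: ord1_succ_of_def)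
      then have sT: "s n \<in> T" "\<rho> (s n) \<le> \<beta>" for n using less.IH s(1) by blast+
      then obtain k l where "strict_mono k" "limitin X (s \<circ> k) l sequentially" "\<rho> l \<le> \<gamma>"
        using step succ by blast
      moreover have "limitin X (s \<circ> k) x sequentially"
        using s(2) \<open>strict_mono k\<close> by (rule limitin_subsequence[rotated])
      ultimately have "l = x"
        using limitin_Hausdorff_unique[OF _ _ _ H] by force
      moreover have "x \<in> T"
        using limitin_closedin[OF s(2) T(1)] sT by simp
      ultimately show "x \<in> {x \<in> T. \<rho> x \<le> \<gamma>}" using \<open>\<rho> l \<le> \<gamma>\<close> by simp
    qed
  next
    case limit
    then show ?thesis using less by (fastforce simp: seqcl_iter_limit)
  qed
qed

section \<open>Sequentially compact spaces with a scattered rank\<close>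

text \<open>\<open>nonlimit\<close> exempts the rank \<open>omega1\<close>, because in the sum used
  for limit orders this value marks the point at infinity.\<close>

locale ranked_space =
  fixes X :: "'a topology" and \<rho> :: "'a \<Rightarrow> ord1"
  assumes subseq: "\<And>s :: nat \<Rightarrow> 'a. (\<And>n. s n \<in> topspace X) \<Longrightarrow>
      \<exists>k l. strict_mono k \<and> limitin X (s \<circ> k) l sequentially"
    and isolating: "\<And>x. x \<in> topspace X \<Longrightarrow>
      \<exists>U. closedin X U \<and> openin X U \<and> x \<in> U \<and> (\<forall>y\<in>U - {x}. \<rho> y < \<rho> x)"
    and separated: "\<And>x y. x \<in> topspace X \<Longrightarrow> y \<in> topspace X \<Longrightarrow> x \<noteq> y \<Longrightarrow>
      \<exists>U. closedin X U \<and> openin X U \<and> x \<in> U \<and> y \<notin> U"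
    and nonlimit: "\<And>x. x \<in> topspace X \<Longrightarrow> \<rho> x < omega1 \<Longrightarrow>
      (\<forall>\<beta>. \<not> \<beta> < \<rho> x) \<or> (\<exists>\<beta>. ord1_succ_of (\<rho> x) \<beta>)"
begin

lemma separated_finite:
  assumes "finite F" "F \<subseteq> topspace X" "x \<in> topspace X" "x \<notin> F"
  obtains U where "closedin X U" "openin X U" "x \<in> U" "U \<inter> F = {}"
proof -
  have "\<exists>U. closedin X U \<and> openin X U \<and> x \<in> U \<and> U \<inter> F = {}"
    using assms
  proof (induction F)
    case empty then show ?case by (intro exI[of _ "topspace X"]) auto
  next
    case (insert y F)
    then obtain U where U: "closedin X U" "openin X U" "x \<in> U" "U \<inter> F = {}" by auto
    obtain V where "closedin X V" "openin X V" "x \<in> V" "y \<notin> V"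
      using separated[of x y] insert.prems by auto
    then show ?case using U by (intro exI[of _ "U \<inter> V"]) (auto intro: closedin_Int)
  qed
  then show ?thesis using that by blast
qed

text \<open>Were \<open>x\<close> missing from \<open>N\<close>, choose \<open>\<gamma>\<close> minimal such that the ranks of \<open>N\<close> are below \<open>\<gamma>\<close>
  near \<open>x\<close>. Since \<open>\<gamma>\<close> is countable, some sequence in \<open>N\<close> has ranks that eventually exceed every
  \<open>\<delta> < \<gamma>\<close>; the limit of a subsequence lies in \<open>N\<close>, hence has rank below \<open>\<gamma>\<close>, but it must have larger
  rank than the points close to it.\<close>

lemma seqclosed_imp_closed_at:
  assumes N: "N \<subseteq> topspace X" "seqcl X N \<subseteq> N" and x: "x \<in> X closure_of N" "\<rho> x < omega1"
  shows "x \<in> N"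
proof (rule ccontr)
  assume xN: "x \<notin> N"
  have xX: "x \<in> topspace X" using x(1) by (simp add: in_closure_of)
  define P where "P \<gamma> \<longleftrightarrow> (\<exists>U. closedin X U \<and> openin X U \<and> x \<in> U \<and> (\<forall>y\<in>N \<inter> U. \<rho> y < \<gamma>))" for \<gamma>
  define \<gamma> where "\<gamma> = (LEAST \<gamma>. P \<gamma>)"
  have "P (\<rho> x)" unfolding P_def using isolating[OF xX] xN by blast
  then have P: "P \<gamma>" and le: "\<gamma> \<le> \<rho> x" unfolding \<gamma>_def by (auto intro: LeastI Least_le)
  obtain U where U: "closedin X U" "openin X U" "x \<in> U" "\<And>y. y \<in> N \<Longrightarrow> y \<in> U \<Longrightarrow> \<rho> y < \<gamma>"
    using P unfolding P_def by auto
  \<comment> \<open>Otherwise a smaller clopen neighbourhood avoiding \<open>F\<close> would make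
    \<delta> admissible, against the minimality of \<gamma>.\<close>
  have big: "\<exists>y\<in>N \<inter> U - F. \<delta> \<le> \<rho> y" if "\<delta> < \<gamma>" "finite F" "F \<subseteq> N" for \<delta> F
  proof (rule ccontr)
    assume no: "\<not> ?thesis"
    have "F \<subseteq> topspace X" "x \<notin> F" using that N xN by auto
    then obtain V where "closedin X V" "openin X V" "x \<in> V" "V \<inter> F = {}"
      using separated_finite[OF \<open>finite F\<close> _ xX] by metis
    then have "P \<delta>" unfolding P_def
      using U no by (intro exI[of _ "U \<inter> V"]) (force simp: not_le intro: closedin_Int)
    then show False using \<open>\<delta> < \<gamma>\<close> unfolding \<gamma>_def using not_less_Least by blast
  qed
  have "\<gamma> \<noteq> omega1" using le x(2) by auto
  then have cnt: "countable {\<delta>. \<delta> < \<gamma>}" by (simp add: countable_below_iff)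
  have "\<exists>y. y \<in> N \<and> y \<in> U" using x(1) U(2,3) unfolding in_closure_of by blast
  then have ne: "{\<delta>. \<delta> < \<gamma>} \<noteq> {}" using U(4) by blast
  define d where "d = from_nat_into {\<delta>. \<delta> < \<gamma>}"
  have d: "range d = {\<delta>. \<delta> < \<gamma>}" unfolding d_def using ne cnt by simp
  \<comment> \<open>Intersecting the earlier values with \<open>N\<close> makes them admissible for
    \<open>big\<close> whatever the function is. Once all values lie in \<open>N\<close>, the
    condition says that \<open>y\<close> is injective.\<close>
  have "\<exists>y. \<forall>n::nat. y n \<in> N \<inter> U - (y ` {..<n} \<inter> N) \<and> (\<forall>i\<le>n. d i \<le> \<rho> (y n))"
  proof (rule dependent_wellorder_choice)
    fix n and f :: "nat \<Rightarrow> 'a"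
    have "Max (d ` {..n}) \<in> range d" using Max_in[of "d ` {..n}"] by blast
    then obtain y where "y \<in> N \<inter> U - (f ` {..<n} \<inter> N)" "Max (d ` {..n}) \<le> \<rho> y"
      using big[of "Max (d ` {..n})" "f ` {..<n} \<inter> N"] d by auto
    then show "\<exists>r. r \<in> N \<inter> U - (f ` {..<n} \<inter> N) \<and> (\<forall>i\<le>n. d i \<le> \<rho> r)"
      by (intro exI[of _ y]) auto
  qed (auto cong: image_cong_simp)
  then obtain y where y: "\<And>n. y n \<in> N" "\<And>n. y n \<in> U" "\<And>n. y n \<notin> y ` {..<n}"
    "\<And>n i. i \<le> n \<Longrightarrow> d i \<le> \<rho> (y n)" by auto
  have inj: "y m \<noteq> y n" if "m < n" for m n using y(3)[of n] that by (metis imageI lessThan_iff)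
  obtain k l where k: "strict_mono k" and l: "limitin X (y \<circ> k) l sequentially"
    using subseq[of y] y(1) N(1) by blast
  have "l \<in> N" using seqclI[OF l] y(1) N(2) by auto
  moreover have "l \<in> U" using limitin_closedin[OF l U(1)] y(2) by simp
  ultimately obtain i where i: "\<rho> l = d i" using U(4) d by blast
  obtain W where W: "openin X W" "l \<in> W" "\<forall>z\<in>W - {l}. \<rho> z < \<rho> l"
    using isolating[OF limitin_topspace[OF l]] by blast
  have "\<forall>\<^sub>F n in sequentially. (y \<circ> k) n \<in> W" using l W by (simp add: limitin_def)
  then obtain n0 where n0: "\<And>n. n \<ge> n0 \<Longrightarrow> y (k n) \<in> W" by (auto simp: eventually_sequentially)
  \<comment> \<open>The rank of \<open>l\<close> is \<open>d i\<close>, so from here on the terms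
    have at least the rank of \<open>l\<close>, and near \<open>l\<close> only \<open>l\<close>
    itself does.\<close>
  have "y (k n) = l" if "n \<ge> n0" "n \<ge> i" for n
  proof -
    have "k n \<ge> i" using seq_suble[OF k, of n] that by simp
    then have "\<rho> l \<le> \<rho> (y (k n))" using y(4) i by simp
    then show ?thesis using W(3) n0[OF that(1)] by (metis DiffI empty_iff insert_iff not_le)
  qed
  then have "y (k (max n0 i)) = y (k (Suc (max n0 i)))" by simp
  moreover have "k (max n0 i) < k (Suc (max n0 i))" using k by (simp add: strict_mono_def)
  ultimately show False using inj by blast
qed

text \<open>Induction on the rank. Near a point \<open>x\<close> outside \<open>M\<close>, all other
  points of the closure have smaller rank; without \<open>x\<close> they do not form a sequentially
  closed set, so a sequence of them converges to \<open>x\<close>. The rank of \<open>x\<close> is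
  then a successor, and its predecessor bounds the ranks of all terms at once.\<close>

lemma closure_imp_seqcl_iter:
  assumes M: "M \<subseteq> topspace X"
  shows "x \<in> X closure_of M \<Longrightarrow> \<rho> x < omega1 \<Longrightarrow> x \<in> seqcl_iter X (\<rho> x) M"
proof (induction "\<rho> x" arbitrary: x rule: less_induct)
  case less
  show ?case
  proof (cases "x \<in> M")
    case True then show ?thesis using seqcl_iter_superset[OF M] by blast
  next
    case False
    have xX: "x \<in> topspace X" using less.prems by (simp add: in_closure_of)
    obtain U where U: "closedin X U" "openin X U" "x \<in> U" "\<forall>y\<in>U - {x}. \<rho> y < \<rho> x"
      using isolating[OF xX] by blast
    define N where "N = X closure_of M \<inter> U - {x}"
    have MN: "M \<inter> U \<subseteq> N" using closure_of_subset[OF M] False by (auto simp: N_def)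
    have "x \<in> X closure_of (M \<inter> U)"
      unfolding in_closure_of
    proof (intro conjI allI impI)
      fix W assume "x \<in> W \<and> openin X W"
      then have "x \<in> W \<inter> U \<and> openin X (W \<inter> U)" using U by auto
      then show "\<exists>y. y \<in> M \<inter> U \<and> y \<in> W" using less.prems(1) unfolding in_closure_of by blast
    qed (rule xX)
    then have "x \<in> X closure_of N" using closure_of_mono[OF MN] by blast
    moreover have NX: "N \<subseteq> topspace X" using closure_of_subset_topspace by (force simp: N_def)
    moreover have "x \<notin> N" by (simp add: N_def)
    ultimately have "\<not> seqcl X N \<subseteq> N" using seqclosed_imp_closed_at less.prems(2) by blast
    then obtain z s where z: "z \<notin> N" "limitin X s z sequentially" "\<And>n::nat. s n \<in> N"
      unfolding seqcl_def by blast
    \<comment> \<open>Together with \<open>x\<close> the set \<open>N\<close> is closed, so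
      \<open>x\<close> is the only limit that \<open>N\<close> can lack.\<close>
    have "z \<in> X closure_of M \<inter> U"
      by (rule limitin_closedin[OF z(2)]) (use U z(3) in \<open>auto simp: N_def intro: closedin_Int\<close>)
    then have zx: "z = x" using z(1) by (simp add: N_def)
    have rs: "\<rho> (s n) < \<rho> x" "s n \<in> X closure_of M" for n using z(3)[of n] U by (auto simp: N_def)
    then obtain \<delta> where \<delta>: "ord1_succ_of (\<rho> x) \<delta>" using nonlimit[OF xX less.prems(2)] by blast
    have "s n \<in> seqcl_iter X \<delta> M" for n
    proof -
      have "s n \<in> seqcl_iter X (\<rho> (s n)) M" using less.hyps[OF rs] less.prems(2) rs(1)[of n] by auto
      moreover have "\<rho> (s n) \<le> \<delta>" using rs(1)[of n] \<delta> by (simp add: ord1_less_succ_iff)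
      ultimately show ?thesis using seqcl_iter_mono_ord[OF M] by blast
    qed
    then have "x \<in> seqcl X (seqcl_iter X \<delta> M)" using seqclI z(2) zx by metis
    then show ?thesis using \<delta> by (simp add: seqcl_iter_succ)
  qed
qed

end

section \<open>Stages\<close>

record stage =
  alg :: "nat set set"
  pts :: "nat filter set"
  rk :: "nat filter \<Rightarrow> ord1"

text \<open>An isolating set determines its point: two distinct points isolated by the same set
  would each have smaller rank than the other. This lets sets of naturals serve as names of
  points.\<close>

definition isolates :: "nat set set \<Rightarrow> (nat filter \<Rightarrow> ord1) \<Rightarrow> nat set \<Rightarrow> nat filter \<Rightarrow> bool"
  where "isolates B r b u \<longleftrightarrow> b \<in> B \<and> has u b \<and>
    (\<forall>v. ultrafilter v \<longrightarrow> has v b \<longrightarrow> alg_eq B u v \<or> r v < r u)"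

text \<open>The points of \<open>alg_space (alg S)\<close> are represented by the ultrafilters in \<open>pts S\<close>.\<close>

locale is_stage =
  fixes S :: stage
  assumes stage_algebra: "algebra UNIV (alg S)"
    and stage_singleton: "\<And>n. {n} \<in> alg S"
    and stage_ultrafilter: "\<And>z. z \<in> pts S \<Longrightarrow> ultrafilter z"
    and stage_point: "\<And>u. ultrafilter u \<Longrightarrow> \<exists>z\<in>pts S. alg_eq (alg S) u z"
    and stage_point_unique:
      "\<And>y z. y \<in> pts S \<Longrightarrow> z \<in> pts S \<Longrightarrow> alg_eq (alg S) y z \<Longrightarrow> y = z"
    and stage_rk_cong:
      "\<And>u v. ultrafilter u \<Longrightarrow> ultrafilter v \<Longrightarrow> alg_eq (alg S) u v \<Longrightarrow> rk S u = rk S v"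
    and stage_isolates: "\<And>u. ultrafilter u \<Longrightarrow> \<exists>b. isolates (alg S) (rk S) b u"
    and stage_nonlimit:
      "\<And>u. ultrafilter u \<Longrightarrow> (\<forall>\<beta>. \<not> \<beta> < rk S u) \<or> (\<exists>\<beta>. ord1_succ_of (rk S u) \<beta>)"
begin

lemma stage_Compl: "b \<in> alg S \<Longrightarrow> - b \<in> alg S"
  using algebra.compl_sets[OF stage_algebra] by (simp add: Compl_eq_Diff_UNIV)

lemma stage_Int: "a \<in> alg S \<Longrightarrow> b \<in> alg S \<Longrightarrow> a \<inter> b \<in> alg S"
  using stage_algebra unfolding algebra_iff_Int by blast

lemma stage_Diff: "a \<in> alg S \<Longrightarrow> b \<in> alg S \<Longrightarrow> a - b \<in> alg S"
  using stage_Int[OF _ stage_Compl] by (simp add: Diff_eq)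

lemma stage_UNIV: "UNIV \<in> alg S"
  using algebra.top[OF stage_algebra] by simp

lemma stage_empty: "{} \<in> alg S"
  using stage_Compl[OF stage_UNIV] by simp

lemma stage_Un: "a \<in> alg S \<Longrightarrow> b \<in> alg S \<Longrightarrow> a \<union> b \<in> alg S"
  using stage_Compl[OF stage_Int[OF stage_Compl stage_Compl]] by simp

lemma stage_separate:
  assumes "ultrafilter u" "ultrafilter v" "\<not> alg_eq (alg S) u v"
  obtains b where "b \<in> alg S" "has u b" "\<not> has v b"
proof -
  obtain b where b: "b \<in> alg S" "has u b \<noteq> has v b" using assms by (auto simp: alg_eq_def)
  show ?thesis
  proof (cases "has u b")
    case True then show ?thesis using that b by blast
  next
    case False
    then show ?thesis using that[OF stage_Compl[OF b(1)]] b assms by simp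
  qed
qed

end

text \<open>The last clause says that a point of \<open>S\<close> continues as exactly one point of \<open>T\<close> of the same
  rank; the other points of \<open>T\<close> which it splits into have smaller rank.\<close>

definition extends :: "stage \<Rightarrow> stage \<Rightarrow> bool"  (infix "\<preceq>" 50)
  where "S \<preceq> T \<longleftrightarrow> alg S \<subseteq> alg T \<and> pts S \<subseteq> pts T \<and>
    (\<forall>u. ultrafilter u \<longrightarrow> rk T u \<le> rk S u) \<and> (\<forall>z\<in>pts S. rk T z = rk S z) \<and>
    (\<forall>u v. ultrafilter u \<longrightarrow> ultrafilter v \<longrightarrow> alg_eq (alg S) u v \<longrightarrow>
      rk T u = rk S u \<longrightarrow> rk T v = rk S v \<longrightarrow> alg_eq (alg T) u v)"

lemma extends_refl [simp]: "S \<preceq> S"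
  by (auto simp: extends_def)

lemma extends_trans:
  assumes "R \<preceq> S" "S \<preceq> T"
  shows "R \<preceq> T"
  unfolding extends_def
proof (intro conjI allI impI ballI)
  show "alg R \<subseteq> alg T" "pts R \<subseteq> pts T" using assms by (auto simp: extends_def)
  show le: "rk T u \<le> rk R u" if "ultrafilter u" for u
    using assms that unfolding extends_def by (meson order_trans)
  show "rk T z = rk R z" if "z \<in> pts R" for z
    using assms that unfolding extends_def by (metis subsetD)
  show "alg_eq (alg T) u v"
    if "ultrafilter u" "ultrafilter v" "alg_eq (alg R) u v" "rk T u = rk R u" "rk T v = rk R v" for u v
  proof -
    have "rk S w = rk R w" if "ultrafilter w" "rk T w = rk R w" for w
      using assms that unfolding extends_def by (metis order_antisym)
    then show ?thesis using assms that unfolding extends_def by metis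
  qed
qed

text \<open>The rank of \<open>u\<close> in the union is the least one along the chain and is
  attained at some stage \<open>c u\<close>. From there on the rank is constant, so by the last
  clause of \<open>extends\<close> the point is no longer separated from its representative, and an
  isolating set found at \<open>c u\<close> still isolates it in the union.\<close>

lemma chain_upper_bound:
  assumes ne: "C \<noteq> {}" and stages: "\<And>S. S \<in> C \<Longrightarrow> is_stage S"
    and chain: "\<And>S T. S \<in> C \<Longrightarrow> T \<in> C \<Longrightarrow> S \<preceq> T \<or> T \<preceq> S"
  obtains U where "is_stage U" "\<And>S. S \<in> C \<Longrightarrow> S \<preceq> U"
    "alg U = (\<Union>S\<in>C. alg S)" "pts U = (\<Union>S\<in>C. pts S)"
proof -
  define r where "r u = (LEAST \<beta>. \<exists>S\<in>C. rk S u = \<beta>)" for u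
  have "\<exists>S\<in>C. rk S u = r u" for u
    unfolding r_def using LeastI_ex[of "\<lambda>\<beta>. \<exists>S\<in>C. rk S u = \<beta>"] ne by blast
  then obtain c where c: "\<And>u. c u \<in> C" "\<And>u. rk (c u) u = r u" by metis
  have r_le: "r u \<le> rk S u" if "S \<in> C" for S u
    unfolding r_def using Least_le[of "\<lambda>\<beta>. \<exists>S\<in>C. rk S u = \<beta>"] that by blast
  have r_eq: "rk S u = r u" if "c u \<preceq> S" "S \<in> C" "ultrafilter u" for S u
    using that r_le[OF that(2), of u] c(2)[of u] by (auto simp: extends_def intro: order_antisym)
  have dir: "\<exists>W\<in>C. S \<preceq> W \<and> T \<preceq> W" if "S \<in> C" "T \<in> C" for S T
    using chain[OF that] that extends_refl by blast
  define B where "B = (\<Union>S\<in>C. alg S)"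
  define Z where "Z = (\<Union>S\<in>C. pts S)"
  let ?U = "\<lparr>alg = B, pts = Z, rk = r\<rparr>"
  have BD: "alg_eq B u v" if "\<And>S. S \<in> C \<Longrightarrow> \<exists>T\<in>C. S \<preceq> T \<and> alg_eq (alg T) u v" for u v
    using that unfolding alg_eq_def B_def extends_def by (metis UN_E subsetD)
  have ev: "alg_eq B u v" if uv: "ultrafilter u" "ultrafilter v" "alg_eq (alg S) u v"
    "r u = rk S u" "r v = rk S v" "S \<in> C" for u v S
  proof (rule BD)
    fix T assume T: "T \<in> C"
    obtain W where W: "W \<in> C" "S \<preceq> W" "T \<preceq> W" using dir[OF \<open>S \<in> C\<close> T] by blast
    have "rk W w = rk S w" if "ultrafilter w" "r w = rk S w" for w
      using W that r_le[OF W(1), of w] by (auto simp: extends_def intro: order_antisym)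
    then have "alg_eq (alg W) u v" using W uv unfolding extends_def by metis
    then show "\<exists>T'\<in>C. T \<preceq> T' \<and> alg_eq (alg T') u v" using W by blast
  qed
  have Zr: "r z = rk S z" if "S \<in> C" "z \<in> pts S" for S z
  proof -
    have "S \<preceq> c z \<or> c z \<preceq> S" using chain that(1) c(1) by blast
    moreover have "ultrafilter z" using stages that is_stage.stage_ultrafilter by blast
    ultimately show ?thesis using that c(2)[of z] r_eq[of z S] unfolding extends_def by metis
  qed
  have "is_stage ?U"
  proof (rule is_stage.intro, unfold stage.simps)
    show "algebra UNIV B"
      unfolding algebra_iff_Int
    proof (intro conjI ballI)
      show "{} \<in> B" unfolding B_def using ne stages is_stage.stage_empty by blast
      show "UNIV - a \<in> B" if "a \<in> B" for a
        using that stages is_stage.stage_Compl unfolding B_def by (metis Compl_eq_Diff_UNIV UN_iff)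
      fix a b assume "a \<in> B" "b \<in> B"
      then obtain S T where ST: "S \<in> C" "a \<in> alg S" "T \<in> C" "b \<in> alg T" by (auto simp: B_def)
      then obtain W where "W \<in> C" "a \<in> alg W" "b \<in> alg W"
        using dir[OF ST(1,3)] unfolding extends_def by blast
      then show "a \<inter> b \<in> B" using is_stage.stage_Int[OF stages] unfolding B_def by blast
    qed simp
    show "{n} \<in> B" for n using ne stages is_stage.stage_singleton unfolding B_def by blast
    show "ultrafilter z" if "z \<in> Z" for z using that stages is_stage.stage_ultrafilter unfolding Z_def by blast
  next
    fix u :: "nat filter" assume u: "ultrafilter u"
    obtain z where z: "z \<in> pts (c u)" "alg_eq (alg (c u)) u z"
      using is_stage.stage_point[OF stages[OF c(1)] u] by blast
    have uz: "ultrafilter z" using is_stage.stage_ultrafilter[OF stages[OF c(1)] z(1)] .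
    have "rk (c u) u = rk (c u) z" using is_stage.stage_rk_cong[OF stages[OF c(1)] u uz z(2)] .
    then have "alg_eq B u z"
      by (intro ev[of u z "c u"]) (use u uz z c Zr[OF c(1) z(1)] in auto)
    then show "\<exists>z\<in>Z. alg_eq B u z" using z(1) c(1) unfolding Z_def by blast
    have "\<exists>b. isolates (alg (c u)) (rk (c u)) b u" by (rule is_stage.stage_isolates[OF stages[OF c(1)] u])
    then obtain b where b: "b \<in> alg (c u)" "has u b"
      "\<And>v. ultrafilter v \<Longrightarrow> has v b \<Longrightarrow> alg_eq (alg (c u)) u v \<or> rk (c u) v < rk (c u) u"
      by (auto simp: isolates_def)
    have "alg_eq B u v \<or> r v < r u" if v: "ultrafilter v" "has v b" for v
    proof -
      have le: "r v \<le> rk (c u) v" by (rule r_le[OF c(1)])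
      show ?thesis
      proof (cases "rk (c u) v < rk (c u) u")
        case True then show ?thesis using le c(2)[of u] by auto
      next
        case False
        then have e: "alg_eq (alg (c u)) u v" using b(3) v by blast
        then have "rk (c u) v = r u" using is_stage.stage_rk_cong[OF stages[OF c(1)] u v(1)] c(2) by metis
        then show ?thesis using le ev[OF u v(1) e _ _ c(1)] c(2)[of u] by (auto simp: le_less)
      qed
    qed
    then show "\<exists>b. isolates B r b u"
      using b c(1)[of u] unfolding isolates_def B_def by blast
    show "(\<forall>\<beta>. \<not> \<beta> < r u) \<or> (\<exists>\<beta>. ord1_succ_of (r u) \<beta>)"
      using is_stage.stage_nonlimit[OF stages[OF c(1)] u, of u] c(2)[of u] by simp
    fix v assume v: "ultrafilter v" "alg_eq B u v"
    obtain W where W: "W \<in> C" "c u \<preceq> W" "c v \<preceq> W" using dir c(1) by metis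
    have "alg_eq (alg W) u v" using v(2) W(1) by (rule_tac alg_eq_mono) (auto simp: B_def)
    then have "rk W u = rk W v" using is_stage.stage_rk_cong[OF stages[OF W(1)] u v(1)] by blast
    then show "r u = r v" using r_eq W u v by metis
  next
    fix y z assume "y \<in> Z" "z \<in> Z" and yz: "alg_eq B y z"
    then obtain S T where ST: "S \<in> C" "y \<in> pts S" "T \<in> C" "z \<in> pts T" by (auto simp: Z_def)
    then obtain W where W: "W \<in> C" "y \<in> pts W" "z \<in> pts W"
      using dir[OF ST(1,3)] unfolding extends_def by blast
    have "alg_eq (alg W) y z" using yz by (rule alg_eq_mono) (use W in \<open>auto simp: B_def\<close>)
    then show "y = z" using is_stage.stage_point_unique[OF stages] W by blast
  qed
  moreover have "S \<preceq> ?U" if "S \<in> C" for S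
    unfolding extends_def stage.simps
    using that r_le Zr ev by (auto simp: B_def Z_def)
  ultimately show ?thesis using that[of ?U] by (simp add: B_def Z_def)
qed

section \<open>Splitting a point\<close>

lemma alg_lim_subseq_of_limit:
  fixes s :: "nat \<Rightarrow> nat filter"
  assumes B: "countable B" and p: "\<And>N. finite N \<Longrightarrow> \<not> has p N"
    and L: "\<And>b. has L b \<longleftrightarrow> has p {n :: nat. has (s n) b}"
  obtains k where "strict_mono k" "alg_lim B (s \<circ> k) L"
proof -
  \<comment> \<open>\<open>UNIV\<close> keeps the set to be enumerated nonempty.\<close>
  let ?D = "{b \<in> insert UNIV B. has L b}"
  have cD: "countable ?D" by (rule countable_subset[OF _ countable_insert[OF B]]) blast
  have "UNIV \<in> ?D" by simp
  then have neD: "?D \<noteq> {}" by blast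
  define e where "e = from_nat_into ?D"
  have e: "range e = ?D" unfolding e_def by (rule range_from_nat_into[OF neD cD])
  \<comment> \<open>Finitely many sets in \<open>L\<close> are met simultaneously for a set of
    indices in the nonprincipal \<open>p\<close>, hence infinitely often. A diagonal choice along
    the enumeration gives the subsequence.\<close>
  have inf: "infinite {m. \<forall>i\<le>n. has (s m) (e i)}" for n
  proof -
    have "has L (e i)" for i using rangeI[of e i] unfolding e by simp
    then have "has p {m. has (s m) (e i)}" for i using L by simp
    then have "has p {m. \<forall>i\<in>{..n}. has (s m) (e i)}"
      unfolding has_def by (simp add: eventually_ball_finite)
    then show ?thesis using p[of "{m. \<forall>i\<le>n. has (s m) (e i)}"] by (simp add: Ball_def, blast)
  qed
  have "\<exists>k. \<forall>n. (\<forall>i\<le>n. has (s (k n)) (e i)) \<and> k n < k (Suc n)"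
  proof (rule dependent_nat_choice)
    show "\<exists>m. \<forall>i\<le>0. has (s m) (e i)" using infinite_imp_nonempty[OF inf[of 0]] by blast
    show "\<exists>y. (\<forall>i\<le>Suc n. has (s y) (e i)) \<and> x < y" for x n
      using inf[of "Suc n"] unfolding infinite_nat_iff_unbounded by blast
  qed
  then obtain k where k: "\<And>n i. i \<le> n \<Longrightarrow> has (s (k n)) (e i)" "\<And>n. k n < k (Suc n)" by blast
  have "alg_lim B (s \<circ> k) L"
    unfolding alg_lim_def
  proof (intro ballI impI)
    fix b assume "b \<in> B" "has L b"
    then have "b \<in> range e" unfolding e by simp
    then obtain i where "b = e i" by blast
    then show "\<forall>\<^sub>F n in sequentially. has ((s \<circ> k) n) b"
      using k(1) by (auto simp: eventually_sequentially)
  qed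
  then show ?thesis using that[of k] k(2) by (simp add: strict_mono_Suc_iff)
qed

lemma alg_lim_subseq_exists:
  fixes s :: "nat \<Rightarrow> nat filter"
  assumes "countable B" "\<And>n. ultrafilter (s n)"
  obtains k v where "strict_mono k" "ultrafilter v" "alg_lim B (s \<circ> k) v"
proof -
  obtain p :: "nat filter" where p: "ultrafilter p" "\<And>N. finite N \<Longrightarrow> \<not> has p N"
    using ultrafilter_nonprincipal[OF infinite_UNIV_nat] by metis
  obtain L where "ultrafilter L" "\<And>b. has L b \<longleftrightarrow> has p {n. has (s n) b}"
    using ultrafilter_limit[of p s, OF p(1) assms(2)] by blast
  moreover from alg_lim_subseq_of_limit[OF assms(1) p(2) this(2)]
  obtain k where "strict_mono k" "alg_lim B (s \<circ> k) L" by blast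
  ultimately show ?thesis using that by blast
qed

text \<open>The sets are chosen one by one, while a neighbourhood \<open>d\<close> of
  \<open>v\<close> is kept disjoint from those already used. The ranks tell the terms apart from
  \<open>v\<close>, so the next set can be cut out of \<open>d\<close> without touching
  \<open>v\<close>. Staying inside longer and longer parts of a neighbourhood base makes the sets
  shrink to \<open>v\<close>; staying inside isolating sets bounds the ranks.\<close>

lemma disjoint_neighbourhoods:
  assumes S: "is_stage S" and cnt: "countable (alg S)"
    and z: "\<And>n. ultrafilter (z n)" "\<And>n. rk S (z n) \<le> \<gamma>"
    and v: "ultrafilter v" "\<gamma> < rk S v" and lim: "alg_lim (alg S) z v"
  obtains k :: "nat \<Rightarrow> nat" and a where "strict_mono k" "\<And>n. a n \<in> alg S" "\<And>n. has (z (k n)) (a n)"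
    "\<And>n w. ultrafilter w \<Longrightarrow> has w (a n) \<Longrightarrow> rk S w \<le> \<gamma>"
    "\<And>m n. m < n \<Longrightarrow> a m \<inter> a n = {}"
    "\<And>b. b \<in> alg S \<Longrightarrow> has v b \<Longrightarrow> \<exists>m. \<forall>n\<ge>m. a n \<subseteq> b"
proof -
  let ?D = "{b \<in> alg S. has v b}"
  have "UNIV \<in> ?D" using is_stage.stage_UNIV[OF S] by simp
  then have neD: "?D \<noteq> {}" by blast
  define e where "e = from_nat_into ?D"
  have e: "range e = ?D"
    unfolding e_def by (rule range_from_nat_into[OF neD countable_subset[OF _ cnt]]) blast
  have eD: "e i \<in> ?D" for i using rangeI[of e i] unfolding e .
  define P where "P n \<equiv> \<lambda>(k, a, d). d \<in> ?D \<and> a \<in> alg S \<and> has (z k) a \<and> (\<forall>i\<le>n. a \<subseteq> e i) \<and>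
    (\<forall>w. ultrafilter w \<longrightarrow> has w a \<longrightarrow> rk S w \<le> \<gamma>) \<and> d \<inter> a = {}" for n :: nat
  define Q where "Q \<equiv> \<lambda>(k :: nat, a :: nat set, d). \<lambda>(k', a', d'). k < k' \<and> a' \<subseteq> d \<and> d' \<subseteq> (d :: nat set)"
  have step: "\<exists>k a d'. k > m \<and> a \<subseteq> d \<and> d' \<subseteq> d \<and> P n (k, a, d')" if d: "d \<in> ?D" for n m d
  proof -
    have "d \<inter> (\<Inter>i\<le>n. e i) \<in> ?D"
    proof (induction n)
      case 0
      then show ?case using d eD[of 0] is_stage.stage_Int[OF S] by simp
    next
      case (Suc n)
      have "d \<inter> (\<Inter>i\<le>Suc n. e i) = (d \<inter> (\<Inter>i\<le>n. e i)) \<inter> e (Suc n)"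
        by (auto simp: atMost_Suc)
      then show ?case using Suc eD[of "Suc n"] is_stage.stage_Int[OF S] by simp
    qed
    then obtain D where D: "D \<in> ?D" "D \<subseteq> d" "\<And>i. i \<le> n \<Longrightarrow> D \<subseteq> e i" by blast
    then have "\<forall>\<^sub>F k in sequentially. has (z k) D" using lim by (simp add: alg_lim_def)
    then obtain N where "\<And>k. k \<ge> N \<Longrightarrow> has (z k) D" by (auto simp: eventually_sequentially)
    then have "has (z (max N (Suc m))) D" "max N (Suc m) > m" by auto
    then obtain k where k: "k > m" "has (z k) D" by blast
    have "\<not> alg_eq (alg S) (z k) v"
      using is_stage.stage_rk_cong[OF S z(1) v(1), of k] z(2)[of k] v(2) by auto
    then obtain c where c: "c \<in> alg S" "has (z k) c" "\<not> has v c"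
      using is_stage.stage_separate[OF S z(1) v(1)] by blast
    obtain b where "isolates (alg S) (rk S) b (z k)" using is_stage.stage_isolates[OF S z(1)] by blast
    then have b: "b \<in> alg S" "has (z k) b"
      "\<And>w. ultrafilter w \<Longrightarrow> has w b \<Longrightarrow> alg_eq (alg S) (z k) w \<or> rk S w < rk S (z k)"
      by (auto simp: isolates_def)
    define a where "a = D \<inter> c \<inter> b"
    have "rk S w \<le> \<gamma>" if w: "ultrafilter w" "has w a" for w
      using b(3)[of w] is_stage.stage_rk_cong[OF S z(1) w(1), of k] z(2)[of k] w by (auto simp: a_def)
    moreover have "a \<in> alg S" using D b c is_stage.stage_Int[OF S] by (auto simp: a_def)
    moreover have "d - a \<in> ?D" using d \<open>a \<in> alg S\<close> c v(1) is_stage.stage_Diff[OF S] by (auto simp: a_def)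
    ultimately have "P n (k, a, d - a)"
      unfolding P_def using D k b c by (auto simp: a_def)
    moreover have "a \<subseteq> d" using D by (auto simp: a_def)
    ultimately show ?thesis using k by blast
  qed
  have "\<exists>f. \<forall>n. P n (f n) \<and> Q (f n) (f (Suc n))"
  proof (rule dependent_nat_choice)
    show "\<exists>x. P 0 x" using step[of UNIV 0 0] is_stage.stage_UNIV[OF S] by auto
    show "\<exists>y. P (Suc n) y \<and> Q x y" if "P n x" for x n
    proof -
      obtain k a d where x: "x = (k, a, d)" by (cases x)
      then have "d \<in> ?D" using that by (simp add: P_def)
      then show ?thesis using step[of d k "Suc n"] by (auto simp: x Q_def)
    qed
  qed
  then obtain f where f: "\<And>n. P n (f n)" "\<And>n. Q (f n) (f (Suc n))" by blast
  define k where "k n = fst (f n)" for n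
  define a where "a n = fst (snd (f n))" for n
  define d where "d n = snd (snd (f n))" for n
  have fk: "f n = (k n, a n, d n)" for n by (simp add: k_def a_def d_def)
  have P: "a n \<in> alg S" "has (z (k n)) (a n)" "\<And>i. i \<le> n \<Longrightarrow> a n \<subseteq> e i" "d n \<inter> a n = {}"
    "\<And>w. ultrafilter w \<Longrightarrow> has w (a n) \<Longrightarrow> rk S w \<le> \<gamma>" for n
    using f(1)[of n] by (auto simp: fk P_def)
  have Q: "k n < k (Suc n)" "a (Suc n) \<subseteq> d n" "d (Suc n) \<subseteq> d n" for n
    using f(2)[of n] by (auto simp: fk Q_def)
  have dd: "d n \<subseteq> d m" if "m \<le> n" for m n using that Q(3) by (rule lift_Suc_antimono_le[rotated])
  have disj: "a m \<inter> a n = {}" if "m < n" for m n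
  proof -
    have "n = Suc (n - 1)" "m \<le> n - 1" using that by auto
    then obtain l where "n = Suc l" "m \<le> l" by blast
    then show ?thesis using Q(2)[of l] dd[of m l] P(4)[of m] by blast
  qed
  have "\<exists>m. \<forall>n\<ge>m. a n \<subseteq> b" if "b \<in> alg S" "has v b" for b
  proof -
    have "b \<in> range e" unfolding e using that by simp
    then obtain i where "b = e i" by blast
    then show ?thesis using P(3) by blast
  qed
  then show ?thesis using that[of k a] P Q(1) disj by (simp add: strict_mono_Suc_iff)
qed

text \<open>The unions over even and over odd indices are disjoint, so no ultrafilter contains both.
  Applied to the representative of the point to be split, this is what keeps that representative
  outside the new set.\<close>

lemma half_sequence:
  fixes a :: "nat \<Rightarrow> 'a set"
  assumes u: "ultrafilter u" and disj: "\<And>m n. m < n \<Longrightarrow> a m \<inter> a n = {}"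
  obtains h :: "nat \<Rightarrow> nat" where "strict_mono h" "\<not> has u (\<Union>n. a (h n))"
proof -
  let ?A = "\<lambda>j. \<Union>n. a (2 * n + j)"
  have "a (2 * m) \<inter> a (2 * n + 1) = {}" for m n
    using disj[of "2 * m" "2 * n + 1"] disj[of "2 * n + 1" "2 * m"] by (cases "m \<le> n") auto
  then have "?A 0 \<inter> ?A 1 = {}" by auto
  then have "\<not> has u (?A 0) \<or> \<not> has u (?A 1)"
    using has_Int[of u "?A 0" "?A 1"] u by auto
  then obtain j where "\<not> has u (?A j)" by blast
  moreover have "strict_mono (\<lambda>n. 2 * n + j)" by (simp add: strict_mono_def)
  ultimately show ?thesis using that by blast
qed

text \<open>For an algebra \<open>B\<close> this is the algebra generated by \<open>B\<close> and
  \<open>A\<close>. The normal form shows at once that it remains countable and that a trace on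
  \<open>B\<close> extends in at most two ways, according to the decision on
  \<open>A\<close>.\<close>

definition adjoin :: "'a set set \<Rightarrow> 'a set \<Rightarrow> 'a set set"
  where "adjoin B A = (\<lambda>(x, y). (x \<inter> A) \<union> (y - A)) ` (B \<times> B)"

lemma has_adjoin:
  "ultrafilter u \<Longrightarrow> has u ((x \<inter> A) \<union> (y - A)) \<longleftrightarrow> (if has u A then has u x else has u y)"
  by simp

lemma adjoinI: "x \<in> B \<Longrightarrow> y \<in> B \<Longrightarrow> (x \<inter> A) \<union> (y - A) \<in> adjoin B A"
  unfolding adjoin_def by (rule image_eqI[of _ _ "(x, y)"]) auto

lemma adjoinE:
  assumes "c \<in> adjoin B A"
  obtains x y where "x \<in> B" "y \<in> B" "c = (x \<inter> A) \<union> (y - A)"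
  using assms unfolding adjoin_def by auto

lemma subset_adjoin: "B \<subseteq> adjoin B A"
proof
  fix b assume b: "b \<in> B"
  have "(b \<inter> A) \<union> (b - A) \<in> adjoin B A" by (rule adjoinI[OF b b])
  then show "b \<in> adjoin B A" by (simp add: Int_Diff_Un)
qed

lemma algebra_adjoin:
  assumes "algebra UNIV B"
  shows "algebra UNIV (adjoin B A)"
  unfolding algebra_iff_Int
proof (intro conjI ballI)
  have B: "{} \<in> B" "\<And>a. a \<in> B \<Longrightarrow> UNIV - a \<in> B" "\<And>a b. a \<in> B \<Longrightarrow> b \<in> B \<Longrightarrow> a \<inter> b \<in> B"
    using assms unfolding algebra_iff_Int by blast+
  show "{} \<in> adjoin B A" using B(1) subset_adjoin by blast
  show "UNIV - c \<in> adjoin B A" if c: "c \<in> adjoin B A" for c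
  proof -
    obtain x y where xy: "x \<in> B" "y \<in> B" "c = (x \<inter> A) \<union> (y - A)" using c by (rule adjoinE)
    have "((UNIV - x) \<inter> A) \<union> ((UNIV - y) - A) \<in> adjoin B A" using xy B by (intro adjoinI) auto
    moreover have "UNIV - c = ((UNIV - x) \<inter> A) \<union> ((UNIV - y) - A)" using xy by auto
    ultimately show ?thesis by simp
  qed
  show "c \<inter> d \<in> adjoin B A" if c: "c \<in> adjoin B A" and d: "d \<in> adjoin B A" for c d
  proof -
    obtain x y where xy: "x \<in> B" "y \<in> B" "c = (x \<inter> A) \<union> (y - A)" using c by (rule adjoinE)
    obtain x' y' where xy': "x' \<in> B" "y' \<in> B" "d = (x' \<inter> A) \<union> (y' - A)" using d by (rule adjoinE)
    have "((x \<inter> x') \<inter> A) \<union> ((y \<inter> y') - A) \<in> adjoin B A" using xy xy' B by (intro adjoinI) auto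
    moreover have "c \<inter> d = ((x \<inter> x') \<inter> A) \<union> ((y \<inter> y') - A)" using xy xy' by auto
    ultimately show ?thesis by simp
  qed
qed simp

lemma in_adjoin:
  assumes "algebra UNIV B"
  shows "A \<in> adjoin B A"
proof -
  have "{} \<in> B" "UNIV \<in> B" using assms algebra.top[OF assms] unfolding algebra_iff_Int by auto
  then have "(UNIV \<inter> A) \<union> ({} - A) \<in> adjoin B A" by (intro adjoinI)
  then show ?thesis by simp
qed

lemma countable_adjoin: "countable B \<Longrightarrow> countable (adjoin B A)"
  by (simp add: adjoin_def)

lemma alg_eq_adjoin_iff:
  assumes "algebra UNIV B" "ultrafilter u" "ultrafilter w"
  shows "alg_eq (adjoin B A) u w \<longleftrightarrow> alg_eq B u w \<and> (has u A \<longleftrightarrow> has w A)"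
proof
  assume *: "alg_eq B u w \<and> (has u A \<longleftrightarrow> has w A)"
  show "alg_eq (adjoin B A) u w"
    unfolding alg_eq_def
  proof
    fix c assume "c \<in> adjoin B A"
    then obtain x y where "x \<in> B" "y \<in> B" "c = (x \<inter> A) \<union> (y - A)" by (rule adjoinE)
    then show "has u c \<longleftrightarrow> has w c"
      using * assms(2,3) by (simp only: has_adjoin) (simp add: alg_eq_def)
  qed
next
  assume *: "alg_eq (adjoin B A) u w"
  then have "alg_eq B u w" by (rule alg_eq_mono) (rule subset_adjoin)
  with * show "alg_eq B u w \<and> (has u A \<longleftrightarrow> has w A)"
    using in_adjoin[OF assms(1), of A] by (simp add: alg_eq_def)
qed

text \<open>The new algebra contains the union \<open>A\<close> of small neighbourhoods of a subsequence of \<open>z\<close>. Away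
  from \<open>v\<close> the set \<open>A\<close> already looks like a member of the old algebra, so only the point \<open>v\<close> is
  split, and \<open>A\<close> is chosen to avoid its representative.\<close>

lemma split_point:
  assumes S: "is_stage S" and cnt: "countable (alg S)"
    and z: "\<And>n. ultrafilter (z n)" "\<And>n. rk S (z n) \<le> \<gamma>"
    and v: "ultrafilter v" and \<delta>: "ord1_succ_of \<delta> \<gamma>" "\<delta> < rk S v" and lim: "alg_lim (alg S) z v"
  obtains T k w where "is_stage T" "countable (alg T)" "S \<preceq> T" "strict_mono k"
    "ultrafilter w" "alg_lim (alg T) (z \<circ> k) w" "rk T w = \<delta>"
proof -
  define B where "B = alg S"
  have alg: "algebra UNIV B" unfolding B_def by (rule is_stage.stage_algebra[OF S])
  have \<gamma>\<delta>: "\<gamma> < \<delta>" using \<delta> by (simp add: ord1_succ_of_def)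
  then have \<gamma>v: "\<gamma> < rk S v" using \<delta> by simp
  obtain k' :: "nat \<Rightarrow> nat" and a' where k': "strict_mono k'" and a': "\<And>n. a' n \<in> B" "\<And>n. has (z (k' n)) (a' n)"
    "\<And>n w. ultrafilter w \<Longrightarrow> has w (a' n) \<Longrightarrow> rk S w \<le> \<gamma>"
    "\<And>m n. m < n \<Longrightarrow> a' m \<inter> a' n = {}"
    "\<And>b. b \<in> B \<Longrightarrow> has v b \<Longrightarrow> \<exists>m. \<forall>n\<ge>m. a' n \<subseteq> b"
    by (rule disjoint_neighbourhoods[OF S cnt z v \<gamma>v lim, folded B_def]) (rule that)
  obtain p where p: "p \<in> pts S" "alg_eq B v p"
    using is_stage.stage_point[OF S v] unfolding B_def by blast
  have pu: "ultrafilter p" using is_stage.stage_ultrafilter[OF S p(1)] .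
  obtain h :: "nat \<Rightarrow> nat" where h: "strict_mono h" "\<not> has p (\<Union>n. a' (h n))"
    by (rule half_sequence[OF pu a'(4)])
  define k where "k = k' \<circ> h"
  define a where "a n = a' (h n)" for n
  define A where "A = (\<Union>n. a n)"
  have k: "strict_mono k" unfolding k_def using k' h(1) by (rule strict_mono_o)
  have a: "a n \<in> B" "has (z (k n)) (a n)" for n using a'(1,2) by (simp_all add: a_def k_def)
  have a_rk: "rk S w \<le> \<gamma>" if "ultrafilter w" "has w (a n)" for w n
    using a'(3) that by (simp add: a_def)
  have pA: "\<not> has p A" using h(2) by (simp add: A_def a_def)
  have small: "\<exists>m. \<forall>n\<ge>m. a n \<subseteq> b" if "b \<in> B" "has v b" for b
    using a'(5)[OF that] seq_suble[OF h(1)] order_trans unfolding a_def by meson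
  have zA: "has (z (k n)) A" for n using a(2) by (rule has_mono) (auto simp: A_def)
  define B' where "B' = adjoin B A"
  have B'_eq: "alg_eq B' u w \<longleftrightarrow> alg_eq B u w \<and> (has u A \<longleftrightarrow> has w A)"
    if "ultrafilter u" "ultrafilter w" for u w
    unfolding B'_def by (rule alg_eq_adjoin_iff[OF alg that])
  \<comment> \<open>A member \<open>b\<close> that misses \<open>v\<close> meets only finitely many
    of the sets \<open>a n\<close>, because these shrink to \<open>v\<close>. On \<open>b\<close>
    the new set is therefore a finite union of old ones.\<close>
  have away: "\<exists>b m. b \<in> B \<and> has u b \<and> \<not> has v b \<and> b \<inter> A \<in> B \<and> b \<inter> A \<subseteq> (\<Union>n<m. a n)"
    if u: "ultrafilter u" and ne: "\<not> alg_eq B u v" for u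
  proof -
    obtain b where b: "b \<in> B" "has u b" "\<not> has v b"
      using is_stage.stage_separate[OF S u v] ne unfolding B_def by blast
    have "- b \<in> B" using is_stage.stage_Compl[OF S] b(1) unfolding B_def by blast
    then obtain m where m: "\<And>n. n \<ge> m \<Longrightarrow> a n \<subseteq> - b"
      using small[of "- b"] b(3) v by auto
    have "\<exists>n<m. x \<in> a n" if "x \<in> b" "x \<in> A" for x
      using that m unfolding A_def by (metis ComplD UN_E not_less subsetD)
    then have eq: "b \<inter> A = b \<inter> (\<Union>n<m. a n)" by (auto simp: A_def)
    have "(\<Union>n<m. a n) \<in> B"
    proof (induction m)
      case 0 then show ?case using is_stage.stage_empty[OF S] by (simp add: B_def)
    next
      case (Suc m)
      then show ?case using is_stage.stage_Un[OF S] a(1) by (simp add: B_def lessThan_Suc)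
    qed
    then have "b \<inter> A \<in> B" unfolding eq using is_stage.stage_Int[OF S] b(1) by (simp add: B_def)
    then show ?thesis using b eq by blast
  qed
  have away_eq: "alg_eq B' u w"
    if u: "ultrafilter u" "\<not> alg_eq B u v" and w: "ultrafilter w" "alg_eq B u w" for u w
  proof -
    obtain b where "b \<in> B" "has u b" "b \<inter> A \<in> B" using away[OF u] by blast
    then have "has u A \<longleftrightarrow> has w A" using w(2) has_Int[of u b A] has_Int[of w b A]
      unfolding alg_eq_def by blast
    then show ?thesis using B'_eq u w by blast
  qed
  have A_rk: "rk S w \<le> \<gamma>" if w: "ultrafilter w" "has w A" "\<not> alg_eq B w v" for w
  proof -
    obtain b m where "has w b" "b \<inter> A \<subseteq> (\<Union>n<m. a n)" using away[OF w(1,3)] by blast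
    then have "has w (\<Union>n<m. a n)" using w(2) has_mono[of w "b \<inter> A"] by simp
    then obtain n where "has w (a n)" using has_UN_finite[OF w(1), of "{..<m}" a] by auto
    then show ?thesis using a_rk w(1) by blast
  qed
  obtain q :: "nat filter" where q: "ultrafilter q" "\<And>N. finite N \<Longrightarrow> \<not> has q N"
    using ultrafilter_nonprincipal[OF infinite_UNIV_nat] by metis
  \<comment> \<open>This is the new point. It contains \<open>A\<close> because all chosen terms do,
    and it has the old trace of \<open>v\<close> because the sets \<open>a n\<close> shrink to
    \<open>v\<close>.\<close>
  obtain w where w: "ultrafilter w" and w_has: "\<And>b. has w b \<longleftrightarrow> has q {n. has (z (k n)) b}"
    using ultrafilter_limit[of q "\<lambda>n. z (k n)", OF q(1) z(1)] by blast
  have wA: "has w A" using zA by (simp add: w_has)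
  have wv: "alg_eq B w v"
  proof (rule ccontr)
    assume "\<not> alg_eq B w v"
    then obtain b where b: "b \<in> B" "has v b" "\<not> has w b"
      using is_stage.stage_separate[OF S v w] alg_eq_sym unfolding B_def by metis
    then obtain m where "\<And>n. n \<ge> m \<Longrightarrow> a n \<subseteq> b" using small by blast
    then have "has (z (k n)) b" if "n \<ge> m" for n using has_mono[OF a(2)] that by blast
    then have "{n. \<not> has (z (k n)) b} \<subseteq> {..<m}" by (auto simp: not_less[symmetric])
    then have "finite {n. \<not> has (z (k n)) b}" by (rule finite_subset) simp
    then have "\<not> has q (- {n. has (z (k n)) b})" using q(2) by (simp add: Compl_eq)
    then show False using b(3) w_has q(1) by simp
  qed
  \<comment> \<open>Of the two halves of the old point \<open>v\<close>, only the one inside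
    \<open>A\<close> is lowered, and it becomes a point of rank \<delta>.\<close>
  define r where "r u = (if alg_eq B u v \<and> has u A then \<delta> else rk S u)" for u
  define T where "T = \<lparr>alg = B', pts = insert w (pts S), rk = r\<rparr>"
  have rv: "rk S u = rk S v" if "ultrafilter u" "alg_eq B u v" for u
    using is_stage.stage_rk_cong[OF S that(1) v] that(2) by (simp add: B_def)
  have r_le: "r u \<le> rk S u" if "ultrafilter u" for u
    using rv[OF that] \<delta>(2) by (auto simp: r_def)
  have point_v: "y = p" if "y \<in> pts S" "alg_eq B y v" for y
    using is_stage.stage_point_unique[OF S that(1) p(1)] that(2) p(2) alg_eq_trans unfolding B_def by blast
  \<comment> \<open>An unchanged rank excludes the half of \<open>v\<close> inside \<open>A\<close>,
    whose rank has dropped strictly.\<close>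
  have keep: "alg_eq B' u x" if "ultrafilter u" "ultrafilter x" "alg_eq B u x" "r u = rk S u" "r x = rk S x" for u x
  proof (cases "alg_eq B u v")
    case True
    then have "alg_eq B x v" using that(3) alg_eq_sym alg_eq_trans by blast
    then have "\<not> has u A" "\<not> has x A"
      using True that rv[OF that(1)] rv[OF that(2)] \<delta>(2) by (auto simp: r_def split: if_splits)
    then show ?thesis using B'_eq that by simp
  qed (use away_eq that in blast)
  have "is_stage T"
    unfolding T_def
  proof (rule is_stage.intro, unfold stage.simps)
    show "algebra UNIV B'" unfolding B'_def by (rule algebra_adjoin[OF alg])
    show "{n} \<in> B'" for n
      using subset_adjoin[of B A] is_stage.stage_singleton[OF S, of n] unfolding B'_def B_def by blast
    show "ultrafilter y" if "y \<in> insert w (pts S)" for y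
      using that w is_stage.stage_ultrafilter[OF S] by blast
    show "\<exists>y\<in>insert w (pts S). alg_eq B' u y" if u: "ultrafilter u" for u
    proof (cases "alg_eq B u v")
      case True
      show ?thesis
      proof (cases "has u A")
        case True
        then have "alg_eq B' u w"
          using B'_eq[OF u w] wA alg_eq_trans[OF \<open>alg_eq B u v\<close> alg_eq_sym[OF wv]] by simp
        then show ?thesis by blast
      next
        case False
        then have "alg_eq B' u p"
          using B'_eq[OF u pu] pA alg_eq_trans[OF \<open>alg_eq B u v\<close> p(2)] by simp
        then show ?thesis using p(1) by blast
      qed
    next
      case False
      obtain y where y: "y \<in> pts S" "alg_eq B u y" using is_stage.stage_point[OF S u] unfolding B_def by blast
      then have "alg_eq B' u y" using away_eq[OF u False is_stage.stage_ultrafilter[OF S y(1)]] by blast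
      then show ?thesis using y(1) by blast
    qed
    show "x = y" if xy: "x \<in> insert w (pts S)" "y \<in> insert w (pts S)" "alg_eq B' x y" for x y
    proof -
      have no: "\<not> alg_eq B' w y" if y: "y \<in> pts S" for y
      proof
        assume "alg_eq B' w y"
        then have "alg_eq B w y" "has y A" using B'_eq[OF w is_stage.stage_ultrafilter[OF S y]] wA by auto
        then have "y = p" using point_v[OF y] alg_eq_trans[OF alg_eq_sym wv] by blast
        then show False using pA \<open>has y A\<close> by simp
      qed
      have "alg_eq B x y" using alg_eq_mono[OF xy(3)] subset_adjoin unfolding B'_def by blast
      then show ?thesis
        using xy no alg_eq_sym is_stage.stage_point_unique[OF S] unfolding B_def by blast
    qed
    show "r u = r x" if u: "ultrafilter u" and x: "ultrafilter x" and ux: "alg_eq B' u x" for u x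
    proof -
      have e: "alg_eq B u x" "has u A \<longleftrightarrow> has x A" using B'_eq[OF u x] ux by auto
      then have "alg_eq B u v \<longleftrightarrow> alg_eq B x v" using alg_eq_sym alg_eq_trans by blast
      then show ?thesis using e is_stage.stage_rk_cong[OF S u x] by (simp add: r_def B_def)
    qed
    show "\<exists>b. isolates B' r b u" if u: "ultrafilter u" for u
    proof (cases "alg_eq B u v")
      case uv: True
      show ?thesis
      proof (cases "has u A")
        case True
        \<comment> \<open>\<open>A\<close> itself isolates the new point: every other point in
          \<open>A\<close> lies in some \<open>a n\<close> and so has rank at most \<gamma>, which
          is below \<delta>.\<close>
        have "alg_eq B' u x \<or> r x < r u" if x: "ultrafilter x" "has x A" for x
        proof (cases "alg_eq B x v")
          case True
          then show ?thesis using B'_eq[OF u x(1)] x(2) \<open>has u A\<close> uv alg_eq_trans alg_eq_sym by blast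
        next
          case xv: False
          then have "r x \<le> \<gamma>" using A_rk[OF x] by (simp add: r_def)
          moreover have "r u = \<delta>" using uv \<open>has u A\<close> by (simp add: r_def)
          ultimately show ?thesis using \<gamma>\<delta> by (metis order.strict_trans1)
        qed
        then have "isolates B' r A u"
          using True in_adjoin[OF alg] by (simp add: isolates_def B'_def)
        then show ?thesis by blast
      next
        case False
        obtain b where b: "isolates B (rk S) b u"
          using is_stage.stage_isolates[OF S u] unfolding B_def by blast
        have "alg_eq B' u x \<or> r x < r u" if x: "ultrafilter x" "has x b" for x
        proof (cases "alg_eq B u x")
          case True
          then have "alg_eq B x v" using uv alg_eq_trans alg_eq_sym by blast
          then show ?thesis
            using B'_eq[OF u x(1)] True False \<delta>(2) rv[OF u uv] by (auto simp: r_def)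
        next
          case ux: False
          then have "rk S x < rk S u" using b x by (auto simp: isolates_def)
          moreover have "r u = rk S u" using False by (simp add: r_def)
          ultimately show ?thesis using r_le[OF x(1)] by (metis order.strict_trans1)
        qed
        then have "isolates B' r b u"
          using b subset_adjoin[of B A] by (auto simp: isolates_def B'_def)
        then show ?thesis by blast
      qed
    next
      case uv: False
      obtain b where b: "isolates B (rk S) b u"
        using is_stage.stage_isolates[OF S u] unfolding B_def by blast
      \<comment> \<open>\<open>c\<close> cuts off the old point \<open>v\<close>, the only place
        where ranks or points have changed.\<close>
      obtain c where c: "c \<in> B" "has u c" "\<not> has v c" using away[OF u uv] by blast
      have "alg_eq B' u x \<or> r x < r u" if x: "ultrafilter x" "has x (b \<inter> c)" for x
      proof -
        have "\<not> alg_eq B x v" using c x by (auto simp: alg_eq_def)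
        then show ?thesis
          using b x away_eq[OF u uv x(1)] uv by (auto simp: isolates_def r_def)
      qed
      moreover have "b \<inter> c \<in> B" using is_stage.stage_Int[OF S] b c by (simp add: isolates_def B_def)
      ultimately have "isolates B' r (b \<inter> c) u"
        using b c subset_adjoin[of B A] by (auto simp: isolates_def B'_def)
      then show ?thesis by blast
    qed
    show "(\<forall>\<beta>. \<not> \<beta> < r u) \<or> (\<exists>\<beta>. ord1_succ_of (r u) \<beta>)" if "ultrafilter u" for u
      using is_stage.stage_nonlimit[OF S that] \<delta>(1) unfolding r_def by auto
  qed
  moreover have "countable (alg T)" using cnt countable_adjoin by (simp add: T_def B'_def B_def)
  moreover have "S \<preceq> T"
    unfolding extends_def
  proof (intro conjI allI impI ballI)
    show "alg S \<subseteq> alg T" using subset_adjoin by (simp add: T_def B'_def B_def)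
    show "rk T y = rk S y" if "y \<in> pts S" for y
      using point_v[OF that] pA by (auto simp: T_def r_def)
  qed (use r_le keep in \<open>auto simp: T_def B_def\<close>)
  moreover have "alg_lim (alg T) (z \<circ> k) w"
    unfolding alg_lim_def
  proof (intro ballI impI)
    fix c assume "c \<in> alg T" and wc: "has w c"
    then have "c \<in> adjoin B A" by (simp add: T_def B'_def)
    then obtain x y where xy: "x \<in> B" "y \<in> B" "c = (x \<inter> A) \<union> (y - A)" by (rule adjoinE)
    then have "has w x" using wc wA has_adjoin[OF w] by metis
    then have "has v x" using wv xy(1) by (simp add: alg_eq_def)
    then have "\<forall>\<^sub>F n in sequentially. has (z n) x" using lim xy(1) by (simp add: alg_lim_def B_def)
    then have "\<forall>\<^sub>F n in sequentially. has (z (k n)) x" by (rule eventually_subseq[OF k])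
    then show "\<forall>\<^sub>F n in sequentially. has ((z \<circ> k) n) c"
    proof eventually_elim
      case (elim n)
      then show ?case using xy(3) has_adjoin[OF z(1)[of "k n"], of x A y] zA[of n] by simp
    qed
  qed
  moreover have "rk T w = \<delta>" using wv wA by (simp add: T_def r_def)
  ultimately show ?thesis using that k w by blast
qed

section \<open>Generic sequences of stages\<close>

lemma bij_betw_below_omega1:
  "bij_betw (\<lambda>a. Abs_ord1 (underS omega1_rel a)) (Field omega1_rel) {\<gamma>. \<gamma> < omega1}"
  unfolding bij_betw_def
proof
  let ?r = omega1_rel
  have ofil: "Order_Relation.ofilter ?r (underS ?r a)" for a
    using wo_rel.underS_ofilter[OF wo_rel_omega1_rel] by blast
  show "inj_on (\<lambda>a. Abs_ord1 (underS ?r a)) (Field ?r)"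
  proof (rule inj_onI)
    fix a b assume "a \<in> Field ?r" "b \<in> Field ?r" "Abs_ord1 (underS ?r a) = Abs_ord1 (underS ?r b)"
    then show "a = b"
      using wo_rel.suc_underS[OF wo_rel_omega1_rel] ofil by (metis Abs_ord1_inject mem_Collect_eq)
  qed
  show "(\<lambda>a. Abs_ord1 (underS ?r a)) ` Field ?r = {\<gamma>. \<gamma> < omega1}"
  proof
    show "(\<lambda>a. Abs_ord1 (underS ?r a)) ` Field ?r \<subseteq> {\<gamma>. \<gamma> < omega1}"
    proof (rule image_subsetI)
      fix a assume "a \<in> Field ?r"
      then have "underS ?r a \<subset> Field ?r" by (intro underS_Field3) auto
      then show "Abs_ord1 (underS ?r a) \<in> {\<gamma>. \<gamma> < omega1}"
        by (simp add: less_ord1_def Rep_omega1 Abs_ord1_inverse ofil)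
    qed
    show "{\<gamma>. \<gamma> < omega1} \<subseteq> (\<lambda>a. Abs_ord1 (underS ?r a)) ` Field ?r"
    proof
      fix \<gamma> assume "\<gamma> \<in> {\<gamma>. \<gamma> < omega1}"
      then have "Rep_ord1 \<gamma> \<noteq> Field ?r" by (auto simp: less_ord1_def Rep_omega1)
      then obtain a where a: "a \<in> Field ?r" "Rep_ord1 \<gamma> = underS ?r a"
        using wo_rel.ofilter_underS_Field[OF wo_rel_omega1_rel, of "Rep_ord1 \<gamma>"] Rep_ord1[of \<gamma>]
        by auto
      then show "\<gamma> \<in> (\<lambda>a. Abs_ord1 (underS ?r a)) ` Field ?r"
        by (metis Rep_ord1_inverse image_eqI)
    qed
  qed
qed

text \<open>The Continuum Hypothesis enters only through this bijection. It schedules the names of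
  sequences along the countable ordinals and later indexes an almost disjoint family by
  them.\<close>

lemma CH_bij_betw_nat_sets:
  assumes continuum_hypothesis
  obtains g where "bij_betw g {\<gamma>. \<gamma> < omega1} (UNIV :: nat set set)"
proof -
  have "(card_of (UNIV :: real set), card_of (Field omega1_rel)) \<in> ordIso"
    using assms card_of_Field_ordIso[OF cardSuc_Card_order[OF natLeq_Card_order]]
    unfolding continuum_hypothesis_def by (meson ordIso_symmetric ordIso_transitive)
  then obtain f where f: "bij_betw f (UNIV :: real set) (Field omega1_rel)"
    using card_of_ordIso by blast
  obtain e where e: "bij_betw e (UNIV :: nat set set) (UNIV :: real set)"
    using nat_sets_eqpoll_reals by (auto simp: eqpoll_def)
  have "bij_betw ((\<lambda>a. Abs_ord1 (underS omega1_rel a)) \<circ> (f \<circ> e)) UNIV {\<gamma>. \<gamma> < omega1}"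
    by (intro bij_betw_trans[OF bij_betw_trans[OF e f] bij_betw_below_omega1])
  then show ?thesis using that bij_betw_inv by blast
qed

text \<open>A point of \<open>S\<close> keeps its rank while the others can only drop, and
  ultrafilters of equal trace that both keep their rank stay together. Hence a name given to a point
  at one stage is valid at all later ones.\<close>

lemma isolates_extends:
  assumes S: "is_stage S" and ext: "S \<preceq> T" and z: "z \<in> pts S"
    and b: "isolates (alg S) (rk S) b z"
  shows "isolates (alg T) (rk T) b z"
  unfolding isolates_def
proof (intro conjI allI impI)
  show "b \<in> alg T" "has z b" using b ext by (auto simp: isolates_def extends_def)
  fix v assume v: "ultrafilter v" "has v b"
  have uz: "ultrafilter z" by (rule is_stage.stage_ultrafilter[OF S z])
  have le: "rk T v \<le> rk S v" and zz: "rk T z = rk S z" using ext z v by (auto simp: extends_def)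
  show "alg_eq (alg T) z v \<or> rk T v < rk T z"
  proof (cases "rk S v < rk S z")
    case True then show ?thesis using le_less_trans[OF le] zz by simp
  next
    case False
    then have e: "alg_eq (alg S) z v" using b v by (auto simp: isolates_def)
    have "rk S z = rk S v" by (rule is_stage.stage_rk_cong[OF S uz v(1) e])
    then show ?thesis using le zz ext uz v(1) e unfolding extends_def by (metis order.order_iff_strict)
  qed
qed

lemma alg_lim_unique:
  assumes B: "algebra UNIV B" and s: "\<And>n. ultrafilter (s n)"
    and v: "ultrafilter v" "alg_lim B s v" and w: "ultrafilter w" "alg_lim B s w"
  shows "alg_eq B v w"
proof -
  have *: "has y b" if "b \<in> B" "has x b" "ultrafilter x" "ultrafilter y" "alg_lim B s x" "alg_lim B s y" for b x y
  proof (rule ccontr)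
    assume "\<not> has y b"
    then have "has y (- b)" "- b \<in> B"
      using that algebra.compl_sets[OF B] by (auto simp: Compl_eq_Diff_UNIV)
    then have "\<forall>\<^sub>F n in sequentially. has (s n) (- b)" "\<forall>\<^sub>F n in sequentially. has (s n) b"
      using that by (auto simp: alg_lim_def)
    then have "\<forall>\<^sub>F n in sequentially. False" by eventually_elim (use s in auto)
    then show False by simp
  qed
  show ?thesis unfolding alg_eq_def using * v w by blast
qed

section \<open>Fixing the limit of a given sequence once and for all\<close>

definition small_stage :: "stage \<Rightarrow> bool"
  where "small_stage S \<longleftrightarrow> is_stage S \<and> countable (alg S)"

text \<open>Convergence is required in all small extensions at once, so that it passes to the union
  of the chain: each member of the final algebra already occurs in a small stage.\<close>

definition settled :: "stage \<Rightarrow> (nat \<Rightarrow> nat filter) \<Rightarrow> bool"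
  where "settled T z \<longleftrightarrow> (\<exists>k v. strict_mono k \<and> v \<in> pts T \<and>
    (\<forall>T'. small_stage T' \<longrightarrow> T \<preceq> T' \<longrightarrow> alg_lim (alg T') (z \<circ> k) v) \<and>
    (\<forall>\<gamma> \<delta>. (\<forall>n. rk T (z n) \<le> \<gamma>) \<longrightarrow> ord1_succ_of \<delta> \<gamma> \<longrightarrow> rk T v \<le> \<delta>))"

lemma exists_point:
  assumes T: "is_stage T" and v: "ultrafilter v" "alg_lim (alg T) s v"
  obtains w where "w \<in> pts T" "alg_lim (alg T) s w" "rk T w = rk T v"
proof -
  obtain w where w: "w \<in> pts T" "alg_eq (alg T) v w" using is_stage.stage_point[OF T v(1)] by blast
  then have "rk T v = rk T w"
    using is_stage.stage_rk_cong[OF T v(1)] is_stage.stage_ultrafilter[OF T] by blast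
  moreover have "alg_lim (alg T) s w" by (rule alg_lim_cong[OF v(2) alg_eq_refl w(2)])
  ultimately show ?thesis using that w by simp
qed

text \<open>Among all stages extending \<open>S\<close> and all limits of subsequences of \<open>z\<close>, take a limit of minimal
  rank: it can neither be split along \<open>z\<close> nor lose the sequence.\<close>

lemma settle:
  assumes S: "small_stage S" and z: "\<And>n. z n \<in> pts S"
  obtains T where "small_stage T" "S \<preceq> T" "settled T z"
proof -
  have zu: "ultrafilter (z n)" for n
    using is_stage.stage_ultrafilter z S by (auto simp: small_stage_def)
  define P where "P \<rho> \<longleftrightarrow> (\<exists>T k v. small_stage T \<and> S \<preceq> T \<and> strict_mono k \<and> v \<in> pts T \<and>
    alg_lim (alg T) (z \<circ> k) v \<and> rk T v = \<rho>)" for \<rho>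
  have PI: "P (rk T v)" if T: "small_stage T" "S \<preceq> T" and k: "strict_mono k"
    and v: "ultrafilter v" "alg_lim (alg T) (z \<circ> k) v" for T k v
  proof -
    obtain w where "w \<in> pts T" "alg_lim (alg T) (z \<circ> k) w" "rk T w = rk T v"
      using exists_point[OF _ v] T(1) by (auto simp: small_stage_def)
    then show ?thesis unfolding P_def using T k by blast
  qed
  define \<rho> where "\<rho> = (LEAST \<rho>. P \<rho>)"
  have "countable (alg S)" using S by (simp add: small_stage_def)
  then obtain k0 v0 where "strict_mono k0" "ultrafilter v0" "alg_lim (alg S) (z \<circ> k0) v0"
    by (rule alg_lim_subseq_exists[OF _ zu])
  then have "P (rk S v0)" using PI[OF S extends_refl] by blast
  then have "P \<rho>" unfolding \<rho>_def by (rule LeastI)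
  then obtain T k v where T: "small_stage T" "S \<preceq> T" and k: "strict_mono k" and v: "v \<in> pts T"
    and lim: "alg_lim (alg T) (z \<circ> k) v" and rv: "rk T v = \<rho>"
    unfolding P_def by blast
  have min: "\<not> P \<sigma>" if "\<sigma> < \<rho>" for \<sigma> using that not_less_Least unfolding \<rho>_def by blast
  have Ts: "is_stage T" using T(1) by (simp add: small_stage_def)
  have vu: "ultrafilter v" by (rule is_stage.stage_ultrafilter[OF Ts v])
  \<comment> \<open>If an extension destroyed the convergence, a subsequence would have another
    limit \<open>w\<close> there, with the same trace as \<open>v\<close> on the algebra of
    \<open>T\<close>. Since \<open>v\<close> keeps its rank, the rank of \<open>w\<close> must have
    dropped, against minimality.\<close>
  have "alg_lim (alg T') (z \<circ> k) v" if T': "small_stage T'" "T \<preceq> T'" for T'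
  proof (rule ccontr)
    assume "\<not> ?thesis"
    then obtain b where b: "b \<in> alg T'" "has v b" "\<not> (\<forall>\<^sub>F n in sequentially. has (z (k n)) b)"
      by (auto simp: alg_lim_def)
    then have "infinite {n. \<not> has (z (k n)) b}"
      by (simp add: eventually_sequentially infinite_nat_iff_unbounded_le)
    then obtain k1 :: "nat \<Rightarrow> nat" where k1: "strict_mono k1" "\<And>n. \<not> has (z (k (k1 n))) b"
      using infinite_enumerate by blast
    have T's: "is_stage T'" "countable (alg T')" using T'(1) by (auto simp: small_stage_def)
    obtain k2 w where k2: "strict_mono k2" and w: "ultrafilter w"
      and wlim: "alg_lim (alg T') ((z \<circ> (k \<circ> k1)) \<circ> k2) w"
      using alg_lim_subseq_exists[OF T's(2), of "z \<circ> (k \<circ> k1)"] zu by auto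
    have "\<not> has w b"
    proof
      assume "has w b"
      then have "\<forall>\<^sub>F n in sequentially. has (z (k (k1 (k2 n)))) b"
        using wlim b(1) by (simp add: alg_lim_def)
      then show False using k1(2) by simp
    qed
    then have ne: "\<not> alg_eq (alg T') v w" using b by (auto simp: alg_eq_def)
    have "strict_mono (k \<circ> k1 \<circ> k2)" using k k1(1) k2 by (simp add: strict_mono_o)
    then have "P (rk T' w)"
      using PI[OF T'(1) extends_trans[OF T(2) T'(2)] _ w] wlim by (simp add: o_assoc)
    have sub: "alg T \<subseteq> alg T'" using T'(2) by (simp add: extends_def)
    have lv: "alg_lim (alg T) (z \<circ> k \<circ> (k1 \<circ> k2)) v"
      using lim by (rule alg_lim_subseq) (use k1(1) k2 in \<open>simp add: strict_mono_o\<close>)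
    have lw: "alg_lim (alg T) (z \<circ> k \<circ> (k1 \<circ> k2)) w"
      using wlim sub by (auto simp: alg_lim_def o_def)
    have vw: "alg_eq (alg T) v w"
      by (rule alg_lim_unique[OF is_stage.stage_algebra[OF Ts] _ vu lv w lw]) (simp add: zu)
    have "rk T v = rk T w" by (rule is_stage.stage_rk_cong[OF Ts vu w vw])
    moreover have "rk T' v = rk T v" "rk T' w \<le> rk T w" using T'(2) v w by (auto simp: extends_def)
    moreover have "rk T' w \<noteq> rk T w"
      using T'(2) vu w vw ne calculation(2) unfolding extends_def by blast
    ultimately have "rk T' w < \<rho>" using rv by (metis order_le_less)
    then show False using min \<open>P (rk T' w)\<close> by blast
  qed
  \<comment> \<open>A rank above \<delta> could be replaced by \<delta> through splitting, again
    against minimality.\<close>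
  moreover have "rk T v \<le> \<delta>" if le: "\<forall>n. rk T (z n) \<le> \<gamma>" and \<delta>: "ord1_succ_of \<delta> \<gamma>" for \<gamma> \<delta>
  proof (rule ccontr)
    assume "\<not> ?thesis"
    then have lt: "\<delta> < rk T v" by simp
    have "countable (alg T)" using T(1) by (simp add: small_stage_def)
    obtain T' k' w where T': "is_stage T'" "countable (alg T')" "T \<preceq> T'" and k': "strict_mono k'"
      and w: "ultrafilter w" "alg_lim (alg T') (z \<circ> k \<circ> k') w" "rk T' w = \<delta>"
      by (rule split_point[OF Ts \<open>countable (alg T)\<close> _ _ vu \<delta> lt lim]) (use zu le in auto)
    have "P (rk T' w)"
      by (rule PI[of T' "k \<circ> k'"])
        (use T' w k k' extends_trans[OF T(2)] in \<open>auto simp: small_stage_def strict_mono_o o_assoc\<close>)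
    then show False using min[of \<delta>] w(3) lt rv by simp
  qed
  ultimately have "settled T z" unfolding settled_def using k v by blast
  then show ?thesis using that T by blast
qed

text \<open>A sequence of points is named by a sequence \<open>b\<close> of isolating sets; there are only continuum
  many such names. The second disjunct keeps the condition dense when \<open>b\<close> never becomes a name.\<close>

definition decides :: "(nat \<Rightarrow> nat set) \<Rightarrow> stage \<Rightarrow> bool"
  where "decides b T \<longleftrightarrow>
    (\<exists>z. (\<forall>n. z n \<in> pts T \<and> isolates (alg T) (rk T) (b n) (z n)) \<and> settled T z) \<or>
    (\<forall>T'. small_stage T' \<longrightarrow> T \<preceq> T' \<longrightarrow> \<not> (\<forall>n. \<exists>z\<in>pts T'. isolates (alg T') (rk T') (b n) z))"

lemma decides_dense:
  assumes S: "small_stage S"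
  obtains T where "small_stage T" "S \<preceq> T" "decides b T"
proof (cases "\<forall>T'. small_stage T' \<longrightarrow> S \<preceq> T' \<longrightarrow> \<not> (\<forall>n. \<exists>z\<in>pts T'. isolates (alg T') (rk T') (b n) z)")
  case True
  then have "decides b S" by (simp add: decides_def)
  then show ?thesis using that S extends_refl by blast
next
  case False
  then obtain T' where T': "small_stage T'" "S \<preceq> T'"
    "\<forall>n. \<exists>z\<in>pts T'. isolates (alg T') (rk T') (b n) z" by blast
  have "\<exists>z. \<forall>n. z n \<in> pts T' \<and> isolates (alg T') (rk T') (b n) (z n)"
    using T'(3) by (intro choice) blast
  then obtain z where z: "\<And>n. z n \<in> pts T'" "\<And>n. isolates (alg T') (rk T') (b n) (z n)" by blast
  obtain T where T: "small_stage T" "T' \<preceq> T" "settled T z"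
    by (rule settle[OF T'(1) z(1)])
  have "isolates (alg T) (rk T) (b n) (z n)" "z n \<in> pts T" for n
    using isolates_extends[OF _ T(2) z(1) z(2)] T'(1) T(2) z(1)
    by (auto simp: small_stage_def extends_def)
  then have "decides b T" unfolding decides_def using T(3) by blast
  then show ?thesis using that T extends_trans[OF T'(2)] by blast
qed

text \<open>Stage \<open>f x\<close> decides the \<open>x\<close>-th sequence of sets. Any sequence
  of points of the union appears, with its names, at one stage below \<open>omega1\<close>. So the
  stage that decided these names has settled a sequence carrying them, and equal names mean equal
  points in the union.\<close>

lemma generic_stage:
  assumes CH: continuum_hypothesis and S0: "small_stage S0"
  obtains G where "is_stage G" "S0 \<preceq> G"
    "\<And>z. \<forall>n::nat. z n \<in> pts G \<Longrightarrow> \<exists>k v. strict_mono k \<and> ultrafilter v \<and> alg_lim (alg G) (z \<circ> k) v \<and>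
      (\<forall>\<gamma> \<delta>. (\<forall>n. rk G (z n) \<le> \<gamma>) \<longrightarrow> ord1_succ_of \<delta> \<gamma> \<longrightarrow> rk G v \<le> \<delta>)"
proof -
  obtain g0 :: "ord1 \<Rightarrow> nat set" where g0: "bij_betw g0 {\<gamma>. \<gamma> < omega1} UNIV"
    using CH_bij_betw_nat_sets[OF CH] by blast
  \<comment> \<open>Through pairing, one set of naturals codes a whole sequence of sets, so the
    enumeration meets every sequence of names.\<close>
  define g where "g \<gamma> n = {m. prod_encode (n, m) \<in> g0 \<gamma>}" for \<gamma> n
  have g: "\<exists>\<gamma><omega1. g \<gamma> = b" for b :: "nat \<Rightarrow> nat set"
  proof -
    let ?N = "prod_encode ` {(n, m). m \<in> b n}"
    have "?N \<in> g0 ` {\<gamma>. \<gamma> < omega1}" using g0 by (simp add: bij_betw_def)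
    then obtain \<gamma> where \<gamma>: "\<gamma> < omega1" "g0 \<gamma> = ?N" by auto
    have "g \<gamma> = b"
      unfolding g_def \<gamma>(2) by (auto simp: fun_eq_iff inj_image_mem_iff)
    then show ?thesis using \<gamma>(1) by blast
  qed
  \<comment> \<open>The recursion runs over the whole type, but its value at \<open>omega1\<close>
    is unconstrained: only smaller ordinals have countably many predecessors, which keeps the union
    of the earlier stages small.\<close>
  define P where "P f x T \<longleftrightarrow> x = omega1 \<or>
    small_stage T \<and> S0 \<preceq> T \<and> (\<forall>y<x. f y \<preceq> T) \<and> decides (g x) T" for f x T
  have "\<exists>f. \<forall>x. P f x (f x)"
  proof (rule dependent_wellorder_choice)
    show "P f x T = P f' x T" if "\<And>y. y < x \<Longrightarrow> f y = f' y" for T f f' x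
      using that by (auto simp: P_def)
  next
    fix x f assume IH: "\<And>y. y < x \<Longrightarrow> P f y (f y)"
    show "\<exists>T. P f x T"
    proof (cases "x = omega1")
      case False
      \<comment> \<open>\<open>S0\<close> makes the chain nonempty at the first step.\<close>
      let ?C = "insert S0 (f ` {y. y < x})"
      have f: "small_stage (f y)" "S0 \<preceq> f y" "\<And>y'. y' < y \<Longrightarrow> f y' \<preceq> f y" if "y < x" for y
        using IH[OF that] that ord1_le_omega1[of x] by (auto simp: P_def)
      have C: "small_stage S" if "S \<in> ?C" for S using that S0 f(1) by auto
      obtain U where U: "is_stage U" "\<And>S. S \<in> ?C \<Longrightarrow> S \<preceq> U" "alg U = (\<Union>S\<in>?C. alg S)"
      proof (rule chain_upper_bound[of ?C])
        show "is_stage S" if "S \<in> ?C" for S using C[OF that] by (simp add: small_stage_def)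
        have "f y \<preceq> f y' \<or> f y' \<preceq> f y" if "y < x" "y' < x" for y y'
          using f(3)[OF that(1)] f(3)[OF that(2)] by (cases y y' rule: linorder_cases) auto
        then show "S \<preceq> T \<or> T \<preceq> S" if "S \<in> ?C" "T \<in> ?C" for S T
          using that f(2) by auto
      qed (use that in auto)
      have "countable {y. y < x}" using False by (simp add: countable_below_iff)
      then have "countable (\<Union>S\<in>?C. alg S)"
        using C by (intro countable_UN) (auto simp: small_stage_def)
      then have "small_stage U" using U(1,3) by (simp add: small_stage_def)
      then obtain T where "small_stage T" "U \<preceq> T" "decides (g x) T" using decides_dense by blast
      then have "P f x T" unfolding P_def using U(2) extends_trans by blast
      then show ?thesis by blast
    qed (simp add: P_def)
  qed
  then obtain f where "\<And>x. P f x (f x)" by blast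
  then have f: "small_stage (f x)" "S0 \<preceq> f x" "\<And>y. y < x \<Longrightarrow> f y \<preceq> f x" "decides (g x) (f x)"
    if "x < omega1" for x using that unfolding P_def by (metis less_irrefl)+
  have f_mono: "f y \<preceq> f x" if "y \<le> x" "x < omega1" for x y
    using f(3)[OF that(2)] that(1) by (cases "y = x") auto
  have f_stage: "is_stage (f x)" if "x < omega1" for x using f(1)[OF that] by (simp add: small_stage_def)
  let ?C = "f ` {x. x < omega1}"
  obtain \<gamma>0 where \<gamma>0: "\<gamma>0 < omega1" using g by blast
  obtain G where G: "is_stage G" "\<And>S. S \<in> ?C \<Longrightarrow> S \<preceq> G" "alg G = (\<Union>S\<in>?C. alg S)"
    "pts G = (\<Union>S\<in>?C. pts S)"
  proof (rule chain_upper_bound[of ?C])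
    show "?C \<noteq> {}" using \<gamma>0 by blast
    show "is_stage S" if "S \<in> ?C" for S using that f_stage by auto
    show "S \<preceq> T \<or> T \<preceq> S" if "S \<in> ?C" "T \<in> ?C" for S T
      using that f_mono by (metis (mono_tags, lifting) imageE le_cases mem_Collect_eq)
  qed (use that in auto)
  have fG: "f x \<preceq> G" if "x < omega1" for x using G(2) that by blast
  have "\<exists>k v. strict_mono k \<and> ultrafilter v \<and> alg_lim (alg G) (z \<circ> k) v \<and>
      (\<forall>\<gamma> \<delta>. (\<forall>n. rk G (z n) \<le> \<gamma>) \<longrightarrow> ord1_succ_of \<delta> \<gamma> \<longrightarrow> rk G v \<le> \<delta>)"
    if "\<forall>n::nat. z n \<in> pts G" for z
  proof -
    have z: "z n \<in> pts G" for n using that by blast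
    then have "\<forall>n. \<exists>x<omega1. z n \<in> pts (f x)" using G(4) by auto
    then obtain x where x: "\<And>n. x n < omega1" "\<And>n. z n \<in> pts (f (x n))" by metis
    have zu: "ultrafilter (z n)" for n using is_stage.stage_ultrafilter[OF G(1) z] .
    have "\<forall>n. \<exists>b. isolates (alg (f (x n))) (rk (f (x n))) b (z n)"
      using is_stage.stage_isolates[OF f_stage[OF x(1)] zu] by blast
    then obtain b where b: "\<And>n. isolates (alg (f (x n))) (rk (f (x n))) (b n) (z n)" by metis
    obtain i where i: "i < omega1" "g i = b" using g by blast
    \<comment> \<open>Countably many countable ordinals have a countable upper bound.\<close>
    have "\<exists>y<omega1. i \<le> y \<and> (\<forall>n. x n \<le> y)"
    proof (rule ccontr)
      assume *: "\<not> ?thesis"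
      have "{y. y < omega1} \<subseteq> {y. y < i} \<union> (\<Union>n. {y. y < x n})"
        using * by (force simp: not_le)
      moreover have "countable {y. y < i}" "\<And>n. countable {y. y < x n}"
        using i(1) x(1) by (metis countable_below_iff less_irrefl)+
      then have "countable ({y. y < i} \<union> (\<Union>n. {y. y < x n}))" by auto
      ultimately have "countable {y. y < omega1}" by (rule countable_subset)
      then show False by (simp add: countable_below_iff)
    qed
    then obtain y where y: "y < omega1" "i \<le> y" "\<And>n. x n \<le> y" by blast
    have "z n \<in> pts (f y) \<and> isolates (alg (f y)) (rk (f y)) (b n) (z n)" for n
    proof
      have "pts (f (x n)) \<subseteq> pts (f y)" using f_mono[OF y(3) y(1)] by (simp add: extends_def)
      then show "z n \<in> pts (f y)" using x(2) by blast
    qed (rule isolates_extends[OF f_stage[OF x(1)] f_mono[OF y(3) y(1)] x(2) b])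
    \<comment> \<open>Stage \<open>y\<close> extends stage \<open>i\<close> and carries all the
      names, so the second alternative of \<open>decides\<close> fails at \<open>i\<close>.\<close>
    then have "\<not> (\<forall>T'. small_stage T' \<longrightarrow> f i \<preceq> T' \<longrightarrow>
        \<not> (\<forall>n. \<exists>z\<in>pts T'. isolates (alg T') (rk T') (b n) z))"
      using f(1)[OF y(1)] f_mono[OF y(2,1)] by blast
    then obtain w where w: "\<And>n. w n \<in> pts (f i)"
      "\<And>n. isolates (alg (f i)) (rk (f i)) (b n) (w n)" and "settled (f i) w"
      using f(4)[OF i(1)] unfolding i(2) decides_def by blast
    then obtain k v where k: "strict_mono k" and v: "v \<in> pts (f i)"
      and lim: "\<And>T'. small_stage T' \<Longrightarrow> f i \<preceq> T' \<Longrightarrow> alg_lim (alg T') (w \<circ> k) v"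
      and rv: "\<And>\<gamma> \<delta>. (\<forall>n. rk (f i) (w n) \<le> \<gamma>) \<Longrightarrow> ord1_succ_of \<delta> \<gamma> \<Longrightarrow> rk (f i) v \<le> \<delta>"
      unfolding settled_def by blast
    have wu: "ultrafilter (w n)" for n using is_stage.stage_ultrafilter[OF f_stage[OF i(1)] w(1)] .
    have wG: "isolates (alg G) (rk G) (b n) (w n)" for n
      by (rule isolates_extends[OF f_stage[OF i(1)] fG[OF i(1)] w])
    have zG: "isolates (alg G) (rk G) (b n) (z n)" for n
      by (rule isolates_extends[OF f_stage[OF x(1)] fG[OF x(1)] x(2) b])
    have wz: "alg_eq (alg G) (w n) (z n)" for n
    proof (rule ccontr)
      assume ne: "\<not> ?thesis"
      then have "rk G (z n) < rk G (w n)" using wG[of n] zG[of n] zu by (auto simp: isolates_def)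
      moreover have "rk G (w n) < rk G (z n)"
        using wG[of n] zG[of n] wu ne alg_eq_sym unfolding isolates_def by blast
      ultimately show False by simp
    qed
    have "alg_lim (alg G) (w \<circ> k) v"
      unfolding alg_lim_def
    proof (intro ballI impI)
      fix c assume "c \<in> alg G" and vc: "has v c"
      then obtain y where y: "y < omega1" "c \<in> alg (f y)" using G(3) by auto
      have m: "max y i < omega1" using y(1) i(1) by simp
      then have "c \<in> alg (f (max y i))" using y(2) f_mono[of y "max y i"] by (auto simp: extends_def)
      then show "\<forall>\<^sub>F n in sequentially. has ((w \<circ> k) n) c"
        using lim[OF f(1)[OF m] f_mono[OF _ m]] vc unfolding alg_lim_def by simp
    qed
    then have "alg_lim (alg G) (z \<circ> k) v" by (rule alg_lim_cong) (use wz in auto)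
    moreover have "rk G v \<le> \<delta>" if "\<forall>n. rk G (z n) \<le> \<gamma>" "ord1_succ_of \<delta> \<gamma>" for \<gamma> \<delta>
    proof -
      have "rk G v = rk (f i) v" using fG[OF i(1)] v by (simp add: extends_def)
      moreover have "rk (f i) (w n) = rk G (z n)" for n
        using fG[OF i(1)] w(1)[of n] is_stage.stage_rk_cong[OF G(1) wu zu wz, of n]
        by (simp add: extends_def)
      ultimately show ?thesis using rv[of \<gamma> \<delta>] that by simp
    qed
    moreover have "ultrafilter v" using is_stage.stage_ultrafilter[OF f_stage[OF i(1)] v] .
    ultimately show ?thesis using k by blast
  qed
  moreover have "S0 \<preceq> G" using extends_trans[OF f(2)[OF \<gamma>0] fG[OF \<gamma>0]] .
  ultimately show ?thesis using that G(1) by blast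
qed

section \<open>Ranked algebras\<close>

definition alg_rank :: "(nat filter \<Rightarrow> ord1) \<Rightarrow> nat filter set \<Rightarrow> ord1"
  where "alg_rank r x = r (SOME u. u \<in> x)"

text \<open>The inductive step of the lower bound, confined to sequences on \<open>A\<close>. The
  confinement matters for the sum: sequences running through infinitely many components may go to
  infinity, whereas each single component is still controlled.\<close>

definition bounded_limits :: "nat set set \<Rightarrow> (nat filter \<Rightarrow> ord1) \<Rightarrow> nat set \<Rightarrow> bool"
  where "bounded_limits B r A \<longleftrightarrow> (\<forall>(s :: nat \<Rightarrow> nat filter) \<gamma> \<delta>.
    (\<forall>n. ultrafilter (s n) \<and> has (s n) A) \<longrightarrow> (\<forall>n. r (s n) \<le> \<gamma>) \<longrightarrow> ord1_succ_of \<delta> \<gamma> \<longrightarrow>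
    (\<exists>k v. strict_mono k \<and> ultrafilter v \<and> alg_lim B (s \<circ> k) v \<and> r v \<le> \<delta>))"

text \<open>Representatives and the chain of stages are forgotten here, so that generic algebras and
  their sum over an almost disjoint family share one interface.\<close>

locale ranked_algebra =
  fixes B :: "nat set set" and r :: "nat filter \<Rightarrow> ord1"
  assumes alg: "algebra UNIV B"
    and singleton: "\<And>n. {n} \<in> B"
    and cong: "\<And>u v. ultrafilter u \<Longrightarrow> ultrafilter v \<Longrightarrow> alg_eq B u v \<Longrightarrow> r u = r v"
    and isolates: "\<And>u. ultrafilter u \<Longrightarrow> \<exists>b. isolates B r b u"
    and principal_le: "\<And>u n \<gamma>. ultrafilter u \<Longrightarrow> has u {n} \<Longrightarrow> r u \<le> \<gamma>"
    and nonlimit_rank: "\<And>u. ultrafilter u \<Longrightarrow> r u < omega1 \<Longrightarrow>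
      (\<forall>\<beta>. \<not> \<beta> < r u) \<or> (\<exists>\<beta>. ord1_succ_of (r u) \<beta>)"
    and subseq_lim: "\<And>s. (\<And>n::nat. ultrafilter (s n)) \<Longrightarrow>
      \<exists>k v. strict_mono k \<and> ultrafilter v \<and> alg_lim B (s \<circ> k) v"
begin

lemma Compl_mem: "b \<in> B \<Longrightarrow> - b \<in> B"
  using algebra.compl_sets[OF alg] by (simp add: Compl_eq_Diff_UNIV)

lemma Int_mem: "a \<in> B \<Longrightarrow> b \<in> B \<Longrightarrow> a \<inter> b \<in> B"
  using alg unfolding algebra_iff_Int by blast

lemma finite_mem: "finite N \<Longrightarrow> N \<in> B"
proof (induction rule: finite_induct)
  case empty then show ?case using alg unfolding algebra_iff_Int by blast
next
  case (insert n N)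
  then show ?case using Compl_mem[OF Int_mem[OF Compl_mem[OF singleton[of n]] Compl_mem]] by simp
qed

lemma alg_rank_class:
  assumes "ultrafilter u"
  shows "alg_rank r (alg_class B u) = r u"
proof -
  have "u \<in> alg_class B u" using assms by (simp add: alg_rel_def)
  moreover define w where "w = (SOME v. v \<in> alg_class B u)"
  ultimately have "w \<in> alg_class B u" by (metis someI)
  then have "r u = r w" using cong[OF assms] by (simp add: alg_rel_def)
  then show ?thesis by (simp add: alg_rank_def w_def)
qed

lemma lim_has:
  assumes "alg_lim B s v" "\<And>n::nat. ultrafilter (s n)" "ultrafilter v" "b \<in> B" "\<And>n. has (s n) b"
  shows "has v b"
proof (rule ccontr)
  assume "\<not> has v b"
  then have "has v (- b)" "- b \<in> B" using assms(3,4) Compl_mem by auto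
  then have "\<forall>\<^sub>F n in sequentially. has (s n) (- b)" using assms(1) by (simp add: alg_lim_def)
  then show False using assms(2,5) by simp
qed

sublocale ranked_space "alg_space B" "alg_rank r"
proof
  fix s :: "nat \<Rightarrow> nat filter set" assume "\<And>n. s n \<in> topspace (alg_space B)"
  then have "\<forall>n. \<exists>u. ultrafilter u \<and> s n = alg_class B u" using alg_space_cases by metis
  then obtain u where u: "\<And>n. ultrafilter (u n)" "\<And>n. s n = alg_class B (u n)" by metis
  obtain k v where k: "strict_mono k" and v: "ultrafilter v" "alg_lim B (u \<circ> k) v"
    using subseq_lim[of u] u(1) by blast
  have "limitin (alg_space B) (\<lambda>n. alg_class B ((u \<circ> k) n)) (alg_class B v) sequentially"
    using limitin_alg_space[OF alg _ v(1), of "u \<circ> k"] u(1) v(2) by simp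
  then show "\<exists>k l. strict_mono k \<and> limitin (alg_space B) (s \<circ> k) l sequentially"
    using k u(2) by (auto simp: o_def)
next
  fix x assume "x \<in> topspace (alg_space B)"
  then obtain u where u: "ultrafilter u" "x = alg_class B u" by (rule alg_space_cases)
  then show "alg_rank r x < omega1 \<Longrightarrow> (\<forall>\<beta>. \<not> \<beta> < alg_rank r x) \<or> (\<exists>\<beta>. ord1_succ_of (alg_rank r x) \<beta>)"
    using nonlimit_rank by (simp add: alg_rank_class)
  obtain b where b: "b \<in> B" "has u b"
    "\<And>v. ultrafilter v \<Longrightarrow> has v b \<Longrightarrow> alg_eq B u v \<or> r v < r u"
    using isolates[OF u(1)] by (auto simp: isolates_def)
  have "alg_rank r y < alg_rank r x" if y: "y \<in> alg_cell B b - {x}" for y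
  proof -
    obtain v where "ultrafilter v" "has v b" "y = alg_class B v" using y by (auto simp: alg_cell_def)
    then show ?thesis using y b(3)[of v] u alg_eq_sym[of B u v] by (auto simp: alg_rank_class alg_class_eq_iff)
  qed
  then show "\<exists>U. closedin (alg_space B) U \<and> openin (alg_space B) U \<and> x \<in> U \<and>
      (\<forall>y\<in>U - {x}. alg_rank r y < alg_rank r x)"
    using b u alg by (intro exI[of _ "alg_cell B b"]) (simp add: closedin_alg_cell openin_alg_cell alg_cell_iff)
next
  show "\<exists>U. closedin (alg_space B) U \<and> openin (alg_space B) U \<and> x \<in> U \<and> y \<notin> U"
    if "x \<in> topspace (alg_space B)" "y \<in> topspace (alg_space B)" "x \<noteq> y" for x y
    using alg_space_separated[OF alg that] by blast
qed

text \<open>The witness is the set of points given by the numbers in \<open>A\<close>. It is dense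
  in the cell of \<open>A\<close>, so its closure contains the point of \<open>u\<close>, while
  \<gamma> closures produce only ranks up to \<gamma>.\<close>

lemma seqcl_iter_principal_neq_closure:
  assumes A: "A \<in> B" and u: "ultrafilter u" "has u A" "\<gamma> < r u"
    and step: "bounded_limits B r A"
  shows "\<exists>M\<subseteq>topspace (alg_space B). seqcl_iter (alg_space B) \<gamma> M \<noteq> alg_space B closure_of M"
proof -
  define D where "D = (\<lambda>n. alg_class B (principal {n})) ` A"
  have "seqcl_iter (alg_space B) \<gamma> D \<subseteq> {x \<in> alg_cell B A. alg_rank r x \<le> \<gamma>}"
  proof (rule seqcl_iter_rank_le)
    show "Hausdorff_space (alg_space B)" by (rule Hausdorff_space_alg_space[OF alg])
    show "closedin (alg_space B) (alg_cell B A)" by (rule closedin_alg_cell[OF alg A])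
    show "D \<subseteq> alg_cell B A"
      unfolding D_def alg_cell_def by (auto simp: ultrafilter_principal)
    show "alg_rank r x \<le> \<beta>" if x: "x \<in> D" for x \<beta>
    proof -
      obtain n where "x = alg_class B (principal {n})" using x by (auto simp: D_def)
      then show ?thesis using principal_le[OF ultrafilter_principal[of n], of n \<beta>]
        by (simp add: alg_rank_class ultrafilter_principal)
    qed
    fix s :: "nat \<Rightarrow> nat filter set" and \<beta> \<delta>
    assume s: "\<And>n. s n \<in> alg_cell B A" "\<And>n. alg_rank r (s n) \<le> \<beta>" and \<delta>: "ord1_succ_of \<delta> \<beta>"
    have "\<forall>n. \<exists>u. ultrafilter u \<and> has u A \<and> s n = alg_class B u"
      using s(1) by (auto simp: alg_cell_def)
    then obtain u where u: "\<And>n. ultrafilter (u n)" "\<And>n. has (u n) A" "\<And>n. s n = alg_class B (u n)" by metis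
    have "r (u n) \<le> \<beta>" for n using s(2)[of n] u by (simp add: alg_rank_class)
    then obtain k v where k: "strict_mono k" and v: "ultrafilter v" "alg_lim B (u \<circ> k) v" "r v \<le> \<delta>"
      using step u \<delta> unfolding bounded_limits_def by blast
    have "limitin (alg_space B) (\<lambda>n. alg_class B ((u \<circ> k) n)) (alg_class B v) sequentially"
      using limitin_alg_space[OF alg _ v(1), of "u \<circ> k"] u(1) v(2) by simp
    then have "limitin (alg_space B) (s \<circ> k) (alg_class B v) sequentially"
      using u(3) by (simp add: o_def)
    then show "\<exists>k l. strict_mono k \<and> limitin (alg_space B) (s \<circ> k) l sequentially \<and> alg_rank r l \<le> \<delta>"
      using k v by (metis alg_rank_class)
  qed
  then have "alg_class B u \<notin> seqcl_iter (alg_space B) \<gamma> D"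
    using u by (auto simp: alg_rank_class)
  moreover have "alg_class B u \<in> alg_space B closure_of D"
    unfolding alg_space_closure_iff[OF alg u(1)]
  proof (intro ballI impI)
    fix b assume b: "b \<in> B" "has u b"
    then have "has u (b \<inter> A)" using u(2) by simp
    then have "b \<inter> A \<noteq> {}" using has_empty[OF u(1)] by metis
    then obtain n where "n \<in> A" "n \<in> b" by blast
    then have "alg_class B (principal {n}) \<in> D \<inter> alg_cell B b"
      using b by (auto simp: D_def alg_cell_iff ultrafilter_principal)
    then show "D \<inter> alg_cell B b \<noteq> {}" by blast
  qed
  moreover have "D \<subseteq> topspace (alg_space B)" by (auto simp: D_def ultrafilter_principal)
  ultimately show ?thesis by blast
qed

end

section \<open>Successor ordinals\<close>

lemma ord1_zero:
  obtains z :: ord1 where "\<And>\<gamma>. z \<le> \<gamma>" "z < omega1"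
proof -
  have z: "(LEAST \<gamma>. True) \<le> (\<gamma> :: ord1)" for \<gamma> by (rule Least_le) simp
  have "uncountable {\<gamma>. \<gamma> < omega1}" by (simp add: countable_below_iff)
  then have "{\<gamma>. \<gamma> < omega1} \<noteq> {}" by force
  then obtain \<gamma> where "\<gamma> < omega1" by blast
  then show ?thesis using that[OF z] z[of \<gamma>] by simp
qed

lemma ultrafilter_finite_cases:
  assumes "ultrafilter u" "\<not> (\<exists>n. has u {n})" "finite N"
  shows "\<not> has u N"
  using has_finite[OF assms(1,3)] assms(2) by blast

text \<open>Over the finite and cofinite sets with \<open>A\<close> adjoined, nonprincipal
  ultrafilters that agree on \<open>A\<close> form one point. It gets the full rank \<alpha> at
  once: at this stage the rank is only a permitted upper bound, and later splittings create the
  intermediate ranks.\<close>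

lemma initial_stage:
  assumes A: "infinite A" and \<alpha>: "ord1_succ_of \<alpha> \<beta>"
  obtains S where "small_stage S" "A \<in> alg S" "\<And>u. ultrafilter u \<Longrightarrow> rk S u \<le> \<alpha>"
    "\<And>u n \<gamma>. ultrafilter u \<Longrightarrow> has u {n} \<Longrightarrow> rk S u \<le> \<gamma>" "\<exists>u\<in>pts S. has u A \<and> rk S u = \<alpha>"
proof -
  obtain z :: ord1 where z: "\<And>\<gamma>. z \<le> \<gamma>" using ord1_zero by blast
  have z\<alpha>: "z < \<alpha>" using z[of \<beta>] \<alpha> by (auto simp: ord1_succ_of_def)
  define F where "F = {X :: nat set. finite X \<or> finite (- X)}"
  have "algebra UNIV F"
    unfolding algebra_iff_Int F_def by (auto simp: Compl_eq_Diff_UNIV[symmetric])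
  define B where "B = adjoin F A"
  have alg: "algebra UNIV B" unfolding B_def by (rule algebra_adjoin) fact
  have AB: "A \<in> B" unfolding B_def by (rule in_adjoin) fact
  have single: "{n} \<in> B" for n using subset_adjoin[of F A] by (auto simp: B_def F_def)
  define p where "p u \<longleftrightarrow> (\<exists>n. has u {n})" for u :: "nat filter"
  define r where "r u = (if p u then z else \<alpha>)" for u
  have eqI: "alg_eq B u v"
    if u: "ultrafilter u" "\<not> p u" and v: "ultrafilter v" "\<not> p v" and uvA: "has u A \<longleftrightarrow> has v A" for u v
  proof -
    have "has u X \<longleftrightarrow> has v X" if "X \<in> F" for X
      using that ultrafilter_finite_cases[OF u(1), of X] ultrafilter_finite_cases[OF u(1), of "- X"]
        ultrafilter_finite_cases[OF v(1), of X] ultrafilter_finite_cases[OF v(1), of "- X"] u v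
      by (auto simp: F_def p_def)
    then show ?thesis
      unfolding B_def alg_eq_adjoin_iff[OF \<open>algebra UNIV F\<close> u(1) v(1)] using uvA
      by (auto simp: alg_eq_def)
  qed
  define \<epsilon> where "\<epsilon> u = (SOME v. ultrafilter v \<and> alg_eq B u v)" for u
  have \<epsilon>: "ultrafilter (\<epsilon> u)" "alg_eq B u (\<epsilon> u)" if "ultrafilter u" for u
    using someI[of "\<lambda>v. ultrafilter v \<and> alg_eq B u v" u] that by (auto simp: \<epsilon>_def)
  have \<epsilon>_cong: "\<epsilon> u = \<epsilon> v" if "alg_eq B u v" for u v
  proof -
    have "alg_eq B u w \<longleftrightarrow> alg_eq B v w" for w using that alg_eq_sym alg_eq_trans by blast
    then show ?thesis by (simp add: \<epsilon>_def)
  qed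
  define S where "S = \<lparr>alg = B, pts = \<epsilon> ` {u. ultrafilter u}, rk = r\<rparr>"
  have p_cong: "p u \<longleftrightarrow> p v" if "alg_eq B u v" for u v
    using that single by (auto simp: p_def alg_eq_def)
  have "is_stage S"
    unfolding S_def
  proof (rule is_stage.intro, unfold stage.simps)
    show "algebra UNIV B" "\<And>n. {n} \<in> B" by fact+
    show "ultrafilter y" if "y \<in> \<epsilon> ` {u. ultrafilter u}" for y using that \<epsilon>(1) by blast
    show "\<exists>y\<in>\<epsilon> ` {u. ultrafilter u}. alg_eq B u y" if "ultrafilter u" for u using that \<epsilon>(2) by blast
    show "x = y" if xy: "x \<in> \<epsilon> ` {u. ultrafilter u}" "y \<in> \<epsilon> ` {u. ultrafilter u}" "alg_eq B x y" for x y
    proof -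
      obtain u v where uv: "ultrafilter u" "x = \<epsilon> u" "ultrafilter v" "y = \<epsilon> v" using xy by blast
      then have "alg_eq B u v" using \<epsilon>(2) xy(3) alg_eq_sym alg_eq_trans by metis
      then show ?thesis using \<epsilon>_cong uv by simp
    qed
    show "r u = r v" if "alg_eq B u v" for u v using p_cong[OF that] by (simp add: r_def)
    show "(\<forall>\<beta>. \<not> \<beta> < r u) \<or> (\<exists>\<beta>. ord1_succ_of (r u) \<beta>)" for u
      using z \<alpha> by (auto simp: r_def not_less)
    show "\<exists>b. isolates B r b u" if u: "ultrafilter u" for u
    proof (cases "p u")
      case True
      then obtain n where n: "has u {n}" by (auto simp: p_def)
      have "alg_eq B u v" if "ultrafilter v" "has v {n}" for v
        using has_singleton[OF u n] has_singleton[OF that] by (simp add: alg_eq_def)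
      then have "isolates B r {n} u" using n single by (simp add: isolates_def)
      then show ?thesis by blast
    next
      case False
      define b where "b = (if has u A then A else - A)"
      have "b \<in> B" using AB algebra.compl_sets[OF alg AB] by (simp add: b_def Compl_eq_Diff_UNIV)
      moreover have "has u b" using u by (simp add: b_def)
      moreover have "alg_eq B u v \<or> r v < r u" if v: "ultrafilter v" "has v b" for v
      proof (cases "p v")
        case True then show ?thesis using False z\<alpha> by (simp add: r_def)
      next
        case pv: False
        have "has u A \<longleftrightarrow> has v A" using v by (auto simp: b_def split: if_splits)
        then show ?thesis using eqI[OF u False v(1) pv] by blast
      qed
      ultimately have "isolates B r b u" by (simp add: isolates_def)
      then show ?thesis by blast
    qed
  qed
  moreover have "countable B"
  proof -
    have "F = {X. finite X} \<union> uminus ` {X. finite X}"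
      unfolding F_def by (auto simp: image_iff)
    then have "countable F" by (simp add: countable_Collect_finite)
    then show ?thesis unfolding B_def by (rule countable_adjoin)
  qed
  moreover obtain u where u: "ultrafilter u" "has u A" "\<And>N. finite N \<Longrightarrow> \<not> has u N"
    using ultrafilter_nonprincipal[OF A] by metis
  have "\<epsilon> u \<in> pts S" "has (\<epsilon> u) A" "rk S (\<epsilon> u) = \<alpha>"
  proof -
    show "\<epsilon> u \<in> pts S" using u(1) by (simp add: S_def)
    show "has (\<epsilon> u) A" using \<epsilon>(2)[OF u(1)] AB u(2) by (simp add: alg_eq_def)
    have "\<not> p u" using u(3) by (auto simp: p_def)
    then show "rk S (\<epsilon> u) = \<alpha>" using p_cong[OF \<epsilon>(2)[OF u(1)]] by (simp add: S_def r_def)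
  qed
  moreover have "rk S v \<le> \<alpha>" for v using z by (simp add: S_def r_def)
  moreover have "rk S v \<le> \<gamma>" if "has v {n}" for v n \<gamma>
  proof -
    have "p v" using that by (auto simp: p_def)
    then show ?thesis using z by (simp add: S_def r_def)
  qed
  moreover have "A \<in> alg S" "alg S = B" using AB by (simp_all add: S_def)
  ultimately show ?thesis using that[of S] unfolding small_stage_def by metis
qed

text \<open>\<open>A\<close> is a parameter because there are two uses: all of \<omega> for a
  successor order, and each member of an almost disjoint family for a limit order.\<close>

lemma successor_algebra:
  assumes CH: continuum_hypothesis and A: "infinite A" and \<alpha>: "ord1_succ_of \<alpha> \<beta>"
  shows "\<exists>B r. ranked_algebra B r \<and> A \<in> B \<and> (\<forall>u. ultrafilter u \<longrightarrow> r u \<le> \<alpha>) \<and>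
    (\<exists>u. ultrafilter u \<and> has u A \<and> r u = \<alpha>) \<and> bounded_limits B r A"
proof -
  obtain S where S: "small_stage S" "A \<in> alg S" "\<And>u. ultrafilter u \<Longrightarrow> rk S u \<le> \<alpha>"
    "\<And>u n \<gamma>. ultrafilter u \<Longrightarrow> has u {n} \<Longrightarrow> rk S u \<le> \<gamma>" "\<exists>u\<in>pts S. has u A \<and> rk S u = \<alpha>"
    using initial_stage[OF A \<alpha>] by blast
  obtain G where G: "is_stage G" "S \<preceq> G" and seq:
    "\<And>z. \<forall>n::nat. z n \<in> pts G \<Longrightarrow> \<exists>k v. strict_mono k \<and> ultrafilter v \<and> alg_lim (alg G) (z \<circ> k) v \<and>
      (\<forall>\<gamma> \<delta>. (\<forall>n. rk G (z n) \<le> \<gamma>) \<longrightarrow> ord1_succ_of \<delta> \<gamma> \<longrightarrow> rk G v \<le> \<delta>)"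
    by (rule generic_stage[OF CH S(1)]) (rule that)
  have seq': "\<exists>k v. strict_mono k \<and> ultrafilter v \<and> alg_lim (alg G) (s \<circ> k) v \<and>
      (\<forall>\<gamma> \<delta>. (\<forall>n. rk G (s n) \<le> \<gamma>) \<longrightarrow> ord1_succ_of \<delta> \<gamma> \<longrightarrow> rk G v \<le> \<delta>)"
    if s: "\<And>n::nat. ultrafilter (s n)" for s
  proof -
    have "\<forall>n. \<exists>z\<in>pts G. alg_eq (alg G) (s n) z" using is_stage.stage_point[OF G(1) s] by blast
    then obtain z where z: "\<And>n. z n \<in> pts G" "\<And>n. alg_eq (alg G) (s n) (z n)" by metis
    have rz: "rk G (s n) = rk G (z n)" for n
      using is_stage.stage_rk_cong[OF G(1) s is_stage.stage_ultrafilter[OF G(1) z(1)] z(2)] .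
    obtain k v where k: "strict_mono k" "ultrafilter v" and lim: "alg_lim (alg G) (z \<circ> k) v"
      and "\<forall>\<gamma> \<delta>. (\<forall>n. rk G (z n) \<le> \<gamma>) \<longrightarrow> ord1_succ_of \<delta> \<gamma> \<longrightarrow> rk G v \<le> \<delta>"
      using seq[of z] z(1) by blast
    moreover have "alg_lim (alg G) (s \<circ> k) v"
      by (rule alg_lim_cong[OF lim]) (auto intro: alg_eq_sym z(2))
    ultimately show ?thesis unfolding rz by blast
  qed
  have le: "rk G u \<le> rk S u" if "ultrafilter u" for u using G(2) that by (simp add: extends_def)
  have "ranked_algebra (alg G) (rk G)"
  proof (rule ranked_algebra.intro)
    show "algebra UNIV (alg G)" by (rule is_stage.stage_algebra[OF G(1)])
    show "{n} \<in> alg G" for n by (rule is_stage.stage_singleton[OF G(1)])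
    show "rk G u = rk G v" if "ultrafilter u" "ultrafilter v" "alg_eq (alg G) u v" for u v
      by (rule is_stage.stage_rk_cong[OF G(1) that])
    show "\<exists>b. isolates (alg G) (rk G) b u" if "ultrafilter u" for u
      by (rule is_stage.stage_isolates[OF G(1) that])
    show "rk G u \<le> \<gamma>" if "ultrafilter u" "has u {n}" for u n \<gamma>
      using order_trans[OF le S(4)] that by blast
    show "(\<forall>\<beta>. \<not> \<beta> < rk G u) \<or> (\<exists>\<beta>. ord1_succ_of (rk G u) \<beta>)" if "ultrafilter u" for u
      by (rule is_stage.stage_nonlimit[OF G(1) that])
    show "\<exists>k v. strict_mono k \<and> ultrafilter v \<and> alg_lim (alg G) (s \<circ> k) v"
      if "\<And>n::nat. ultrafilter (s n)" for s using seq'[of s] that by blast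
  qed
  moreover have "A \<in> alg G" using S(2) G(2) by (auto simp: extends_def)
  moreover have "rk G u \<le> \<alpha>" if "ultrafilter u" for u using order_trans[OF le S(3)] that by blast
  moreover have "\<exists>u. ultrafilter u \<and> has u A \<and> rk G u = \<alpha>"
  proof -
    obtain u where u: "u \<in> pts S" "has u A" "rk S u = \<alpha>" using S(5) by blast
    then have "u \<in> pts G" "rk G u = \<alpha>" using G(2) by (auto simp: extends_def)
    then show ?thesis using u is_stage.stage_ultrafilter[OF G(1)] by blast
  qed
  moreover have "bounded_limits (alg G) (rk G) A"
    unfolding bounded_limits_def using seq' by blast
  ultimately show ?thesis by blast
qed

section \<open>Limit ordinals\<close>

text \<open>\<open>f X\<close> is a branch of the binary tree, coded by the initial segments of
  \<open>X\<close>; branches of distinct sets separate at a finite level. There are enough of them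
  to reserve one for every ordinal below \<alpha>.\<close>

lemma almost_disjoint_branches:
  obtains f :: "nat set \<Rightarrow> nat set"
  where "\<And>X. infinite (f X)" "\<And>X Y. X \<noteq> Y \<Longrightarrow> finite (f X \<inter> f Y)" "inj f"
proof -
  define f where "f X = range (\<lambda>n. prod_encode (n, set_encode (X \<inter> {..<n})))" for X
  have inf: "infinite (f X)" for X
    unfolding f_def by (rule range_inj_infinite) (auto simp: inj_def)
  have fin: "finite (f X \<inter> f Y)" if XY: "X \<noteq> Y" for X Y
  proof -
    obtain m where m: "m \<in> X \<longleftrightarrow> m \<notin> Y" using XY by blast
    have "f X \<inter> f Y \<subseteq> (\<lambda>n. prod_encode (n, set_encode (X \<inter> {..<n}))) ` {..m}"
    proof
      fix c assume "c \<in> f X \<inter> f Y"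
      then obtain n n' where c: "c = prod_encode (n, set_encode (X \<inter> {..<n}))"
        "c = prod_encode (n', set_encode (Y \<inter> {..<n'}))" by (auto simp: f_def)
      then have "set_encode (X \<inter> {..<n}) = set_encode (Y \<inter> {..<n})" by auto
      then have "X \<inter> {..<n} = Y \<inter> {..<n}" by (simp add: set_encode_eq)
      then have "n \<le> m" using m by (metis IntD1 IntI lessThan_iff not_le)
      then show "c \<in> (\<lambda>n. prod_encode (n, set_encode (X \<inter> {..<n}))) ` {..m}" using c(1) by blast
    qed
    then show ?thesis by (rule finite_subset) simp
  qed
  have "inj f"
  proof (rule injI)
    fix X Y assume "f X = f Y"
    then show "X = Y" using fin[of X Y] inf[of X] by auto
  qed
  then show ?thesis using that inf fin by blast
qed

text \<open>By Zorn's lemma; an infinite set meeting every member in a finite set could be added to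
  a maximal family.\<close>

lemma maximal_almost_disjoint:
  assumes "\<And>A. A \<in> \<A>0 \<Longrightarrow> infinite A" "\<And>A B. A \<in> \<A>0 \<Longrightarrow> B \<in> \<A>0 \<Longrightarrow> A \<noteq> B \<Longrightarrow> finite (A \<inter> B)"
  obtains \<A> :: "'a set set" where "\<A>0 \<subseteq> \<A>" "\<And>A. A \<in> \<A> \<Longrightarrow> infinite A"
    "\<And>A B. A \<in> \<A> \<Longrightarrow> B \<in> \<A> \<Longrightarrow> A \<noteq> B \<Longrightarrow> finite (A \<inter> B)"
    "\<And>N. infinite N \<Longrightarrow> \<exists>A\<in>\<A>. infinite (N \<inter> A)"
proof -
  define \<P> where "\<P> = {\<A>. \<A>0 \<subseteq> \<A> \<and> (\<forall>A\<in>\<A>. infinite A) \<and>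
    (\<forall>A\<in>\<A>. \<forall>B\<in>\<A>. A \<noteq> B \<longrightarrow> finite (A \<inter> B))}"
  have "\<exists>M\<in>\<P>. \<forall>X\<in>\<P>. M \<subseteq> X \<longrightarrow> X = M"
  proof (rule subset_Zorn_nonempty)
    have "\<A>0 \<in> \<P>" using assms by (simp add: \<P>_def)
    then show "\<P> \<noteq> {}" by blast
  next
    fix \<C> assume ne: "\<C> \<noteq> {}" and ch: "subset.chain \<P> \<C>"
    have sub: "\<D> \<in> \<P>" if "\<D> \<in> \<C>" for \<D>
      using ch that by (auto simp: subset.chain_def)
    have cmp: "\<D> \<subseteq> \<E> \<or> \<E> \<subseteq> \<D>" if "\<D> \<in> \<C>" "\<E> \<in> \<C>" for \<D> \<E>
      using ch that by (auto simp: subset.chain_def)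
    have "\<A>0 \<subseteq> \<Union>\<C>" using ne sub by (fastforce simp: \<P>_def)
    moreover have "infinite A" if "A \<in> \<Union>\<C>" for A using that sub by (auto simp: \<P>_def)
    moreover have "finite (A \<inter> B)" if AB: "A \<in> \<Union>\<C>" "B \<in> \<Union>\<C>" "A \<noteq> B" for A B
    proof -
      obtain \<D> \<E> where DE: "\<D> \<in> \<C>" "A \<in> \<D>" "\<E> \<in> \<C>" "B \<in> \<E>" using AB by blast
      then have "\<exists>\<F>\<in>\<C>. A \<in> \<F> \<and> B \<in> \<F>" using cmp[OF DE(1,3)] by blast
      then obtain \<F> where "\<F> \<in> \<C>" "A \<in> \<F>" "B \<in> \<F>" by blast
      with sub[of \<F>] AB(3) show ?thesis by (simp add: \<P>_def)
    qed
    ultimately show "\<Union>\<C> \<in> \<P>" unfolding \<P>_def mem_Collect_eq by (intro conjI ballI impI)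
  qed
  then obtain \<A> where \<A>: "\<A> \<in> \<P>" and max: "\<And>X. X \<in> \<P> \<Longrightarrow> \<A> \<subseteq> X \<Longrightarrow> X = \<A>" by blast
  have mad: "\<exists>A\<in>\<A>. infinite (N \<inter> A)" if N: "infinite N" for N
  proof (rule ccontr)
    assume no: "\<not> ?thesis"
    have "insert N \<A> \<in> \<P>" using \<A> N no unfolding \<P>_def by (auto simp: Int_commute)
    then have "N \<in> \<A>" using max[of "insert N \<A>"] by blast
    then show False using no N by auto
  qed
  have "\<A>0 \<subseteq> \<A>" "\<And>A. A \<in> \<A> \<Longrightarrow> infinite A"
    "\<And>A B. A \<in> \<A> \<Longrightarrow> B \<in> \<A> \<Longrightarrow> A \<noteq> B \<Longrightarrow> finite (A \<inter> B)"
    using \<A> by (simp_all add: \<P>_def)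
  then show ?thesis using mad by (rule that)
qed

text \<open>The nonprincipal ultrafilters that contain no member of the family form a single point of the
  sum, the point at infinity. Of \<open>C A\<close> only the trace on \<open>A\<close> matters.\<close>

locale mad_sum =
  fixes \<A> :: "nat set set" and C :: "nat set \<Rightarrow> nat set set" and \<rho> :: "nat set \<Rightarrow> nat filter \<Rightarrow> ord1"
  assumes inf_family: "infinite \<A>"
    and inf: "\<And>A. A \<in> \<A> \<Longrightarrow> infinite A"
    and almost_disjoint: "\<And>A A'. A \<in> \<A> \<Longrightarrow> A' \<in> \<A> \<Longrightarrow> A \<noteq> A' \<Longrightarrow> finite (A \<inter> A')"
    and mad: "\<And>N. infinite N \<Longrightarrow> \<exists>A\<in>\<A>. infinite (N \<inter> A)"
    and comp: "\<And>A. A \<in> \<A> \<Longrightarrow> ranked_algebra (C A) (\<rho> A)"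
    and comp_mem: "\<And>A. A \<in> \<A> \<Longrightarrow> A \<in> C A"
    and comp_rank: "\<And>A u. A \<in> \<A> \<Longrightarrow> ultrafilter u \<Longrightarrow> \<rho> A u < omega1"
begin

text \<open>The ideal generated by the finite sets and the family. The point at infinity corresponds
  to the dual filter.\<close>

definition thin :: "nat set \<Rightarrow> bool"
  where "thin b \<longleftrightarrow> (\<exists>F \<T>. finite F \<and> finite \<T> \<and> \<T> \<subseteq> \<A> \<and> b \<subseteq> F \<union> \<Union>\<T>)"

text \<open>The first condition makes the sum look like \<open>C A\<close> on each member
  \<open>A\<close>; the second leaves a single point outside all the components.\<close>

definition sum_alg :: "nat set set"
  where "sum_alg = {b. (\<forall>A\<in>\<A>. A \<inter> b \<in> C A) \<and> (thin b \<or> thin (- b))}"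

definition at_infinity :: "nat filter \<Rightarrow> bool"
  where "at_infinity u \<longleftrightarrow> ultrafilter u \<and> (\<forall>n. \<not> has u {n}) \<and> (\<forall>A\<in>\<A>. \<not> has u A)"

text \<open>The order of the tests matters: a number may lie in several members of the family, but a
  nonprincipal ultrafilter contains at most one of them, so the choice of \<open>A\<close> is then
  unambiguous.\<close>

definition sum_rank :: "nat filter \<Rightarrow> ord1"
  where "sum_rank u = (if \<exists>n. has u {n} then LEAST \<gamma>. True
    else if \<exists>A\<in>\<A>. has u A then \<rho> (SOME A. A \<in> \<A> \<and> has u A) u else omega1)"

section \<open>The algebra of the sum and its point at infinity\<close>

lemma thin_subset: "thin b \<Longrightarrow> a \<subseteq> b \<Longrightarrow> thin a"
  unfolding thin_def by (meson order_trans)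

lemma thin_Un:
  assumes "thin a" "thin b"
  shows "thin (a \<union> b)"
proof -
  obtain F \<T> F' \<T>' where "finite F" "finite \<T>" "\<T> \<subseteq> \<A>" "a \<subseteq> F \<union> \<Union>\<T>"
    "finite F'" "finite \<T>'" "\<T>' \<subseteq> \<A>" "b \<subseteq> F' \<union> \<Union>\<T>'" using assms unfolding thin_def by blast
  then show ?thesis unfolding thin_def by (intro exI[of _ "F \<union> F'"] exI[of _ "\<T> \<union> \<T>'"]) auto
qed

lemma thin_finite: "finite N \<Longrightarrow> thin N"
  unfolding thin_def by (intro exI[of _ N] exI[of _ "{}"]) auto

lemma thin_member: "A \<in> \<A> \<Longrightarrow> thin A"
  unfolding thin_def by (intro exI[of _ "{}"] exI[of _ "{A}"]) auto

lemma sum_algebra: "algebra UNIV sum_alg"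
  unfolding algebra_iff_Int
proof (intro conjI ballI)
  have Cc: "A - b \<in> C A" if "A \<in> \<A>" "A \<inter> b \<in> C A" for A b
  proof -
    have "A \<inter> - (A \<inter> b) \<in> C A"
      using that ranked_algebra.Int_mem[OF comp] ranked_algebra.Compl_mem[OF comp] comp_mem by blast
    then show ?thesis by (simp add: Diff_eq Int_Un_distrib)
  qed
  show "{} \<in> sum_alg"
    using thin_finite[of "{}"] ranked_algebra.finite_mem[OF comp] by (simp add: sum_alg_def)
  show "UNIV - a \<in> sum_alg" if "a \<in> sum_alg" for a
    using that Cc by (auto simp: sum_alg_def Compl_eq_Diff_UNIV[symmetric] Diff_eq)
  show "a \<inter> b \<in> sum_alg" if ab: "a \<in> sum_alg" "b \<in> sum_alg" for a b
  proof -
    have "A \<inter> (a \<inter> b) \<in> C A" if A: "A \<in> \<A>" for A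
    proof -
      have "A \<inter> a \<in> C A" "A \<inter> b \<in> C A" using ab A by (simp_all add: sum_alg_def)
      then have "(A \<inter> a) \<inter> (A \<inter> b) \<in> C A" by (rule ranked_algebra.Int_mem[OF comp[OF A]])
      then show ?thesis by (simp add: Int_ac)
    qed
    moreover have "thin (a \<inter> b) \<or> thin (- (a \<inter> b))"
    proof (cases "thin a \<or> thin b")
      case True
      then show ?thesis using thin_subset[of a "a \<inter> b"] thin_subset[of b "a \<inter> b"] by blast
    next
      case False
      then have "thin (- a \<union> - b)" using ab thin_Un by (simp add: sum_alg_def)
      then show ?thesis by simp
    qed
    ultimately show ?thesis by (simp add: sum_alg_def)
  qed
qed simp

lemma sum_alg_component:
  assumes A: "A \<in> \<A>" and c: "c \<in> C A"
  shows "A \<inter> c \<in> sum_alg"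
proof -
  have "A' \<inter> (A \<inter> c) \<in> C A'" if A': "A' \<in> \<A>" for A'
  proof (cases "A' = A")
    case True
    then show ?thesis using ranked_algebra.Int_mem[OF comp[OF A] comp_mem[OF A] c] by simp
  next
    case False
    then have "finite (A' \<inter> (A \<inter> c))"
      using almost_disjoint[OF A' A] by (metis finite_Int Int_assoc)
    then show ?thesis by (rule ranked_algebra.finite_mem[OF comp[OF A']])
  qed
  moreover have "thin (A \<inter> c)" using thin_subset[OF thin_member[OF A]] by simp
  ultimately show ?thesis by (simp add: sum_alg_def)
qed

lemma finite_sum_alg: "finite N \<Longrightarrow> N \<in> sum_alg"
  using thin_finite ranked_algebra.finite_mem[OF comp] by (simp add: sum_alg_def)

lemma member_sum_alg: "A \<in> \<A> \<Longrightarrow> A \<in> sum_alg"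
  using sum_alg_component[OF _ comp_mem] by simp

lemma at_infinity_thin: "at_infinity u \<Longrightarrow> thin b \<Longrightarrow> \<not> has u b"
proof
  assume u: "at_infinity u" "thin b" "has u b"
  then have uu: "ultrafilter u" by (simp add: at_infinity_def)
  obtain F \<T> where F: "finite F" "finite \<T>" "\<T> \<subseteq> \<A>" "b \<subseteq> F \<union> \<Union>\<T>"
    using u(2) by (auto simp: thin_def)
  have "has u (F \<union> \<Union>\<T>)" by (rule has_mono[OF u(3) F(4)])
  then have "has u F \<or> has u (\<Union>\<T>)" using uu by simp
  then show False
  proof
    assume "has u F"
    then obtain j where "has u {j}" by (rule has_finite[OF uu F(1)])
    then show False using u(1) by (simp add: at_infinity_def)
  next
    assume "has u (\<Union>\<T>)"
    then obtain A where "A \<in> \<T>" "has u A" using has_Union_finite[OF uu F(2)] by blast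
    then show False using u(1) F(3) by (auto simp: at_infinity_def)
  qed
qed

text \<open>The ideal of thin sets is proper: an infinite family has a member outside any finite
  subfamily, and that member meets the union of the subfamily in a finite set only.\<close>

lemma at_infinity_exists: "\<exists>u. at_infinity u"
proof -
  have "\<exists>u. ultrafilter u \<and> (\<forall>b\<in>{- a |a. thin a}. has u b)"
  proof (rule ultrafilter_FIP)
    fix \<S> assume "finite \<S>" "\<S> \<subseteq> {- a |a. thin a}"
    then have "\<exists>a. thin a \<and> - a \<subseteq> \<Inter>\<S>"
    proof (induction \<S>)
      case empty then show ?case using thin_finite[of "{}"] by blast
    next
      case (insert b \<S>)
      then obtain a a' where "thin a" "- a \<subseteq> \<Inter>\<S>" "thin a'" "b = - a'" by auto
      then show ?case using thin_Un by (intro exI[of _ "a \<union> a'"]) auto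
    qed
    then obtain a where a: "thin a" "- a \<subseteq> \<Inter>\<S>" by blast
    then obtain F \<T> where F: "finite F" "finite \<T>" "\<T> \<subseteq> \<A>" "a \<subseteq> F \<union> \<Union>\<T>"
      by (auto simp: thin_def)
    obtain A where A: "A \<in> \<A>" "A \<notin> \<T>" using F(2) inf_family by (metis finite_subset subsetI)
    have "finite (\<Union>A'\<in>\<T>. A \<inter> A')" using F almost_disjoint[OF A(1)] A(2) by (intro finite_UN_I) blast+
    then have "finite (A \<inter> (F \<union> \<Union>\<T>))" using F(1) by (simp add: Int_Un_distrib Int_UN_distrib)
    then have "finite (A \<inter> a)" by (rule finite_subset[rotated]) (use F(4) in blast)
    then have "\<not> A \<subseteq> a" using inf[OF A(1)] by (auto simp: Int_absorb2)
    then show "\<Inter>\<S> \<noteq> {}" using a(2) by blast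
  qed
  then obtain u where u: "ultrafilter u" "\<And>a. thin a \<Longrightarrow> has u (- a)" by blast
  then have "at_infinity u"
    unfolding at_infinity_def using thin_finite[of "{_}"] thin_member by auto
  then show ?thesis ..
qed

section \<open>Ranks and convergent subsequences in the sum\<close>

lemma sum_cases:
  assumes "ultrafilter u"
  obtains A where "A \<in> \<A>" "has u A" | n where "has u {n}" | "at_infinity u"
  using assms unfolding at_infinity_def by blast

lemma sum_alg_eq_iff:
  assumes A: "A \<in> \<A>" and u: "ultrafilter u" "has u A" and v: "ultrafilter v" "has v A"
  shows "alg_eq sum_alg u v \<longleftrightarrow> alg_eq (C A) u v"
proof
  assume *: "alg_eq sum_alg u v"
  show "alg_eq (C A) u v"
    unfolding alg_eq_def
  proof
    fix c assume "c \<in> C A"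
    then have "has u (A \<inter> c) \<longleftrightarrow> has v (A \<inter> c)"
      using * sum_alg_component[OF A] unfolding alg_eq_def by blast
    then show "has u c \<longleftrightarrow> has v c" using u v by simp
  qed
next
  assume *: "alg_eq (C A) u v"
  show "alg_eq sum_alg u v"
    unfolding alg_eq_def
  proof
    fix b assume "b \<in> sum_alg"
    then have "A \<inter> b \<in> C A" using A by (simp add: sum_alg_def)
    then have "has u (A \<inter> b) \<longleftrightarrow> has v (A \<inter> b)" using * unfolding alg_eq_def by blast
    then show "has u b \<longleftrightarrow> has v b" using u v by simp
  qed
qed

lemma sum_rank_principal:
  fixes u :: "nat filter"
  assumes "has u {n}"
  shows "sum_rank u \<le> \<gamma>"
proof -
  have "sum_rank u = (LEAST \<gamma>. True)" using assms by (auto simp: sum_rank_def)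
  then show ?thesis by (simp add: Least_le)
qed

lemma sum_rank_component:
  assumes A: "A \<in> \<A>" and u: "ultrafilter u" "has u A"
  shows "sum_rank u = \<rho> A u"
proof (cases "\<exists>n. has u {n}")
  case True
  then show ?thesis
    using sum_rank_principal ranked_algebra.principal_le[OF comp[OF A] u(1)] by (meson order_antisym)
next
  case False
  have uniq: "A' = A" if "A' \<in> \<A>" "has u A'" for A'
  proof (rule ccontr)
    assume "A' \<noteq> A"
    then have "finite (A' \<inter> A)" using almost_disjoint A that by blast
    then show False using ultrafilter_finite_cases[OF u(1) False, of "A' \<inter> A"] that u by simp
  qed
  have "(SOME A'. A' \<in> \<A> \<and> has u A') = A"
    by (rule some_equality) (use A u(2) uniq in blast)+
  then show ?thesis using False A u by (auto simp: sum_rank_def)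
qed

lemma sum_rank_at_infinity: "at_infinity u \<Longrightarrow> sum_rank u = omega1"
  by (auto simp: sum_rank_def at_infinity_def)

lemma sum_rank_less_omega1:
  assumes "ultrafilter u" "\<not> at_infinity u"
  shows "sum_rank u < omega1"
  using assms(1)
proof (cases rule: sum_cases)
  case (1 A)
  then show ?thesis using sum_rank_component comp_rank assms(1) by metis
next
  case (2 n)
  obtain z :: ord1 where "z < omega1" using ord1_zero by blast
  then show ?thesis using sum_rank_principal[OF 2, of z] by simp
next
  case 3
  then show ?thesis using assms by simp
qed

lemma at_infinity_eq:
  assumes "at_infinity u" "at_infinity v"
  shows "alg_eq sum_alg u v"
  unfolding alg_eq_def
proof
  fix b assume b: "b \<in> sum_alg"
  have uv: "ultrafilter u" "ultrafilter v" using assms by (auto simp: at_infinity_def)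
  consider "thin b" | "thin (- b)" using b by (auto simp: sum_alg_def)
  then show "has u b \<longleftrightarrow> has v b"
    using at_infinity_thin[OF assms(1)] at_infinity_thin[OF assms(2)] uv by cases (blast, fastforce)
qed

lemma lim_component:
  assumes A: "A \<in> \<A>" and lim: "alg_lim (C A) s v" and v: "has v A"
  shows "alg_lim sum_alg s v"
  unfolding alg_lim_def
proof (intro ballI impI)
  fix b assume "b \<in> sum_alg" "has v b"
  then have "A \<inter> b \<in> C A" "has v (A \<inter> b)" using A v by (simp_all add: sum_alg_def)
  then have "\<forall>\<^sub>F n in sequentially. has (s n) (A \<inter> b)" using lim unfolding alg_lim_def by blast
  then show "\<forall>\<^sub>F n in sequentially. has (s n) b" by eventually_elim simp
qed

text \<open>A basic neighbourhood of infinity omits only a thin set, which is covered by finitely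
  many numbers and members of the family; each of these catches finitely many terms.\<close>

lemma lim_at_infinity:
  assumes s: "\<And>n::nat. ultrafilter (s n)" and A: "\<And>A. A \<in> \<A> \<Longrightarrow> finite {n. has (s n) A}"
    and fin: "\<And>j. finite {n. has (s n) {j}}" and u: "at_infinity u"
  shows "alg_lim sum_alg s u"
  unfolding alg_lim_def
proof (intro ballI impI)
  fix b assume b: "b \<in> sum_alg" "has u b"
  then have "thin (- b)" using at_infinity_thin[OF u] by (auto simp: sum_alg_def)
  then obtain F \<T> where F: "finite F" "finite \<T>" "\<T> \<subseteq> \<A>" "- b \<subseteq> F \<union> \<Union>\<T>"
    by (auto simp: thin_def)
  have "{n. \<not> has (s n) b} \<subseteq> (\<Union>j\<in>F. {n. has (s n) {j}}) \<union> (\<Union>A\<in>\<T>. {n. has (s n) A})"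
  proof
    fix n assume "n \<in> {n. \<not> has (s n) b}"
    then have "has (s n) (- b)" using s by simp
    then have "has (s n) (F \<union> \<Union>\<T>)" using F(4) by (rule has_mono)
    then have "has (s n) F \<or> has (s n) (\<Union>\<T>)" using s by simp
    then show "n \<in> (\<Union>j\<in>F. {n. has (s n) {j}}) \<union> (\<Union>A\<in>\<T>. {n. has (s n) A})"
    proof
      assume "has (s n) F"
      then obtain j where "j \<in> F" "has (s n) {j}" by (rule has_finite[OF s F(1)])
      then show ?thesis by blast
    next
      assume "has (s n) (\<Union>\<T>)"
      then obtain A where "A \<in> \<T>" "has (s n) A" using has_Union_finite[OF s F(2)] by blast
      then show ?thesis by blast
    qed
  qed
  moreover have "finite \<dots>" using F A fin by auto
  ultimately have "finite {n. \<not> has (s n) b}" by (rule finite_subset)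
  then show "\<forall>\<^sub>F n in sequentially. has (s n) b"
    by (simp add: eventually_cofinite flip: cofinite_eq_sequentially)
qed

lemma sum_subseq_lim:
  assumes s: "\<And>n::nat. ultrafilter (s n)"
  shows "\<exists>k v. strict_mono k \<and> ultrafilter v \<and> alg_lim sum_alg (s \<circ> k) v"
proof -
  consider A where "A \<in> \<A>" "infinite {n. has (s n) A}" | j where "infinite {n. has (s n) {j}}"
    | "\<forall>A\<in>\<A>. finite {n. has (s n) A}" "\<forall>j. finite {n. has (s n) {j}}" by blast
  then show ?thesis
  proof cases
    case (1 A)
    obtain k :: "nat \<Rightarrow> nat" where k: "strict_mono k" "\<And>n. has (s (k n)) A"
      using infinite_enumerate[OF 1(2)] by blast
    obtain k' v where k': "strict_mono k'" and v: "ultrafilter v" "alg_lim (C A) ((s \<circ> k) \<circ> k') v"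
      using ranked_algebra.subseq_lim[OF comp[OF 1(1)], of "s \<circ> k"] s by auto
    have "has v A"
      by (rule ranked_algebra.lim_has[OF comp[OF 1(1)] v(2) _ v(1) comp_mem[OF 1(1)]]) (use s k in auto)
    then have "alg_lim sum_alg (s \<circ> (k \<circ> k')) v" using lim_component[OF 1(1) v(2)] by (simp add: o_assoc)
    then show ?thesis using v(1) strict_mono_o[OF k(1) k'] by blast
  next
    case (2 j)
    obtain k :: "nat \<Rightarrow> nat" where k: "strict_mono k" "\<And>n. has (s (k n)) {j}"
      using infinite_enumerate[OF 2] by blast
    have "alg_lim sum_alg (s \<circ> k) (s (k 0))"
      unfolding alg_lim_def using has_singleton[OF s k(2)] by simp
    then show ?thesis using k(1) s by blast
  next
    case 3
    obtain u where "at_infinity u" using at_infinity_exists by blast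
    moreover have "strict_mono (\<lambda>n::nat. n)" by (simp add: strict_mono_def)
    ultimately show ?thesis using lim_at_infinity[where s = s and u = u, OF s] 3
      by (intro exI[of _ "\<lambda>n. n"] exI[of _ u]) (auto simp: at_infinity_def o_def)
  qed
qed

sublocale ranked_algebra sum_alg sum_rank
proof (rule ranked_algebra.intro)
  show "algebra UNIV sum_alg" by (rule sum_algebra)
  show "{n} \<in> sum_alg" for n by (rule finite_sum_alg) simp
  show "\<exists>k v. strict_mono k \<and> ultrafilter v \<and> alg_lim sum_alg (s \<circ> k) v"
    if "\<And>n::nat. ultrafilter (s n)" for s by (rule sum_subseq_lim[OF that])
  show "sum_rank u \<le> \<gamma>" if "has u {n}" for u n \<gamma> by (rule sum_rank_principal[OF that])
  fix u :: "nat filter" assume u: "ultrafilter u"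
  show "(\<forall>\<beta>. \<not> \<beta> < sum_rank u) \<or> (\<exists>\<beta>. ord1_succ_of (sum_rank u) \<beta>)" if lt: "sum_rank u < omega1"
    using u
  proof (cases rule: sum_cases)
    case (1 A)
    then show ?thesis
      using ranked_algebra.nonlimit_rank[OF comp[OF 1(1)] u] sum_rank_component[OF 1(1) u 1(2)] lt by simp
  next
    case (2 n)
    then show ?thesis using sum_rank_principal[OF 2] by (simp add: not_less)
  next
    case 3
    then show ?thesis using sum_rank_at_infinity lt by simp
  qed
  show "sum_rank u = sum_rank v" if v: "ultrafilter v" and uv: "alg_eq sum_alg u v" for v
    using u
  proof (cases rule: sum_cases)
    case (1 A)
    then have vA: "has v A" using uv member_sum_alg by (simp add: alg_eq_def)
    then have "\<rho> A u = \<rho> A v"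
      using ranked_algebra.cong[OF comp[OF 1(1)] u v] sum_alg_eq_iff[OF 1(1) u 1(2) v] uv by blast
    then show ?thesis using sum_rank_component[OF 1(1)] u v vA 1(2) by simp
  next
    case (2 n)
    then have "has v {n}" using uv finite_sum_alg[of "{n}"] by (simp add: alg_eq_def)
    then show ?thesis using sum_rank_principal 2 by (meson order_antisym)
  next
    case 3
    then have "at_infinity v"
      using uv v member_sum_alg finite_sum_alg unfolding at_infinity_def alg_eq_def by blast
    then show ?thesis using 3 sum_rank_at_infinity by simp
  qed
  show "\<exists>b. isolates sum_alg sum_rank b u"
    using u
  proof (cases rule: sum_cases)
    case (1 A)
    obtain b where "isolates (C A) (\<rho> A) b u"
      using ranked_algebra.isolates[OF comp[OF 1(1)] u] by blast
    then have b: "b \<in> C A" "has u b"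
      "\<And>v. ultrafilter v \<Longrightarrow> has v b \<Longrightarrow> alg_eq (C A) u v \<or> \<rho> A v < \<rho> A u"
      by (auto simp: isolates_def)
    have "alg_eq sum_alg u v \<or> sum_rank v < sum_rank u" if v: "ultrafilter v" "has v (A \<inter> b)" for v
      using b(3)[of v] sum_alg_eq_iff[OF 1(1) u 1(2) v(1)] sum_rank_component[OF 1(1)] u v 1(2) by simp
    then have "isolates sum_alg sum_rank (A \<inter> b) u"
      using sum_alg_component[OF 1(1) b(1)] 1(2) b(2) by (simp add: isolates_def)
    then show ?thesis by blast
  next
    case (2 n)
    have "alg_eq sum_alg u v" if "ultrafilter v" "has v {n}" for v
      using has_singleton[OF u 2] has_singleton[OF that] by (simp add: alg_eq_def)
    then have "isolates sum_alg sum_rank {n} u" using 2 finite_sum_alg[of "{n}"] by (simp add: isolates_def)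
    then show ?thesis by blast
  next
    case 3
    \<comment> \<open>The whole space isolates the point at infinity, since all other ranks are
      below \<open>omega1\<close>.\<close>
    have "alg_eq sum_alg u v \<or> sum_rank v < sum_rank u" if "ultrafilter v" for v
      using at_infinity_eq[OF 3] sum_rank_less_omega1[OF that] sum_rank_at_infinity[OF 3] by auto
    then have "isolates sum_alg sum_rank UNIV u"
      using algebra.top[OF sum_algebra] by (simp add: isolates_def)
    then show ?thesis by blast
  qed
qed

text \<open>One closure produces nonprincipal points in infinitely many components; choosing them in
  distinct components gives a sequence that converges to infinity in the second closure.\<close>

lemma at_infinity_closure:
  assumes M: "M \<subseteq> topspace (alg_space sum_alg)" and u: "at_infinity u"
    and cl: "alg_class sum_alg u \<in> alg_space sum_alg closure_of M"
  shows "alg_class sum_alg u \<in> seqcl (alg_space sum_alg) (seqcl (alg_space sum_alg) M)"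
proof -
  let ?X = "alg_space sum_alg" and ?c = "alg_class sum_alg"
  have uu: "ultrafilter u" using u by (simp add: at_infinity_def)
  define M' where "M' = seqcl ?X M"
  have MM': "M \<subseteq> M'" unfolding M'_def by (rule seqcl_superset[OF M])
  have M'X: "M' \<subseteq> topspace ?X" by (auto simp: M'_def seqcl_def)
  show ?thesis
  proof (cases "?c u \<in> M")
    case True
    then show ?thesis using MM' seqcl_superset[OF M'X] by (auto simp: M'_def)
  next
    case False
    define \<T> where "\<T> = {A \<in> \<A>. \<exists>v. ultrafilter v \<and> (\<forall>n. \<not> has v {n}) \<and> has v A \<and> ?c v \<in> M'}"
    have "infinite \<T>"
    proof
      assume fin: "finite \<T>"
      have sub: "\<T> \<subseteq> \<A>" by (auto simp: \<T>_def)
      \<comment> \<open>Were \<T> finite, \<open>M\<close> would contain infinitely many numbers off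
        its members: a neighbourhood of infinity avoiding both \<T> and a finite \<open>N\<close>
        would still meet \<open>M\<close>, and only in a point that puts another member into
        \<T>.\<close>
      define N where "N = {n. ?c (principal {n}) \<in> M \<and> n \<notin> \<Union>\<T>}"
      have tU: "thin (\<Union>\<T>)" unfolding thin_def using fin sub by blast
      have "infinite N"
      proof
        assume "finite N"
        then have t: "thin (\<Union>\<T> \<union> N)" using thin_Un[OF tU thin_finite] by blast
        have "\<Union>\<T> \<in> sum_alg"
          using fin sub member_sum_alg algebra_iff_Un[of UNIV sum_alg] sum_algebra
          by (induction rule: finite_induct) (auto simp: finite_sum_alg)
        then have "- (\<Union>\<T> \<union> N) \<in> sum_alg"
          using Int_mem[OF Compl_mem Compl_mem[OF finite_sum_alg[OF \<open>finite N\<close>]]] by simp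
        moreover have "has u (- (\<Union>\<T> \<union> N))"
          using at_infinity_thin[OF u t] has_Compl[OF uu] by blast
        ultimately have "M \<inter> alg_cell sum_alg (- (\<Union>\<T> \<union> N)) \<noteq> {}"
          using cl alg_space_closure_iff[OF sum_algebra uu] by blast
        then obtain x where "x \<in> M" "x \<in> alg_cell sum_alg (- (\<Union>\<T> \<union> N))" by blast
        then obtain v where v: "ultrafilter v" "has v (- (\<Union>\<T> \<union> N))" "?c v \<in> M"
          unfolding alg_cell_def by blast
        have np: "\<not> has v {n}" for n
        proof
          assume n: "has v {n}"
          have "alg_eq sum_alg v (principal {n})" using has_singleton[OF v(1) n] by (simp add: alg_eq_def)
          then have "?c v = ?c (principal {n})" using v(1) by (simp add: alg_class_eq_iff ultrafilter_principal)
          moreover have "n \<in> - (\<Union>\<T> \<union> N)" by (rule iffD1[OF has_singleton[OF v(1) n] v(2)])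
          ultimately show False using v(3) by (auto simp: N_def)
        qed
        show False using v(1)
        proof (cases rule: sum_cases)
          case (1 A)
          have "?c v \<in> M'" using v(3) MM' by blast
          then have "A \<in> \<T>" unfolding \<T>_def using 1 v(1) np by blast
          then have "A \<subseteq> \<Union>\<T> \<union> N" by blast
          then have "has v (\<Union>\<T> \<union> N)" by (rule has_mono[OF 1(2)])
          then show False using v(1,2) by simp
        next
          case (2 n)
          then show False using np by blast
        next
          case 3
          then have "?c u = ?c v" using at_infinity_eq[OF u] uu v(1) by (simp add: alg_class_eq_iff)
          then show False using v(3) False by simp
        qed
      qed
      \<comment> \<open>By maximality some member catches infinitely many of these numbers. Their
        limit is a nonprincipal point on it, which puts the member into \<T> although
        \<open>N\<close> avoids \<T>.\<close>
      then obtain A where A: "A \<in> \<A>" "infinite (N \<inter> A)" using mad by blast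
      obtain e :: "nat \<Rightarrow> nat" where e: "strict_mono e" "\<And>n. e n \<in> N \<inter> A"
        using infinite_enumerate[OF A(2)] by blast
      obtain k v where k: "strict_mono k" and v: "ultrafilter v"
        "alg_lim sum_alg ((\<lambda>n. principal {e n}) \<circ> k) v"
        using subseq_lim[of "\<lambda>n. principal {e n}"] by (auto simp: ultrafilter_principal)
      have vA: "has v A"
        by (rule lim_has[OF v(2) _ v(1) member_sum_alg[OF A(1)]]) (use e in \<open>auto simp: ultrafilter_principal\<close>)
      have np: "\<not> has v {j}" for j
      proof
        assume j: "has v {j}"
        have "{j} \<in> sum_alg" by (rule finite_sum_alg) simp
        then have "\<forall>\<^sub>F n in sequentially. has (((\<lambda>n. principal {e n}) \<circ> k) n) {j}"
          using v(2) j unfolding alg_lim_def by blast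
        then obtain n where "\<And>m. m \<ge> n \<Longrightarrow> e (k m) = j" by (auto simp: eventually_sequentially)
        then have "e (k n) = j" "e (k (Suc n)) = j" by simp_all
        moreover have "e (k n) < e (k (Suc n))" using e(1) k by (simp add: strict_mono_def)
        ultimately show False by simp
      qed
      have "limitin ?X (\<lambda>n. ?c (principal {e (k n)})) (?c v) sequentially"
        using limitin_alg_space[OF sum_algebra _ v(1), of "(\<lambda>n. principal {e n}) \<circ> k"] v(2)
        by (simp add: ultrafilter_principal)
      then have "?c v \<in> M'" unfolding M'_def using e(2) by (rule_tac seqclI) (auto simp: N_def)
      then have "A \<in> \<T>" using A(1) v(1) np vA by (auto simp: \<T>_def)
      then show False using e(2)[of 0] by (auto simp: N_def)
    qed
    then obtain g :: "nat \<Rightarrow> nat set" where g: "inj g" "range g \<subseteq> \<T>"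
      using infinite_countable_subset by blast
    have "\<forall>n. \<exists>v. ultrafilter v \<and> (\<forall>j. \<not> has v {j}) \<and> has v (g n) \<and> ?c v \<in> M'"
      using g(2) by (auto simp: \<T>_def)
    then obtain s where s: "\<And>n::nat. ultrafilter (s n)" "\<And>n j. \<not> has (s n) {j}" "\<And>n. has (s n) (g n)"
      "\<And>n. ?c (s n) \<in> M'" by metis
    have "finite {n. has (s n) A}" if A: "A \<in> \<A>" for A
    proof -
      have "A = g n" if n: "has (s n) A" for n
      proof (rule ccontr)
        assume "A \<noteq> g n"
        moreover have "g n \<in> \<A>" using g(2) by (auto simp: \<T>_def)
        ultimately have "finite (A \<inter> g n)" using almost_disjoint A by blast
        then show False using ultrafilter_finite_cases[OF s(1), of n "A \<inter> g n"] s(2,3) n by simp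
      qed
      then have "{n. has (s n) A} \<subseteq> g -` {A}" by auto
      then show ?thesis using finite_vimageI[OF _ g(1), of "{A}"] finite_subset by blast
    qed
    then have "alg_lim sum_alg s u" using s(2) by (intro lim_at_infinity[OF s(1) _ _ u]) auto
    then have "limitin ?X (\<lambda>n. ?c (s n)) (?c u) sequentially"
      using limitin_alg_space[OF sum_algebra s(1) uu] by simp
    then show ?thesis using s(4) unfolding M'_def by (rule seqclI)
  qed
qed

end

section \<open>The theorem\<close>

lemma alg_space_order:
  assumes "algebra UNIV B"
    and "\<And>M. M \<subseteq> topspace (alg_space B) \<Longrightarrow> alg_space B closure_of M \<subseteq> seqcl_iter (alg_space B) \<alpha> M"
    and "\<And>\<gamma>. \<gamma> < \<alpha> \<Longrightarrow> \<exists>M\<subseteq>topspace (alg_space B). seqcl_iter (alg_space B) \<gamma> M \<noteq> alg_space B closure_of M"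
  shows "\<exists>E. equiv (topspace beta_omega) E \<and>
             compact_space (quotient_space beta_omega E) \<and>
             Hausdorff_space (quotient_space beta_omega E) \<and>
             sequential_space (quotient_space beta_omega E) \<and>
             sequential_order (quotient_space beta_omega E) = \<alpha>"
  using equiv_alg_rel compact_space_alg_space Hausdorff_space_alg_space[OF assms(1)]
    sequential_space_order_eqI[OF assms(2,3)] by blast

theorem theorem6p9:
  fixes \<alpha> :: ord1
  assumes "continuum_hypothesis"
  shows "\<exists>E. equiv (topspace beta_omega) E \<and>
             compact_space (quotient_space beta_omega E) \<and>
             Hausdorff_space (quotient_space beta_omega E) \<and>
             sequential_space (quotient_space beta_omega E) \<and>
             sequential_order (quotient_space beta_omega E) = \<alpha>"
proof (cases \<alpha> rule: ord1_cases)
  case zero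
  \<comment> \<open>The trivial algebra identifies all ultrafilters; in a one-point space every set
    is closed.\<close>
  let ?B = "{{}, UNIV} :: nat set set"
  have alg: "algebra UNIV ?B" by (auto simp: algebra_iff_Int)
  show ?thesis
  proof (rule alg_space_order[OF alg])
    fix M assume M: "M \<subseteq> topspace (alg_space ?B)"
    have "alg_class ?B u = alg_class ?B v" if "ultrafilter u" "ultrafilter v" for u v
      using that by (simp add: alg_class_eq_iff alg_eq_def)
    then have "x = y" if "x \<in> topspace (alg_space ?B)" "y \<in> topspace (alg_space ?B)" for x y
      using that by (metis alg_space_cases)
    then have "M = {} \<or> M = topspace (alg_space ?B)" using M by blast
    then have "alg_space ?B closure_of M = M" by auto
    then show "alg_space ?B closure_of M \<subseteq> seqcl_iter (alg_space ?B) \<alpha> M"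
      using zero by (simp add: seqcl_iter_zero)
  qed (use zero in blast)
next
  case (succ \<beta>)
  obtain B r where B: "ranked_algebra B r" "UNIV \<in> B" "\<forall>u. ultrafilter u \<longrightarrow> r u \<le> \<alpha>"
    "\<exists>u. ultrafilter u \<and> has u UNIV \<and> r u = \<alpha>" "bounded_limits B r UNIV"
    using successor_algebra[OF assms infinite_UNIV_nat succ] by blast
  interpret ranked_algebra B r by (rule B)
  have \<alpha>: "\<alpha> < omega1" using succ not_ord1_succ_of_omega1 ord1_less_omega1_iff by blast
  show ?thesis
  proof (rule alg_space_order[OF alg])
    fix M assume M: "M \<subseteq> topspace (alg_space B)"
    show "alg_space B closure_of M \<subseteq> seqcl_iter (alg_space B) \<alpha> M"
    proof
      fix x assume x: "x \<in> alg_space B closure_of M"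
      then obtain u where "ultrafilter u" "x = alg_class B u"
        using alg_space_cases by (metis in_closure_of)
      then have le: "alg_rank r x \<le> \<alpha>" using B(3) by (simp add: alg_rank_class)
      then have "x \<in> seqcl_iter (alg_space B) (alg_rank r x) M"
        using closure_imp_seqcl_iter[OF M x] \<alpha> by simp
      then show "x \<in> seqcl_iter (alg_space B) \<alpha> M" using seqcl_iter_mono_ord[OF M le] by blast
    qed
  next
    fix \<gamma> assume "\<gamma> < \<alpha>"
    moreover obtain u where "ultrafilter u" "has u UNIV" "r u = \<alpha>" using B(4) by blast
    ultimately show "\<exists>M\<subseteq>topspace (alg_space B). seqcl_iter (alg_space B) \<gamma> M \<noteq> alg_space B closure_of M"
      using seqcl_iter_principal_neq_closure[OF B(2) _ _ _ B(5)] by blast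
  qed
next
  case (limit \<beta>)
  \<comment> \<open>Here \<alpha> may also be \<open>omega1\<close>, which is not a
    successor.\<close>
  have below: "\<exists>\<delta><\<alpha>. ord1_succ_of \<delta> \<gamma>" if "\<gamma> < \<alpha>" for \<gamma>
  proof -
    have "\<gamma> < omega1" using that ord1_le_omega1[of \<alpha>] by simp
    then obtain \<delta> where \<delta>: "ord1_succ_of \<delta> \<gamma>" using ord1_succ_of_exists by blast
    then have "\<delta> \<le> \<alpha>" using that by (metis leD le_less_linear ord1_less_succ_iff)
    then show ?thesis using \<delta> limit(2) by (metis le_less)
  qed
  obtain g where g: "bij_betw g {\<gamma>. \<gamma> < omega1} (UNIV :: nat set set)"
    using CH_bij_betw_nat_sets[OF assms] by blast
  obtain f :: "nat set \<Rightarrow> nat set" where f: "\<And>X. infinite (f X)"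
    "\<And>X Y. X \<noteq> Y \<Longrightarrow> finite (f X \<inter> f Y)" "inj f" by (rule almost_disjoint_branches) (rule that)
  obtain \<A> where \<A>: "range f \<subseteq> \<A>" "\<And>A. A \<in> \<A> \<Longrightarrow> infinite A"
    "\<And>A B. A \<in> \<A> \<Longrightarrow> B \<in> \<A> \<Longrightarrow> A \<noteq> B \<Longrightarrow> finite (A \<inter> B)"
    "\<And>N. infinite N \<Longrightarrow> \<exists>A\<in>\<A>. infinite (N \<inter> A)"
  proof (rule maximal_almost_disjoint[of "range f"])
    show "infinite A" if "A \<in> range f" for A using that f(1) by auto
    show "finite (A \<inter> B)" if "A \<in> range f" "B \<in> range f" "A \<noteq> B" for A B
      using that f(2) by (metis imageE)
  qed (use that in auto)
  have inj: "inj_on (f \<circ> g) {\<gamma>. \<gamma> < omega1}"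
    using g f(3) by (intro comp_inj_on) (auto simp: bij_betw_def inj_on_def)
  \<comment> \<open>The member \<open>f (g \<gamma>)\<close> is reserved for \<gamma>; all other
    members of the maximal family receive an arbitrary index below \<alpha>. The component on
    \<open>A\<close> is then built with order \<open>j A\<close>, the successor of the
    index.\<close>
  have "\<exists>i. i < \<alpha> \<and> (\<forall>\<gamma><\<alpha>. A = f (g \<gamma>) \<longrightarrow> i = \<gamma>)" for A
  proof (cases "\<exists>\<gamma><\<alpha>. A = f (g \<gamma>)")
    case True
    then obtain \<gamma> where \<gamma>: "\<gamma> < \<alpha>" "A = f (g \<gamma>)" by blast
    have lt: "\<gamma>' < omega1" if "\<gamma>' < \<alpha>" for \<gamma>' using that ord1_le_omega1[of \<alpha>] by simp
    then have "\<gamma> = \<gamma>'" if "\<gamma>' < \<alpha>" "A = f (g \<gamma>')" for \<gamma>'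
      using inj_onD[OF inj, of \<gamma> \<gamma>'] that \<gamma> by simp
    then show ?thesis using \<gamma> by blast
  qed (use limit(1) in blast)
  then obtain i where i: "\<And>A. i A < \<alpha>" "\<And>A \<gamma>. \<gamma> < \<alpha> \<Longrightarrow> A = f (g \<gamma>) \<Longrightarrow> i A = \<gamma>" by metis
  have "\<forall>A. \<exists>\<delta>. \<delta> < \<alpha> \<and> ord1_succ_of \<delta> (i A)" using below i(1) by blast
  then obtain j where j: "\<And>A. j A < \<alpha>" "\<And>A. ord1_succ_of (j A) (i A)" by metis
  have "\<forall>A\<in>\<A>. \<exists>p. ranked_algebra (fst p) (snd p) \<and> A \<in> fst p \<and>
    (\<forall>u. ultrafilter u \<longrightarrow> snd p u \<le> j A) \<and> (\<exists>u. ultrafilter u \<and> has u A \<and> snd p u = j A) \<and>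
    bounded_limits (fst p) (snd p) A"
    using successor_algebra[OF assms \<A>(2) j(2)] by (simp add: split_paired_Ex)
  then obtain p where p: "\<And>A. A \<in> \<A> \<Longrightarrow> ranked_algebra (fst (p A)) (snd (p A)) \<and> A \<in> fst (p A) \<and>
    (\<forall>u. ultrafilter u \<longrightarrow> snd (p A) u \<le> j A) \<and>
    (\<exists>u. ultrafilter u \<and> has u A \<and> snd (p A) u = j A) \<and> bounded_limits (fst (p A)) (snd (p A)) A"
    using bchoice by (metis (lifting))
  define C where "C A = fst (p A)" for A
  define \<rho> where "\<rho> A = snd (p A)" for A
  have C: "ranked_algebra (C A) (\<rho> A)" "A \<in> C A" "\<And>u. ultrafilter u \<Longrightarrow> \<rho> A u \<le> j A"
    "\<exists>u. ultrafilter u \<and> has u A \<and> \<rho> A u = j A" "bounded_limits (C A) (\<rho> A) A"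
    if "A \<in> \<A>" for A
    using p[OF that] by (simp_all add: C_def \<rho>_def)
  have \<rho>_less: "\<rho> A u < \<alpha>" if "A \<in> \<A>" "ultrafilter u" for A u
    using C(3)[OF that] j(1)[of A] by simp
  have "infinite (range f)" using f(3) by (simp add: finite_image_iff Finite_Set.finite_set)
  interpret mad_sum \<A> C \<rho>
  proof (rule mad_sum.intro)
    show "infinite \<A>" using \<open>infinite (range f)\<close> \<A>(1) finite_subset by blast
    show "\<rho> A u < omega1" if "A \<in> \<A>" "ultrafilter u" for A u
      using \<rho>_less[OF that] ord1_le_omega1[of \<alpha>] by simp
  qed (use \<A> C in auto)
  let ?X = "alg_space sum_alg"
  show ?thesis
  proof (rule alg_space_order[OF sum_algebra])
    fix M assume M: "M \<subseteq> topspace ?X"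
    show "?X closure_of M \<subseteq> seqcl_iter ?X \<alpha> M"
    proof
      fix x assume x: "x \<in> ?X closure_of M"
      then obtain u where u: "ultrafilter u" "x = alg_class sum_alg u"
        using alg_space_cases by (metis in_closure_of)
      obtain z :: ord1 where z: "\<And>\<gamma>. z \<le> \<gamma>" using ord1_zero by blast
      have z\<alpha>: "z < \<alpha>" using z[of \<beta>] limit(1) by simp
      show "x \<in> seqcl_iter ?X \<alpha> M"
      proof (cases "at_infinity u")
        case True
        \<comment> \<open>Infinity needs two closures, and the second successor of zero is still
          below the limit \<alpha>.\<close>
        obtain \<delta>1 where \<delta>1: "\<delta>1 < \<alpha>" "ord1_succ_of \<delta>1 z" using below[OF z\<alpha>] by blast
        obtain \<delta>2 where \<delta>2: "\<delta>2 < \<alpha>" "ord1_succ_of \<delta>2 \<delta>1" using below[OF \<delta>1(1)] by blast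
        have "seqcl_iter ?X z M = M" using z by (intro seqcl_iter_zero) (simp add: not_less)
        then have "seqcl_iter ?X \<delta>2 M = seqcl ?X (seqcl ?X M)"
          using \<delta>1(2) \<delta>2(2) by (simp add: seqcl_iter_succ)
        then have "x \<in> seqcl_iter ?X \<delta>2 M" using at_infinity_closure[OF M True] x u(2) by simp
        then show ?thesis using seqcl_iter_mono_ord[OF M, of \<delta>2 \<alpha>] \<delta>2(1) by (meson less_imp_le subsetD)
      next
        case False
        have lt: "sum_rank u < \<alpha>"
          using u(1)
        proof (cases rule: sum_cases)
          case (1 A)
          then show ?thesis using sum_rank_component[OF 1(1) u(1) 1(2)] \<rho>_less[OF 1(1) u(1)] by simp
        next
          case (2 n)
          then show ?thesis using sum_rank_principal[OF 2, of z] z\<alpha> by simp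
        qed (use False in simp)
        have r: "alg_rank sum_rank x = sum_rank u" using u by (simp add: alg_rank_class)
        have "x \<in> seqcl_iter ?X (sum_rank u) M"
          using closure_imp_seqcl_iter[OF M x] sum_rank_less_omega1[OF u(1) False] r by simp
        then show ?thesis using seqcl_iter_mono_ord[OF M, of "sum_rank u" \<alpha>] lt by (meson less_imp_le subsetD)
      qed
    qed
  next
    fix \<gamma> assume \<gamma>: "\<gamma> < \<alpha>"
    \<comment> \<open>The component reserved for \<gamma> contains a point of rank \<gamma> + 1. The
      bound on limits carries over from it to the sum because its cell is closed under limits of
      sequences.\<close>
    define A where "A = f (g \<gamma>)"
    have A: "A \<in> \<A>" using \<A>(1) by (auto simp: A_def)
    have "i A = \<gamma>" using i(2)[OF \<gamma>] by (simp add: A_def)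
    then have "\<gamma> < j A" using j(2)[of A] by (simp add: ord1_succ_of_def)
    moreover obtain u where u: "ultrafilter u" "has u A" "\<rho> A u = j A" using C(4)[OF A] by blast
    ultimately have "\<gamma> < sum_rank u" using sum_rank_component[OF A u(1,2)] by simp
    moreover have "bounded_limits sum_alg sum_rank A"
      unfolding bounded_limits_def
    proof (intro allI impI)
      fix s :: "nat \<Rightarrow> nat filter" and \<gamma>' \<delta>
      assume s: "\<forall>n. ultrafilter (s n) \<and> has (s n) A" "\<forall>n. sum_rank (s n) \<le> \<gamma>'"
        and \<delta>: "ord1_succ_of \<delta> \<gamma>'"
      have "\<rho> A (s n) \<le> \<gamma>'" for n using s sum_rank_component[OF A, of "s n"] by metis
      then obtain k v where k: "strict_mono k" and v: "ultrafilter v" "alg_lim (C A) (s \<circ> k) v" "\<rho> A v \<le> \<delta>"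
        using C(5)[OF A] s(1) \<delta> unfolding bounded_limits_def by blast
      have vA: "has v A"
        by (rule ranked_algebra.lim_has[OF C(1)[OF A] v(2) _ v(1) C(2)[OF A]]) (use s in auto)
      then have "alg_lim sum_alg (s \<circ> k) v" "sum_rank v \<le> \<delta>"
        using lim_component[OF A v(2)] sum_rank_component[OF A v(1)] v(3) by simp_all
      then show "\<exists>k v. strict_mono k \<and> ultrafilter v \<and> alg_lim sum_alg (s \<circ> k) v \<and> sum_rank v \<le> \<delta>"
        using k v(1) by blast
    qed
    ultimately show "\<exists>M\<subseteq>topspace ?X. seqcl_iter ?X \<gamma> M \<noteq> ?X closure_of M"
      using seqcl_iter_principal_neq_closure[OF member_sum_alg[OF A] u(1,2)] by blast
  qed
qed

end
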